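(* Let $k$ be a field of characteristic $p\ge3$, let $r,s\ge1$, and let $G$ be an algebraic $k$-supergroup scheme. Then $k[V_{r;s}(G)]$ is a $\mathbb Z[\frac{p^r}{2}]$-graded connected $k$-algebra (i.e. its degree-$0$ component is $k$). If $G\to G'$ is a homomorphism of algebraic $k$-supergroup schemes, then the corresponding algebra map $k[V_{r;s}(G')]\to k[V_{r;s}(G)]$ respects gradings.
   Context: "Super" means $\mathbb Z_2$-graded with the usual signs; a superalgebra is commutative if $ba=(-1)^{\bar a\bar b}ab$. An affine $k$-supergroup scheme $G$ is a representable functor from commutative $k$-superalgebras to groups; it is algebraic if $k[G]$ is finitely generated. $k[\mathbb M_{r;s}]$ is the commutative superalgebra generated by $\tau$ odd, $\theta$ even and $\sigma_i$ even ($0\le i<p^s$), with $\sigma_0=1$, $\tau^2=0$, $\theta^{p^{r-1}}=\sigma_1$, $\sigma_i\sigma_j=\binom{i+j}{i}\sigma_{i+j}$; it is a Hopf superalgebra with $\tau,\theta$ primitive and $\Delta(\sigma_i)=\sum_{a+b=i}\sigma_a\otimes\sigma_b+\sum_{a+b+p=i}\sigma_a\tau\otimes\sigma_b\tau$. $\mathbb M_{r;s}$ is the corresponding finite supergroup scheme. $\mathbf{Hom}(\mathbb M_{r;s},G)$ is the functor sending a commutative superalgebra $A$ to the set of $A$-supergroup scheme homomorphisms $\mathbb M_{r;s}\otimes_kA\to G\otimes_kA$; it is an affine superscheme of finite type. $V_{r;s}(G)$ is its underlying purely even subscheme: $k[V_{r;s}(G)]$ is the quotient of $k[\mathbf{Hom}(\mathbb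 M_{r;s},G)]$ by the ideal generated by its odd elements. The grading: let $B=k[x,y]/\langle x^{p^r}-y^2\rangle$; $\mathrm{Spec}(B)$ is a monoid scheme via $x\mapsto x\otimes x$, $y\mapsto y\otimes y$. A point $(\mu,a)$ of $\mathrm{Spec}(B)$ ($x\mapsto a$, $y\mapsto\mu$, $\mu^2=a^{p^r}$) gives the endomorphism $\rho_{(\mu,a)}$ of $\mathbb M_{r;s}$ with comorphism $\tau\mapsto\tau\cdot\mu$, $\theta\mapsto\theta\cdot a$, $\sigma_i\mapsto\sigma_i\cdot a^{ip^{r-1}}$, and $\mathrm{Spec}(B)$ acts on $\mathbf{Hom}(\mathbb M_{r;s},G)$ on the right by precomposition. Writing the coaction on $z\in k[\mathbf{Hom}(\mathbb M_{r;s},G)]$ as $\sum_{i\ge0}[\phi_i(z)\otimes x^i+\psi_i(z)\otimes x^iy]$, the maps $\phi_i,\psi_i$ are the projections onto the components of degrees $i$ and $i+\frac{p^r}{2}$; this grading induces the grading on the quotient $k[V_{r;s}(G)]$. *)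

theory Defs
  imports Complex_Main "HOL-Algebra.Module" "HOL-Algebra.QuotRing" "HOL-Algebra.Subrings"
begin

section \<open>Commutative superalgebras over a field\<close>

text \<open>
  The ground field and all test superalgebras of functors live in one type \<open>'u\<close>, which plays the
  role of a universe. When \<open>'u\<close> is infinite and contains the field, then up to isomorphism it
  contains every finitely generated superalgebra over the field, and it is closed under tensor
  products of superalgebras over the field.
\<close>

record ('k, 'a) superalg = "('k, 'a) module" +
  evens :: "'a set"
  odds :: "'a set"

definition has_characteristic :: "('a, 'b) ring_scheme \<Rightarrow> nat \<Rightarrow> bool" where
  "has_characteristic K p \<longleftrightarrow> (\<forall>n :: nat. [n] \<cdot>\<^bsub>K\<^esub> \<one>\<^bsub>K\<^esub> = \<zero>\<^bsub>K\<^esub> \<longleftrightarrow> p dvd n)"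

locale superalgebra = module K A + ring A
  for K :: "'k ring" and A :: "('k, 'a) superalg" (structure) +
  assumes smult_mult_left: "\<lbrakk>c \<in> carrier K; x \<in> carrier A; y \<in> carrier A\<rbrakk>
      \<Longrightarrow> (c \<odot> x) \<otimes> y = c \<odot> (x \<otimes> y)"
    and smult_mult_right: "\<lbrakk>c \<in> carrier K; x \<in> carrier A; y \<in> carrier A\<rbrakk>
      \<Longrightarrow> x \<otimes> (c \<odot> y) = c \<odot> (x \<otimes> y)"
    and evens_submodule: "submodule (evens A) K A"
    and odds_submodule: "submodule (odds A) K A"
    and parity_decomposition: "x \<in> carrier A
      \<Longrightarrow> \<exists>!w. fst w \<in> evens A \<and> snd w \<in> odds A \<and> x = fst w \<oplus> snd w"
    and one_even: "\<one> \<in> evens A"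
    and even_even: "\<lbrakk>x \<in> evens A; y \<in> evens A\<rbrakk> \<Longrightarrow> x \<otimes> y \<in> evens A"
    and even_odd: "\<lbrakk>x \<in> evens A; y \<in> odds A\<rbrakk> \<Longrightarrow> x \<otimes> y \<in> odds A"
    and odd_even: "\<lbrakk>x \<in> odds A; y \<in> evens A\<rbrakk> \<Longrightarrow> x \<otimes> y \<in> odds A"
    and odd_odd: "\<lbrakk>x \<in> odds A; y \<in> odds A\<rbrakk> \<Longrightarrow> x \<otimes> y \<in> evens A"

locale comm_superalgebra = superalgebra K A
  for K :: "'k ring" and A :: "('k, 'a) superalg" (structure) +
  assumes even_comm: "\<lbrakk>x \<in> evens A; y \<in> evens A \<union> odds A\<rbrakk> \<Longrightarrow> y \<otimes> x = x \<otimes> y"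
    and odd_anticomm: "\<lbrakk>x \<in> odds A; y \<in> odds A\<rbrakk> \<Longrightarrow> y \<otimes> x = \<ominus> (x \<otimes> y)"

definition superhom ::
  "'k ring \<Rightarrow> ('k, 'a) superalg \<Rightarrow> ('k, 'b) superalg \<Rightarrow> ('a \<Rightarrow> 'b) set" where
  "superhom K A B = {f \<in> ring_hom A B. f \<in> extensional (carrier A) \<and>
     (\<forall>c \<in> carrier K. \<forall>x \<in> carrier A. f (c \<odot>\<^bsub>A\<^esub> x) = c \<odot>\<^bsub>B\<^esub> f x) \<and>
     f ` evens A \<subseteq> evens B \<and> f ` odds A \<subseteq> odds B}"

definition finitely_generated :: "'k ring \<Rightarrow> ('k, 'a) superalg \<Rightarrow> bool" where
  "finitely_generated K A \<longleftrightarrow> (\<exists>S. finite S \<and> S \<subseteq> carrier A \<and>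
     (\<forall>T. subring T A \<and> submodule T K A \<and> S \<subseteq> T \<longrightarrow> T = carrier A))"


section \<open>Representable functors and supergroup schemes\<close>

text \<open>
  A natural isomorphism \<open>rep\<close> from the functor of superalgebra homomorphisms out of \<open>R\<close> to the
  set-valued functor with object map \<open>S\<close> and arrow map \<open>Smap\<close>.
\<close>

definition represents ::
  "'u ring \<Rightarrow> ('u, 'u) superalg \<Rightarrow> (('u, 'u) superalg \<Rightarrow> 'x set) \<Rightarrow>
   (('u, 'u) superalg \<Rightarrow> ('u, 'u) superalg \<Rightarrow> ('u \<Rightarrow> 'u) \<Rightarrow> 'x \<Rightarrow> 'x) \<Rightarrow>
   (('u, 'u) superalg \<Rightarrow> ('u \<Rightarrow> 'u) \<Rightarrow> 'x) \<Rightarrow> bool" where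
  "represents K R S Smap rep \<longleftrightarrow> comm_superalgebra K R \<and>
     (\<forall>A. comm_superalgebra K A \<longrightarrow> bij_betw (rep A) (superhom K R A) (S A)) \<and>
     (\<forall>A A' f h. comm_superalgebra K A \<and> comm_superalgebra K A' \<and>
        f \<in> superhom K A A' \<and> h \<in> superhom K R A \<longrightarrow>
        rep A' (compose (carrier R) f h) = Smap A A' f (rep A h))"

record ('u, 'g) group_functor =
  fobj :: "('u, 'u) superalg \<Rightarrow> 'g monoid"
  fmap :: "('u, 'u) superalg \<Rightarrow> ('u, 'u) superalg \<Rightarrow> ('u \<Rightarrow> 'u) \<Rightarrow> 'g \<Rightarrow> 'g"

definition is_group_functor :: "'u ring \<Rightarrow> ('u, 'g) group_functor \<Rightarrow> bool" where
  "is_group_functor K F \<longleftrightarrow>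
     (\<forall>A. comm_superalgebra K A \<longrightarrow> Group.group (fobj F A) \<and>
        (\<forall>x \<in> carrier (fobj F A). fmap F A A (\<lambda>a \<in> carrier A. a) x = x)) \<and>
     (\<forall>A A' f. comm_superalgebra K A \<and> comm_superalgebra K A' \<and> f \<in> superhom K A A' \<longrightarrow>
        fmap F A A' f \<in> hom (fobj F A) (fobj F A')) \<and>
     (\<forall>A A' A'' f g. comm_superalgebra K A \<and> comm_superalgebra K A' \<and> comm_superalgebra K A'' \<and>
        f \<in> superhom K A A' \<and> g \<in> superhom K A' A'' \<longrightarrow>
        (\<forall>x \<in> carrier (fobj F A).
           fmap F A A'' (compose (carrier A) g f) x = fmap F A' A'' g (fmap F A A' f x)))"

definition algebraic_supergroup_scheme :: "'u ring \<Rightarrow> ('u, 'g) group_functor \<Rightarrow> bool" where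
  "algebraic_supergroup_scheme K G \<longleftrightarrow> is_group_functor K G \<and>
     (\<exists>H rep. represents K H (\<lambda>A. carrier (fobj G A)) (fmap G) rep \<and> finitely_generated K H)"

definition supergroup_scheme_hom ::
  "'u ring \<Rightarrow> ('u, 'g) group_functor \<Rightarrow> ('u, 'h) group_functor \<Rightarrow>
   (('u, 'u) superalg \<Rightarrow> 'g \<Rightarrow> 'h) \<Rightarrow> bool" where
  "supergroup_scheme_hom K G G' f \<longleftrightarrow>
     (\<forall>A. comm_superalgebra K A \<longrightarrow> f A \<in> hom (fobj G A) (fobj G' A)) \<and>
     (\<forall>A A' g. comm_superalgebra K A \<and> comm_superalgebra K A' \<and> g \<in> superhom K A A' \<longrightarrow>
        (\<forall>x \<in> carrier (fobj G A). f A' (fmap G A A' g x) = fmap G' A A' g (f A x)))"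


section \<open>The finite supergroup scheme M\<close>

text \<open>
  The coordinate superalgebra of \<open>M\<close> is presented by generators and relations, so an \<open>A\<close>-point, that
  is, a superalgebra homomorphism into \<open>A\<close>, is the same thing as the triple \<open>(t, h, \<sigma>)\<close> of the images of
  the generators \<open>\<tau>\<close>, \<open>\<theta>\<close> and \<open>\<sigma>\<^sub>i\<close> (\<open>i < p ^ s\<close>); these have the parities of the generators and satisfy
  the defining relations. For \<open>i, j < p ^ s \<le> i + j\<close> the binomial coefficient of \<open>i + j\<close> over \<open>i\<close> is
  divisible by \<open>p\<close>, so the product of \<open>\<sigma>\<^sub>i\<close> and \<open>\<sigma>\<^sub>j\<close> is then zero.

  The product of points \<open>g\<close> and \<open>h\<close> is the convolution product: it sends a generator with
  comultiplication \<open>\<Sum> u \<otimes> v\<close> to \<open>\<Sum> g(u) h(v)\<close>.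
\<close>

type_synonym 'u M_point = "'u \<times> 'u \<times> (nat \<Rightarrow> 'u)"

definition M_carrier :: "nat \<Rightarrow> nat \<Rightarrow> nat \<Rightarrow> ('u, 'u) superalg \<Rightarrow> 'u M_point set" where
  "M_carrier p r s A = {(t, h, \<sigma>).
     t \<in> odds A \<and> h \<in> evens A \<and> \<sigma> \<in> {..<p ^ s} \<rightarrow>\<^sub>E evens A \<and>
     \<sigma> 0 = \<one>\<^bsub>A\<^esub> \<and> t \<otimes>\<^bsub>A\<^esub> t = \<zero>\<^bsub>A\<^esub> \<and> h [^]\<^bsub>A\<^esub> (p ^ (r - 1)) = \<sigma> 1 \<and>
     (\<forall>i < p ^ s. \<forall>j < p ^ s. \<sigma> i \<otimes>\<^bsub>A\<^esub> \<sigma> j =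
        (if i + j < p ^ s then [((i + j) choose i)] \<cdot>\<^bsub>A\<^esub> \<sigma> (i + j) else \<zero>\<^bsub>A\<^esub>))}"

definition M_mult ::
  "nat \<Rightarrow> nat \<Rightarrow> ('u, 'u) superalg \<Rightarrow> 'u M_point \<Rightarrow> 'u M_point \<Rightarrow> 'u M_point" where
  "M_mult p s A = (\<lambda>(t, h, \<sigma>) (t', h', \<sigma>').
     (t \<oplus>\<^bsub>A\<^esub> t', h \<oplus>\<^bsub>A\<^esub> h',
      \<lambda>i \<in> {..<p ^ s}.
        (\<Oplus>\<^bsub>A\<^esub>w \<in> {(a, b). a + b = i}. \<sigma> (fst w) \<otimes>\<^bsub>A\<^esub> \<sigma>' (snd w)) \<oplus>\<^bsub>A\<^esub>
        (\<Oplus>\<^bsub>A\<^esub>w \<in> {(a, b). a + b + p = i}.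
           (\<sigma> (fst w) \<otimes>\<^bsub>A\<^esub> t) \<otimes>\<^bsub>A\<^esub> (\<sigma>' (snd w) \<otimes>\<^bsub>A\<^esub> t'))))"

definition M_scheme :: "nat \<Rightarrow> nat \<Rightarrow> nat \<Rightarrow> ('u, 'u M_point) group_functor" where
  "M_scheme p r s = \<lparr>
     fobj = (\<lambda>A. \<lparr>carrier = M_carrier p r s A, mult = M_mult p s A,
        one = (\<zero>\<^bsub>A\<^esub>, \<zero>\<^bsub>A\<^esub>, \<lambda>i \<in> {..<p ^ s}. if i = 0 then \<one>\<^bsub>A\<^esub> else \<zero>\<^bsub>A\<^esub>)\<rparr>),
     fmap = (\<lambda>A A' f (t, h, \<sigma>). (f t, f h, \<lambda>i \<in> {..<p ^ s}. f (\<sigma> i)))\<rparr>"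


section \<open>The functor of homomorphisms from M to G\<close>

text \<open>
  An \<open>A\<close>-superalgebra is a pair of a commutative superalgebra and its structure map. The base change
  to \<open>A\<close> of a functor is its restriction along the functor that forgets the structure map.
\<close>

definition superalgebras_over ::
  "'u ring \<Rightarrow> ('u, 'u) superalg \<Rightarrow> (('u, 'u) superalg \<times> ('u \<Rightarrow> 'u)) set" where
  "superalgebras_over K A = {(B, j). comm_superalgebra K B \<and> j \<in> superhom K A B}"

definition base_changed_homs ::
  "'u ring \<Rightarrow> ('u, 'm) group_functor \<Rightarrow> ('u, 'g) group_functor \<Rightarrow> ('u, 'u) superalg \<Rightarrow>
   (('u, 'u) superalg \<times> ('u \<Rightarrow> 'u) \<Rightarrow> 'm \<Rightarrow> 'g) set" where
  "base_changed_homs K M G A = {\<eta> \<in> extensional (superalgebras_over K A).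
     (\<forall>(B, j) \<in> superalgebras_over K A.
        \<eta> (B, j) \<in> hom (fobj M B) (fobj G B) \<inter> extensional (carrier (fobj M B))) \<and>
     (\<forall>(B, j) \<in> superalgebras_over K A. \<forall>(B', j') \<in> superalgebras_over K A.
        \<forall>g \<in> superhom K B B'. compose (carrier A) g j = j' \<longrightarrow>
        (\<forall>x \<in> carrier (fobj M B).
           \<eta> (B', j') (fmap M B B' g x) = fmap G B B' g (\<eta> (B, j) x)))}"

definition base_change ::
  "'u ring \<Rightarrow> ('u, 'u) superalg \<Rightarrow> ('u, 'u) superalg \<Rightarrow> ('u \<Rightarrow> 'u) \<Rightarrow>
   (('u, 'u) superalg \<times> ('u \<Rightarrow> 'u) \<Rightarrow> 'm \<Rightarrow> 'g) \<Rightarrow>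
   (('u, 'u) superalg \<times> ('u \<Rightarrow> 'u) \<Rightarrow> 'm \<Rightarrow> 'g)" where
  "base_change K A A' f \<eta> =
     restrict (\<lambda>(B, j). \<eta> (B, compose (carrier A) j f)) (superalgebras_over K A')"

type_synonym ('u, 'g) Hom_rep =
  "('u, 'u) superalg \<Rightarrow> ('u \<Rightarrow> 'u) \<Rightarrow>
   (('u, 'u) superalg \<times> ('u \<Rightarrow> 'u) \<Rightarrow> 'u M_point \<Rightarrow> 'g)"

text \<open>\<open>R\<close>, together with \<open>rep\<close>, is the coordinate superalgebra of \<open>Hom(M, G)\<close>.\<close>

definition is_coordinate_superalgebra_of_Hom ::
  "'u ring \<Rightarrow> nat \<Rightarrow> nat \<Rightarrow> nat \<Rightarrow> ('u, 'g) group_functor \<Rightarrow> ('u, 'u) superalg \<Rightarrow>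
   ('u, 'g) Hom_rep \<Rightarrow> bool" where
  "is_coordinate_superalgebra_of_Hom K p r s G R rep \<longleftrightarrow>
     represents K R (base_changed_homs K (M_scheme p r s) G) (base_change K) rep"


section \<open>The action of Spec(B) and the degree components\<close>

text \<open>
  \<open>B = k[x, y] / (x ^ (p ^ r) - y ^ 2)\<close> is purely even, so its \<open>A\<close>-points are pairs of even elements,
  the images of \<open>y\<close> and \<open>x\<close>.
\<close>

definition Spec_B :: "nat \<Rightarrow> nat \<Rightarrow> ('u, 'u) superalg \<Rightarrow> ('u \<times> 'u) set" where
  "Spec_B p r A = {(\<mu>, a). \<mu> \<in> evens A \<and> a \<in> evens A \<and> \<mu> \<otimes>\<^bsub>A\<^esub> \<mu> = a [^]\<^bsub>A\<^esub> (p ^ r)}"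

definition M_endo ::
  "nat \<Rightarrow> nat \<Rightarrow> nat \<Rightarrow> ('u, 'u) superalg \<Rightarrow> 'u \<times> 'u \<Rightarrow> 'u M_point \<Rightarrow> 'u M_point" where
  "M_endo p r s A = (\<lambda>(\<mu>, a) (t, h, \<sigma>).
     (t \<otimes>\<^bsub>A\<^esub> \<mu>, h \<otimes>\<^bsub>A\<^esub> a, \<lambda>i \<in> {..<p ^ s}. \<sigma> i \<otimes>\<^bsub>A\<^esub> a [^]\<^bsub>A\<^esub> (i * p ^ (r - 1))))"

definition right_action ::
  "'u ring \<Rightarrow> nat \<Rightarrow> nat \<Rightarrow> nat \<Rightarrow> ('u, 'u) superalg \<Rightarrow> 'u \<times> 'u \<Rightarrow>
   (('u, 'u) superalg \<times> ('u \<Rightarrow> 'u) \<Rightarrow> 'u M_point \<Rightarrow> 'g) \<Rightarrow>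
   (('u, 'u) superalg \<times> ('u \<Rightarrow> 'u) \<Rightarrow> 'u M_point \<Rightarrow> 'g)" where
  "right_action K p r s A = (\<lambda>(\<mu>, a) \<eta>. restrict
     (\<lambda>(B, j). \<lambda>m \<in> M_carrier p r s B. \<eta> (B, j) (M_endo p r s B (j \<mu>, j a) m))
     (superalgebras_over K A))"

text \<open>
  Since \<open>x ^ i\<close> and \<open>x ^ i * y\<close> (\<open>i \<ge> 0\<close>) form a basis of \<open>B\<close>, an element
  \<open>\<Sum> (u i \<otimes> x ^ i + v i \<otimes> x ^ i * y)\<close> of the tensor product of \<open>R\<close> and \<open>B\<close> is given by its two
  finitely supported sequences of coefficients \<open>(u, v)\<close>.
\<close>

definition finite_seqs :: "('a, 'm) ring_scheme \<Rightarrow> (nat \<Rightarrow> 'a) set" where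
  "finite_seqs R = {u. range u \<subseteq> carrier R \<and> finite {i. u i \<noteq> \<zero>\<^bsub>R\<^esub>}}"

text \<open>The value at \<open>(u, v)\<close> of the pairing of \<open>h : R \<rightarrow> A\<close> and the point \<open>(\<mu>, a)\<close> of \<open>Spec(B)\<close>.\<close>

definition pair_points ::
  "('u, 'u) superalg \<Rightarrow> ('u, 'u) superalg \<Rightarrow> ('u \<Rightarrow> 'u) \<Rightarrow> 'u \<times> 'u \<Rightarrow>
   (nat \<Rightarrow> 'u) \<times> (nat \<Rightarrow> 'u) \<Rightarrow> 'u" where
  "pair_points R A h = (\<lambda>(\<mu>, a) (u, v).
     (\<Oplus>\<^bsub>A\<^esub>i \<in> {i. u i \<noteq> \<zero>\<^bsub>R\<^esub>}. h (u i) \<otimes>\<^bsub>A\<^esub> a [^]\<^bsub>A\<^esub> (i :: nat)) \<oplus>\<^bsub>A\<^esub>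
     (\<Oplus>\<^bsub>A\<^esub>i \<in> {i. v i \<noteq> \<zero>\<^bsub>R\<^esub>}. h (v i) \<otimes>\<^bsub>A\<^esub> (a [^]\<^bsub>A\<^esub> (i :: nat) \<otimes>\<^bsub>A\<^esub> \<mu>)))"

text \<open>
  The coaction is the comorphism of the action: for all points \<open>h\<close> of \<open>Hom(M, G)\<close> and \<open>b\<close> of
  \<open>Spec(B)\<close>, following it by the pairing with \<open>h\<close> and \<open>b\<close> gives the point \<open>h \<cdot> b\<close>.
\<close>

definition is_coaction ::
  "'u ring \<Rightarrow> nat \<Rightarrow> nat \<Rightarrow> nat \<Rightarrow> ('u, 'u) superalg \<Rightarrow> ('u, 'g) Hom_rep \<Rightarrow>
   ('u \<Rightarrow> (nat \<Rightarrow> 'u) \<times> (nat \<Rightarrow> 'u)) \<Rightarrow> bool" where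
  "is_coaction K p r s R rep \<delta> \<longleftrightarrow>
     \<delta> \<in> carrier R \<rightarrow>\<^sub>E finite_seqs R \<times> finite_seqs R \<and>
     (\<forall>A. comm_superalgebra K A \<longrightarrow> (\<forall>h \<in> superhom K R A. \<forall>b \<in> Spec_B p r A.
        (\<lambda>z \<in> carrier R. pair_points R A h b (\<delta> z)) \<in> superhom K R A \<and>
        rep A (\<lambda>z \<in> carrier R. pair_points R A h b (\<delta> z)) =
          right_action K p r s A b (rep A h)))"

definition coaction ::
  "'u ring \<Rightarrow> nat \<Rightarrow> nat \<Rightarrow> nat \<Rightarrow> ('u, 'u) superalg \<Rightarrow> ('u, 'g) Hom_rep \<Rightarrow>
   'u \<Rightarrow> (nat \<Rightarrow> 'u) \<times> (nat \<Rightarrow> 'u)" where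
  "coaction K p r s R rep = (THE \<delta>. is_coaction K p r s R rep \<delta>)"

definition phi ::
  "'u ring \<Rightarrow> nat \<Rightarrow> nat \<Rightarrow> nat \<Rightarrow> ('u, 'u) superalg \<Rightarrow> ('u, 'g) Hom_rep \<Rightarrow> nat \<Rightarrow> 'u \<Rightarrow> 'u" where
  "phi K p r s R rep i z = fst (coaction K p r s R rep z) i"

definition psi ::
  "'u ring \<Rightarrow> nat \<Rightarrow> nat \<Rightarrow> nat \<Rightarrow> ('u, 'u) superalg \<Rightarrow> ('u, 'g) Hom_rep \<Rightarrow> nat \<Rightarrow> 'u \<Rightarrow> 'u" where
  "psi K p r s R rep i z = snd (coaction K p r s R rep z) i"

text \<open>
  For odd \<open>p\<close> the degrees \<open>i\<close> are integers and the degrees \<open>i + p ^ r / 2\<close> are not, so at most one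
  of the first two sets below is nonempty; in all other degrees the component is zero.
\<close>

definition Hom_component ::
  "'u ring \<Rightarrow> nat \<Rightarrow> nat \<Rightarrow> nat \<Rightarrow> ('u, 'u) superalg \<Rightarrow> ('u, 'g) Hom_rep \<Rightarrow> rat \<Rightarrow> 'u set" where
  "Hom_component K p r s R rep d =
     {phi K p r s R rep i z | i z. z \<in> carrier R \<and> d = of_nat i} \<union>
     {psi K p r s R rep i z | i z. z \<in> carrier R \<and> d = of_nat i + of_nat (p ^ r) / 2} \<union>
     {\<zero>\<^bsub>R\<^esub>}"


section \<open>The coordinate algebra of V and its grading\<close>

definition odd_ideal :: "('u, 'u) superalg \<Rightarrow> 'u set" where
  "odd_ideal R = Idl\<^bsub>R\<^esub> (odds R)"

definition V_algebra :: "('u, 'u) superalg \<Rightarrow> ('u, 'u set) module" where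
  "V_algebra R = ring.extend (R Quot (odd_ideal R))
     (module.fields (\<lambda>c X. \<Union>z \<in> X. odd_ideal R +>\<^bsub>R\<^esub> (c \<odot>\<^bsub>R\<^esub> z)))"

definition V_component ::
  "'u ring \<Rightarrow> nat \<Rightarrow> nat \<Rightarrow> nat \<Rightarrow> ('u, 'u) superalg \<Rightarrow> ('u, 'g) Hom_rep \<Rightarrow> rat \<Rightarrow> 'u set set" where
  "V_component K p r s R rep d =
     (\<lambda>z. odd_ideal R +>\<^bsub>R\<^esub> z) ` Hom_component K p r s R rep d"

text \<open>The additive subgroup of the rationals generated by \<open>1\<close> and \<open>p ^ r / 2\<close>.\<close>

definition degree_group :: "nat \<Rightarrow> nat \<Rightarrow> rat set" where
  "degree_group p r = {of_int m + of_int n * (of_nat (p ^ r) / 2) | m n. True}"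

definition graded_algebra ::
  "'k ring \<Rightarrow> ('k, 'a) module \<Rightarrow> rat set \<Rightarrow> (rat \<Rightarrow> 'a set) \<Rightarrow> bool" where
  "graded_algebra K A D C \<longleftrightarrow> algebra K A \<and>
     (\<forall>d \<in> D. submodule (C d) K A) \<and>
     (\<forall>z \<in> carrier A. \<exists>!w. w \<in> (\<Pi>\<^sub>E d \<in> D. C d) \<and> finite {d \<in> D. w d \<noteq> \<zero>\<^bsub>A\<^esub>} \<and>
        z = (\<Oplus>\<^bsub>A\<^esub>d \<in> {d \<in> D. w d \<noteq> \<zero>\<^bsub>A\<^esub>}. w d)) \<and>
     \<one>\<^bsub>A\<^esub> \<in> C 0 \<and>
     (\<forall>d \<in> D. \<forall>e \<in> D. \<forall>x \<in> C d. \<forall>y \<in> C e. x \<otimes>\<^bsub>A\<^esub> y \<in> C (d + e))"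

definition connected_grading ::
  "'k ring \<Rightarrow> ('k, 'a) module \<Rightarrow> (rat \<Rightarrow> 'a set) \<Rightarrow> bool" where
  "connected_grading K A C \<longleftrightarrow> bij_betw (\<lambda>c. c \<odot>\<^bsub>A\<^esub> \<one>\<^bsub>A\<^esub>) (carrier K) (C 0)"


section \<open>Functoriality in G\<close>

definition pushforward ::
  "'u ring \<Rightarrow> ('u, 'm) group_functor \<Rightarrow> (('u, 'u) superalg \<Rightarrow> 'g \<Rightarrow> 'h) \<Rightarrow> ('u, 'u) superalg \<Rightarrow>
   (('u, 'u) superalg \<times> ('u \<Rightarrow> 'u) \<Rightarrow> 'm \<Rightarrow> 'g) \<Rightarrow>
   (('u, 'u) superalg \<times> ('u \<Rightarrow> 'u) \<Rightarrow> 'm \<Rightarrow> 'h)" where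
  "pushforward K M f A \<eta> = restrict
     (\<lambda>(B, j). \<lambda>x \<in> carrier (fobj M B). f B (\<eta> (B, j) x)) (superalgebras_over K A)"

definition Hom_comorphism ::
  "'u ring \<Rightarrow> nat \<Rightarrow> nat \<Rightarrow> nat \<Rightarrow> ('u, 'u) superalg \<Rightarrow> ('u, 'g) Hom_rep \<Rightarrow>
   ('u, 'u) superalg \<Rightarrow> ('u, 'h) Hom_rep \<Rightarrow> (('u, 'u) superalg \<Rightarrow> 'g \<Rightarrow> 'h) \<Rightarrow> 'u \<Rightarrow> 'u" where
  "Hom_comorphism K p r s R rep R' rep' f = (THE F. F \<in> superhom K R' R \<and>
     (\<forall>A. comm_superalgebra K A \<longrightarrow> (\<forall>h \<in> superhom K R A.
        rep' A (compose (carrier R') h F) = pushforward K (M_scheme p r s) f A (rep A h))))"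

definition V_comorphism ::
  "'u ring \<Rightarrow> nat \<Rightarrow> nat \<Rightarrow> nat \<Rightarrow> ('u, 'u) superalg \<Rightarrow> ('u, 'g) Hom_rep \<Rightarrow>
   ('u, 'u) superalg \<Rightarrow> ('u, 'h) Hom_rep \<Rightarrow> (('u, 'u) superalg \<Rightarrow> 'g \<Rightarrow> 'h) \<Rightarrow>
   'u set \<Rightarrow> 'u set" where
  "V_comorphism K p r s R rep R' rep' f X =
     (\<Union>z \<in> X. odd_ideal R +>\<^bsub>R\<^esub> Hom_comorphism K p r s R rep R' rep' f z)"

definition algebra_hom :: "'k ring \<Rightarrow> ('k, 'a) module \<Rightarrow> ('k, 'b) module \<Rightarrow> ('a \<Rightarrow> 'b) set" where
  "algebra_hom K A B = {F \<in> ring_hom A B.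
     \<forall>c \<in> carrier K. \<forall>x \<in> carrier A. F (c \<odot>\<^bsub>A\<^esub> x) = c \<odot>\<^bsub>B\<^esub> F x}"

end

theory Submission
  imports Defs "HOL-Algebra.UnivPoly" "HOL-Computational_Algebra.Primes"
begin

text \<open>
  A representing object of a functor with an action of the monoid \<open>Spec(B)\<close> carries a coaction of
  \<open>B\<close>, and such a coaction is a grading. The proof makes this precise for \<open>Hom(M, G)\<close> and then reads off
  the degree zero part.

  \<^bold>\<open>The coaction.\<close> Under \<open>x \<mapsto> t\<^sup>2\<close> and \<open>y \<mapsto> t ^ (p ^ r)\<close> the algebra \<open>B\<close> becomes the monoid
  algebra of the submonoid \<open>S\<close> of the natural numbers generated by \<open>2\<close> and \<open>p ^ r\<close>; since \<open>p\<close> is odd,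
  \<open>x ^ i\<close> and \<open>x ^ i * y\<close> are the monomials \<open>t ^ n\<close> with \<open>n\<close> in \<open>S\<close>, and \<open>n\<close> is twice the degree. Hence
  \<open>R \<otimes> B\<close> is the superalgebra \<open>R[S]\<close> of polynomials over \<open>R\<close> with exponents in \<open>S\<close>. As the universe is
  infinite, \<open>R[S]\<close> has a copy in it (\<open>infinite_inj_up\<close>). The inclusion of \<open>R\<close> and the point
  \<open>(t ^ (p ^ r), t\<^sup>2)\<close> are the universal pair of a point of \<open>Hom(M, G)\<close> and a point of \<open>Spec(B)\<close>, and the
  product of the two is a homomorphism from \<open>R\<close> to \<open>R[S]\<close>; it is the only possible coaction, and
  naturality shows that it is one (\<open>coaction_ex1\<close>). The action is defined because the points of \<open>Spec(B)\<close>
  act on \<open>M\<close> by endomorphisms (\<open>M_endo_mult\<close>) and because the points of \<open>M\<close> are closed under the convolution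
  product (\<open>M_mult_closed\<close>). The latter says that the comultiplication respects the relations of
  \<open>k[M]\<close>, which comes down to Vandermonde's identity and to the behaviour of binomial coefficients
  modulo \<open>p\<close>.

  \<^bold>\<open>The grading.\<close> The coefficients of the coaction are maps \<open>component n\<close> from \<open>R\<close> to itself.
  Multiplicativity of the coaction is the product rule for components, the neutral point \<open>(1, 1)\<close> gives
  that an element is the sum of its components (\<open>component_sum\<close>), and associativity of the action gives that
  components are orthogonal idempotents (\<open>component_component\<close>). They preserve odd elements, so the
  ideal generated by the odd elements is homogeneous (\<open>component_I\<close>) and the quotient inherits the grading.

  \<^bold>\<open>Degree zero.\<close> The point \<open>(0, 0)\<close> sends \<open>M\<close> to its identity, so it moves every homomorphism from
  \<open>M\<close> to \<open>G\<close> to the trivial one, which is defined over \<open>k\<close>. On the other hand it singles out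
  the component of degree zero. Hence that component takes values in \<open>k\<close>, through a homomorphism from \<open>R\<close> to
  \<open>k\<close> (\<open>augmentation\<close>). This homomorphism kills the odd elements, which shows that \<open>k\<close> survives in the quotient.

  \<^bold>\<open>Functoriality.\<close> Composing with \<open>G \<rightarrow> G'\<close> commutes with the action of \<open>Spec(B)\<close>, which acts on
  \<open>M\<close>. So the comorphism commutes with components (\<open>Hom_comorphism_component\<close>).
\<close>

section \<open>Binomial coefficients modulo a prime and finite sums\<close>

lemma prime_dvd_prime_power_choose:
  fixes p :: nat
  assumes "prime p" "0 < k" "k < p ^ s"
  shows "p dvd (p ^ s choose k)"
proof (rule ccontr)
  assume n: "\<not> p dvd (p ^ s choose k)"
  have "k * (p ^ s choose k) = p ^ s * ((p ^ s - 1) choose (k - 1))"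
    using times_binomial_minus1_eq[OF assms(2)] by simp
  then have "p ^ s dvd k * (p ^ s choose k)" by simp
  moreover have "coprime (p ^ s) (p ^ s choose k)"
    using n assms(1) prime_imp_coprime by auto
  ultimately have "p ^ s dvd k" by (simp add: coprime_dvd_mult_left_iff)
  then show False using assms by (auto dest: dvd_imp_le)
qed

text \<open>
  Comparison of coefficients in \<open>(1 + X) ^ (p ^ s + m) = (1 + X ^ (p ^ s)) * (1 + X) ^ m\<close> over the field
  with \<open>p\<close> elements.
\<close>

lemma choose_add_prime_power_mod:
  fixes p :: nat
  assumes p: "prime p"
  shows "(p ^ s + m choose i) mod p =
    ((m choose i) + (if p ^ s \<le> i then m choose (i - p ^ s) else 0)) mod p"
proof -
  let ?q = "p ^ s"
  have q: "?q > 0" using p by (simp add: prime_gt_0_nat)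
  have "(?q + m choose i) mod p = (\<Sum>k\<le>i. (?q choose k) * (m choose (i - k))) mod p"
    by (simp add: vandermonde)
  also have "\<dots> = (\<Sum>k\<le>i. ((?q choose k) * (m choose (i - k))) mod p) mod p"
    by (simp add: mod_sum_eq)
  also have "\<dots> = (\<Sum>k\<le>i. ((if k = 0 then m choose (i - k) else 0) +
      (if k = ?q then m choose (i - k) else 0)) mod p) mod p"
  proof (rule arg_cong[where f = "\<lambda>x. x mod p"], rule sum.cong[OF refl])
    fix k
    consider "k = 0" | "k = ?q" | "0 < k" "k < ?q" | "k > ?q" by linarith
    then show "((?q choose k) * (m choose (i - k))) mod p =
      ((if k = 0 then m choose (i - k) else 0) + (if k = ?q then m choose (i - k) else 0)) mod p"
    proof cases
      case 3
      then have "p dvd (?q choose k) * (m choose (i - k))"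
        using prime_dvd_prime_power_choose[OF p] by simp
      then show ?thesis using 3 by simp
    qed (use q in \<open>auto simp: binomial_eq_0\<close>)
  qed
  also have "\<dots> = (\<Sum>k\<le>i. (if k = 0 then m choose (i - k) else 0) +
      (if k = ?q then m choose (i - k) else 0)) mod p"
    by (simp add: mod_sum_eq)
  also have "(\<Sum>k\<le>i. (if k = 0 then m choose (i - k) else 0) +
      (if k = ?q then m choose (i - k) else 0)) =
      (m choose i) + (if ?q \<le> i then m choose (i - ?q) else 0)"
    by (simp add: sum.distrib sum.delta')
  finally show ?thesis .
qed

text \<open>
  With \<open>m = i + j - p ^ s\<close> we have \<open>m < i < p ^ s\<close>, so both terms of the preceding congruence vanish.
\<close>

lemma prime_dvd_choose_carry:
  fixes p :: nat
  assumes p: "prime p" and "i < p ^ s" "j < p ^ s" "p ^ s \<le> i + j"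
  shows "p dvd (i + j choose i)"
proof -
  have "p ^ s + (i + j - p ^ s) = i + j" using assms by simp
  then show ?thesis
    using choose_add_prime_power_mod[OF p, of s "i + j - p ^ s" i] assms
    by (simp add: mod_eq_0_iff_dvd binomial_eq_0)
qed

text \<open>
  Moves the weights of a regrouped sum into the natural numbers, where identities between binomial
  coefficients are available.
\<close>

lemma (in abelian_monoid) finsum_group_by:
  assumes "finite X" "finite Y" "g ` X \<subseteq> Y" "\<tau> \<in> Y \<rightarrow> carrier G"
  shows "(\<Oplus>x\<in>X. [(w x :: nat)] \<cdot> \<tau> (g x)) = (\<Oplus>e\<in>Y. [(\<Sum>x\<in>{x\<in>X. g x = e}. w x)] \<cdot> \<tau> e)"
  using assms(1,3)
proof (induction X rule: finite_induct)
  case empty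
  then show ?case by (simp add: finsum_zero)
next
  case (insert x F)
  have \<tau>: "\<tau> e \<in> carrier G" if "e \<in> Y" for e using assms(4) that by auto
  have gx: "g x \<in> Y" using insert.prems by auto
  have W: "(\<Sum>x\<in>{y\<in>insert x F. g y = e}. w x) =
      (if g x = e then w x else 0) + (\<Sum>x\<in>{y\<in>F. g y = e}. w x)" for e
  proof (cases "g x = e")
    case True
    then have "{y\<in>insert x F. g y = e} = insert x {y\<in>F. g y = e}" by auto
    then show ?thesis using insert.hyps True by simp
  next
    case False
    then have "{y\<in>insert x F. g y = e} = {y\<in>F. g y = e}" by auto
    then show ?thesis using False by simp
  qed
  have "(\<Oplus>e\<in>Y. [(\<Sum>x\<in>{y\<in>insert x F. g y = e}. w x)] \<cdot> \<tau> e) =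
    (\<Oplus>e\<in>Y. [(if g x = e then w x else 0)] \<cdot> \<tau> e \<oplus> [(\<Sum>x\<in>{y\<in>F. g y = e}. w x)] \<cdot> \<tau> e)"
    unfolding W using \<tau> by (intro finsum_cong') (auto simp: add.nat_pow_mult)
  also have "\<dots> = (\<Oplus>e\<in>Y. [(if g x = e then w x else 0)] \<cdot> \<tau> e) \<oplus>
      (\<Oplus>e\<in>Y. [(\<Sum>x\<in>{y\<in>F. g y = e}. w x)] \<cdot> \<tau> e)"
    using \<tau> by (intro finsum_addf) auto
  also have "(\<Oplus>e\<in>Y. [(if g x = e then w x else 0)] \<cdot> \<tau> e) =
      (\<Oplus>e\<in>Y. if g x = e then [(w x)] \<cdot> \<tau> e else \<zero>)"
    using \<tau> by (intro finsum_cong') auto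
  also have "\<dots> = [(w x)] \<cdot> \<tau> (g x)"
    using finsum_singleton[OF gx assms(2), of "\<lambda>e. [(w x)] \<cdot> \<tau> e"] \<tau> by auto
  finally show ?case
    using insert gx \<tau> by (subst finsum_insert) (auto simp: image_subset_iff)
qed

text \<open>
  For even elements of a superalgebra, which commute inside a ring that is not commutative.
\<close>

lemma (in ring) binomial_commuting:
  assumes "x \<in> carrier R" "y \<in> carrier R" "x \<otimes> y = y \<otimes> x"
  shows "(x \<oplus> y) [^] n = (\<Oplus>k\<in>{..n}. [(n choose k)] \<cdot> (x [^] k \<otimes> y [^] (n - k)))"
proof (induction n)
  case 0
  then show ?case using assms by simp
next
  case (Suc n)
  have yx: "y [^] m \<otimes> x = x \<otimes> y [^] m" for m :: nat
    using assms by (metis group_commutes_pow)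
  let ?f = "\<lambda>n k. [(n choose k)] \<cdot> (x [^] k \<otimes> y [^] (n - k))"
  have cl[simp]: "x [^] k \<otimes> y [^] (m::nat) \<in> carrier R" for k m :: nat using assms by simp
  have "(x \<oplus> y) [^] Suc n = (\<Oplus>k\<in>{..n}. ?f n k) \<otimes> (x \<oplus> y)"
    using Suc by simp
  also have "\<dots> = (\<Oplus>k\<in>{..n}. ?f n k \<otimes> x) \<oplus> (\<Oplus>k\<in>{..n}. ?f n k \<otimes> y)"
    using assms by (simp add: r_distr finsum_ldistr Pi_def)
  also have "(\<Oplus>k\<in>{..n}. ?f n k \<otimes> x) = (\<Oplus>k\<in>{..n}. [(n choose k)] \<cdot> (x [^] Suc k \<otimes> y [^] (n - k)))"
    using assms by (intro finsum_cong') (auto simp: add_pow_ldistr m_assoc yx)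
  also have "(\<Oplus>k\<in>{..n}. ?f n k \<otimes> y) = (\<Oplus>k\<in>{..n}. [(n choose k)] \<cdot> (x [^] k \<otimes> y [^] (Suc n - k)))"
    using assms by (intro finsum_cong') (auto simp: add_pow_ldistr m_assoc Suc_diff_le)
  also have "\<dots> = (\<Oplus>k\<in>{..Suc n}. [(n choose k)] \<cdot> (x [^] k \<otimes> y [^] (Suc n - k)))"
    using assms by (subst finsum_Suc) (auto simp: binomial_eq_0)
  also have "\<dots> = (\<Oplus>k\<in>{..n}. [(n choose Suc k)] \<cdot> (x [^] Suc k \<otimes> y [^] (n - k))) \<oplus> y [^] Suc n"
    using assms by (subst finsum_Suc2) (auto simp del: nat_pow_Suc)
  finally have *: "(x \<oplus> y) [^] Suc n =
    (\<Oplus>k\<in>{..n}. [(n choose k)] \<cdot> (x [^] Suc k \<otimes> y [^] (n - k))) \<oplus>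
    ((\<Oplus>k\<in>{..n}. [(n choose Suc k)] \<cdot> (x [^] Suc k \<otimes> y [^] (n - k))) \<oplus> y [^] Suc n)" .
  have "(\<Oplus>k\<in>{..Suc n}. ?f (Suc n) k) =
    (\<Oplus>k\<in>{..n}. [(Suc n choose Suc k)] \<cdot> (x [^] Suc k \<otimes> y [^] (n - k))) \<oplus> y [^] Suc n"
    using assms by (subst finsum_Suc2) (auto simp del: nat_pow_Suc)
  also have "(\<Oplus>k\<in>{..n}. [(Suc n choose Suc k)] \<cdot> (x [^] Suc k \<otimes> y [^] (n - k))) =
    (\<Oplus>k\<in>{..n}. [(n choose k)] \<cdot> (x [^] Suc k \<otimes> y [^] (n - k)) \<oplus>
       [(n choose Suc k)] \<cdot> (x [^] Suc k \<otimes> y [^] (n - k)))"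
    using assms by (intro finsum_cong') (auto simp: add.nat_pow_mult)
  also have "\<dots> = (\<Oplus>k\<in>{..n}. [(n choose k)] \<cdot> (x [^] Suc k \<otimes> y [^] (n - k))) \<oplus>
     (\<Oplus>k\<in>{..n}. [(n choose Suc k)] \<cdot> (x [^] Suc k \<otimes> y [^] (n - k)))"
    using assms by (intro finsum_addf) auto
  finally show ?case unfolding * using assms by (simp add: a_assoc del: nat_pow_Suc)
qed

lemma (in ring) add_pow_eq_mod:
  assumes "\<And>x. x \<in> carrier R \<Longrightarrow> [(p :: nat)] \<cdot> x = \<zero>" "x \<in> carrier R" "n mod p = m mod p"
  shows "[n] \<cdot> x = [m] \<cdot> x"
proof -
  have "[n] \<cdot> x = [(n mod p)] \<cdot> x" if "x \<in> carrier R" for n x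
  proof -
    have "[n] \<cdot> x = [(p * (n div p))] \<cdot> x \<oplus> [(n mod p)] \<cdot> x"
      using that by (simp add: add.nat_pow_mult)
    also have "\<dots> = [(n div p)] \<cdot> ([p] \<cdot> x) \<oplus> [(n mod p)] \<cdot> x"
      using that by (simp add: add.nat_pow_pow)
    finally show ?thesis using that assms(1) by simp
  qed
  then show ?thesis using assms by metis
qed

lemma (in ring) add_pow_prime_power_distrib:
  assumes p: "prime p" "\<And>x. x \<in> carrier R \<Longrightarrow> [(p :: nat)] \<cdot> x = \<zero>"
    and xy: "x \<in> carrier R" "y \<in> carrier R" "x \<otimes> y = y \<otimes> x"
  shows "(x \<oplus> y) [^] (p ^ s) = x [^] (p ^ s) \<oplus> y [^] (p ^ s)"
proof -
  let ?q = "p ^ s"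
  obtain m where m: "?q = Suc m" using p(1) by (metis gr0_implies_Suc prime_gt_0_nat zero_less_power)
  have "[(?q choose k)] \<cdot> z = \<zero>" if "0 < k" "k < ?q" "z \<in> carrier R" for k z
    using add_pow_eq_mod[OF p(2), of z "?q choose k" 0] prime_dvd_prime_power_choose[OF p(1) that(1,2)] that by simp
  then have z: "(\<Oplus>k\<in>{..m}. [(?q choose k)] \<cdot> (x [^] k \<otimes> y [^] (?q - k))) =
    (\<Oplus>k\<in>{..m}. if 0 = k then y [^] ?q else \<zero>)"
    using xy m by (intro finsum_cong') auto
  have "(x \<oplus> y) [^] ?q = (\<Oplus>k\<in>{..Suc m}. [(?q choose k)] \<cdot> (x [^] k \<otimes> y [^] (?q - k)))"
    using binomial_commuting[OF xy, of ?q] m by simp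
  also have "\<dots> = x [^] ?q \<oplus> (\<Oplus>k\<in>{..m}. [(?q choose k)] \<cdot> (x [^] k \<otimes> y [^] (?q - k)))"
    using xy m by (subst finsum_Suc) auto
  also have "\<dots> = x [^] ?q \<oplus> y [^] ?q"
    unfolding z using finsum_singleton[of 0 "{..m}" "\<lambda>_. y [^] ?q"] xy by simp
  finally show ?thesis .
qed

lemma finsum_additive:
  assumes "abelian_monoid G" "abelian_monoid H"
    and closed: "\<And>x. x \<in> carrier G \<Longrightarrow> f x \<in> carrier H"
    and zero: "f \<zero>\<^bsub>G\<^esub> = \<zero>\<^bsub>H\<^esub>"
    and add: "\<And>x y. \<lbrakk>x \<in> carrier G; y \<in> carrier G\<rbrakk> \<Longrightarrow> f (x \<oplus>\<^bsub>G\<^esub> y) = f x \<oplus>\<^bsub>H\<^esub> f y"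
    and g: "g \<in> I \<rightarrow> carrier G"
  shows "f (\<Oplus>\<^bsub>G\<^esub>i\<in>I. g i) = (\<Oplus>\<^bsub>H\<^esub>i\<in>I. f (g i))"
proof -
  interpret G: abelian_monoid G by fact
  interpret H: abelian_monoid H by fact
  show ?thesis using g
  proof (induction I rule: infinite_finite_induct)
    case (insert x F)
    then have "g \<in> F \<rightarrow> carrier G" "g x \<in> carrier G" by auto
    moreover from this have "(\<lambda>i. f (g i)) \<in> F \<rightarrow> carrier H" using closed by auto
    ultimately show ?case using insert by (simp add: G.finsum_insert H.finsum_insert closed add)
  qed (auto simp: zero G.finsum_empty G.finsum_infinite H.finsum_empty H.finsum_infinite)
qed

lemma (in abelian_monoid) finsum_closed_under_add:
  assumes "H \<subseteq> carrier G" "\<zero> \<in> H" "\<And>x y. \<lbrakk>x \<in> H; y \<in> H\<rbrakk> \<Longrightarrow> x \<oplus> y \<in> H" "f \<in> J \<rightarrow> H"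
  shows "(\<Oplus>i\<in>J. f i) \<in> H"
  using assms(4)
proof (induction J rule: infinite_finite_induct)
  case (insert x F)
  then have "f x \<in> H" "f \<in> F \<rightarrow> H" by auto
  moreover from this have "f x \<in> carrier G" "f \<in> F \<rightarrow> carrier G" using assms(1) by auto
  ultimately show ?case using insert assms(3) by (simp add: finsum_insert)
qed (auto simp: assms finsum_empty finsum_infinite)

lemma (in abelian_monoid) finsum_add_pow:
  assumes "g \<in> I \<rightarrow> carrier G"
  shows "(\<Oplus>i\<in>I. [(n :: nat)] \<cdot> g i) = [n] \<cdot> (\<Oplus>i\<in>I. g i)"
  by (rule finsum_additive[symmetric, OF abelian_monoid_axioms abelian_monoid_axioms])
    (use assms in \<open>auto simp: add.nat_pow_distrib\<close>)

lemma (in abelian_monoid) finsum_Times: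
  assumes "finite X" "finite Y" "f \<in> X \<times> Y \<rightarrow> carrier G"
  shows "(\<Oplus>x\<in>X. \<Oplus>y\<in>Y. f (x, y)) = (\<Oplus>w\<in>X \<times> Y. f w)"
  using assms(1,3)
proof (induction X rule: finite_induct)
  case empty
  then show ?case by (simp add: finsum_empty)
next
  case (insert x F)
  have "insert x F \<times> Y = Pair x ` Y \<union> F \<times> Y" by auto
  moreover have "(\<Oplus>w\<in>Pair x ` Y \<union> F \<times> Y. f w) = (\<Oplus>w\<in>Pair x ` Y. f w) \<oplus> (\<Oplus>w\<in>F \<times> Y. f w)"
    using insert assms(2) by (intro finsum_Un_disjoint) auto
  moreover have "(\<Oplus>w\<in>Pair x ` Y. f w) = (\<Oplus>y\<in>Y. f (x, y))"
    using insert by (intro finsum_reindex) (auto simp: inj_on_def)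
  moreover have "(\<Oplus>x\<in>insert x F. \<Oplus>y\<in>Y. f (x, y)) =
    (\<Oplus>y\<in>Y. f (x, y)) \<oplus> (\<Oplus>x\<in>F. \<Oplus>y\<in>Y. f (x, y))"
    using insert by (intro finsum_insert) (auto intro!: finsum_closed)
  ultimately show ?case using insert by auto
qed

section \<open>Superalgebras and divided power sequences\<close>

lemma characteristic_odd_prime:
  assumes "field K" "has_characteristic K p" "p \<ge> 3"
  shows "prime p" "odd p"
proof -
  interpret field K by fact
  have ch: "[n] \<cdot>\<^bsub>K\<^esub> \<one>\<^bsub>K\<^esub> = \<zero>\<^bsub>K\<^esub> \<longleftrightarrow> p dvd n" for n :: nat
    using assms(2) by (auto simp: has_characteristic_def)
  have "m = 1 \<or> m = p" if mp: "m dvd p" for m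
  proof -
    obtain n where n: "p = m * n" using mp by (auto elim: dvdE)
    \<comment> \<open>A proper factorization of the characteristic gives zero divisors in the field.\<close>
    have "[m] \<cdot>\<^bsub>K\<^esub> \<one>\<^bsub>K\<^esub> \<otimes>\<^bsub>K\<^esub> [n] \<cdot>\<^bsub>K\<^esub> \<one>\<^bsub>K\<^esub> = [p] \<cdot>\<^bsub>K\<^esub> \<one>\<^bsub>K\<^esub>"
      by (simp add: n add_pow_ldistr add_pow_rdistr add.nat_pow_pow mult.commute)
    then have "[m] \<cdot>\<^bsub>K\<^esub> \<one>\<^bsub>K\<^esub> = \<zero>\<^bsub>K\<^esub> \<or> [n] \<cdot>\<^bsub>K\<^esub> \<one>\<^bsub>K\<^esub> = \<zero>\<^bsub>K\<^esub>"
      using ch[of p] integral by simp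
    then have "p dvd m \<or> p dvd n" by (simp add: ch)
    then show ?thesis
    proof
      assume "p dvd m" then show ?thesis using mp by (simp add: dvd_antisym)
    next
      assume "p dvd n"
      then have "p * 1 = p * m" using n by (metis dvd_antisym dvd_triv_right mult.commute mult.right_neutral)
      then show ?thesis using assms(3) by (metis mult_left_cancel not_numeral_le_zero)
    qed
  qed
  then show "prime p" using assms(3) by (auto simp: prime_nat_iff)
  then show "odd p" using assms(3) by (auto dest: prime_odd_nat)
qed

context superalgebra
begin

lemma evens_closed [simp]: "x \<in> evens A \<Longrightarrow> x \<in> carrier A"
  using submoduleE(1)[OF evens_submodule] by auto

lemma odds_closed [simp]: "x \<in> odds A \<Longrightarrow> x \<in> carrier A"
  using submoduleE(1)[OF odds_submodule] by auto

lemma evens_add [simp]: "\<lbrakk>x \<in> evens A; y \<in> evens A\<rbrakk> \<Longrightarrow> x \<oplus> y \<in> evens A"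
  using submoduleE(5)[OF evens_submodule] by auto

lemma odds_add [simp]: "\<lbrakk>x \<in> odds A; y \<in> odds A\<rbrakk> \<Longrightarrow> x \<oplus> y \<in> odds A"
  using submoduleE(5)[OF odds_submodule] by auto

lemma zero_even [simp]: "\<zero> \<in> evens A"
  using subgroup.one_closed[OF submodule.axioms(1)[OF evens_submodule]] by simp

lemma zero_odd [simp]: "\<zero> \<in> odds A"
  using subgroup.one_closed[OF submodule.axioms(1)[OF odds_submodule]] by simp

lemma evens_pow [simp]: "x \<in> evens A \<Longrightarrow> x [^] (n :: nat) \<in> evens A"
  by (induction n) (auto simp: one_even even_even)

lemma evens_finsum: "f \<in> I \<rightarrow> evens A \<Longrightarrow> (\<Oplus>i\<in>I. f i) \<in> evens A"
  by (rule finsum_closed_under_add) auto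

lemma odds_finsum: "f \<in> I \<rightarrow> odds A \<Longrightarrow> (\<Oplus>i\<in>I. f i) \<in> odds A"
  by (rule finsum_closed_under_add) auto

lemma parity_obtain:
  assumes "x \<in> carrier A"
  obtains e o' where "e \<in> evens A" "o' \<in> odds A" "x = e \<oplus> o'"
  using parity_decomposition[OF assms] by blast

lemma parity_unique:
  assumes "e \<in> evens A" "e' \<in> evens A" "u \<in> odds A" "u' \<in> odds A" "e \<oplus> u = e' \<oplus> u'"
  shows "e = e'" "u = u'"
proof -
  have "e \<oplus> u \<in> carrier A" using assms by simp
  from parity_decomposition[OF this] obtain w
    where w: "\<And>v. fst v \<in> evens A \<and> snd v \<in> odds A \<and> e \<oplus> u = fst v \<oplus> snd v \<Longrightarrow> v = w"
    by blast
  have "(e, u) = w" "(e', u') = w" using w[of "(e, u)"] w[of "(e', u')"] assms by simp_all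
  then show "e = e'" "u = u'" by auto
qed

lemma add_pow_eq_smult:
  assumes "x \<in> carrier A"
  shows "[(n :: nat)] \<cdot> x = ([n] \<cdot>\<^bsub>K\<^esub> \<one>\<^bsub>K\<^esub>) \<odot> x"
  by (induction n) (use assms in \<open>auto simp: smult_l_distr\<close>)

lemma characteristic_add_pow:
  assumes "has_characteristic K p" "x \<in> carrier A"
  shows "[p] \<cdot> x = \<zero>"
proof -
  have "[p] \<cdot>\<^bsub>K\<^esub> \<one>\<^bsub>K\<^esub> = \<zero>\<^bsub>K\<^esub>" using assms(1) by (simp add: has_characteristic_def)
  then show ?thesis using assms(2) by (simp add: add_pow_eq_smult)
qed

end

context comm_superalgebra
begin

text \<open>
  The defining commutation rules concern homogeneous elements; an arbitrary element is a sum of two of them.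
\<close>

lemma even_central:
  assumes "x \<in> evens A" "y \<in> carrier A"
  shows "y \<otimes> x = x \<otimes> y"
proof -
  obtain e o' where "e \<in> evens A" "o' \<in> odds A" "y = e \<oplus> o'"
    using parity_obtain[OF assms(2)] .
  then show ?thesis using assms even_comm[of x e] even_comm[of x o'] by (simp add: l_distr r_distr)
qed

lemma even_left_commute:
  assumes "x \<in> evens A" "y \<in> carrier A" "z \<in> carrier A"
  shows "y \<otimes> (x \<otimes> z) = x \<otimes> (y \<otimes> z)"
  using assms even_central[of x y] by (simp add: m_assoc[symmetric])

lemma even_mult_mult:
  assumes "a \<in> carrier A" "b \<in> evens A" "c \<in> carrier A" "d \<in> carrier A"
  shows "(a \<otimes> b) \<otimes> (c \<otimes> d) = (a \<otimes> c) \<otimes> (b \<otimes> d)"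
  using assms even_left_commute[of b c d] by (simp add: m_assoc)

end

context superalgebra
begin

text \<open>
  Points of \<open>M\<close> have finitely many \<open>\<sigma>\<^sub>i\<close>. Extended by zero they satisfy this product rule for all
  indices, which removes the case distinction at \<open>p ^ s\<close>.
\<close>

definition divided_powers :: "(nat \<Rightarrow> 'a) \<Rightarrow> bool" where
  "divided_powers \<sigma> \<longleftrightarrow> (\<forall>n. \<sigma> n \<in> evens A) \<and> \<sigma> 0 = \<one> \<and>
     (\<forall>i j. \<sigma> i \<otimes> \<sigma> j = [((i + j) choose i)] \<cdot> \<sigma> (i + j))"

text \<open>
  The effect on points of the summands of the comultiplication of \<open>\<sigma>\<^sub>n\<close> that do not involve \<open>\<tau>\<close>.
\<close>

definition convolve :: "(nat \<Rightarrow> 'a) \<Rightarrow> (nat \<Rightarrow> 'a) \<Rightarrow> nat \<Rightarrow> 'a" where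
  "convolve \<sigma> \<sigma>' n = (\<Oplus>a\<in>{..n}. \<sigma> a \<otimes> \<sigma>' (n - a))"

end

text \<open>
  Vandermonde's identity: the sum is the weight with which \<open>\<sigma>\<^sub>e * \<sigma>'\<^sub>f\<close>, where \<open>e + f = i + j\<close>, occurs in
  the product of the convolutions of orders \<open>i\<close> and \<open>j\<close>.
\<close>

lemma sum_choose_choose:
  fixes i j e :: nat
  assumes "e \<le> i + j"
  shows "(\<Sum>w\<in>{w\<in>{..i}\<times>{..j}. fst w + snd w = e}.
    ((fst w + snd w) choose fst w) * ((i - fst w + (j - snd w)) choose (i - fst w))) = (i + j) choose i"
    (is "sum ?f ?X = _")
proof -
  have "sum ?f ?X = (\<Sum>a\<in>{a. a \<le> i \<and> a \<le> e \<and> e - a \<le> j}. (e choose a) * ((i + j - e) choose (i - a)))"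
    by (rule sum.reindex_bij_witness[of _ "\<lambda>a. (a, e - a)" fst]) (use assms in auto)
  also have "\<dots> = (\<Sum>a\<le>i. (e choose a) * ((i + j - e) choose (i - a)))"
  proof (rule sum.mono_neutral_left)
    show "\<forall>a\<in>{..i} - {a. a \<le> i \<and> a \<le> e \<and> e - a \<le> j}. (e choose a) * ((i + j - e) choose (i - a)) = 0"
      using assms by (auto simp: binomial_eq_0)
  qed auto
  also have "\<dots> = (e + (i + j - e)) choose i" by (rule vandermonde)
  finally show ?thesis using assms by simp
qed

context comm_superalgebra
begin

lemma divided_powers_convolve:
  assumes "divided_powers \<sigma>" "divided_powers \<sigma>'"
  shows "divided_powers (convolve \<sigma> \<sigma>')"
proof -
  have ev: "\<sigma> n \<in> evens A" "\<sigma>' n \<in> evens A" for n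
    using assms by (auto simp: divided_powers_def)
  have cl [simp]: "\<sigma> n \<in> carrier A" "\<sigma>' n \<in> carrier A" for n using ev by auto
  have one: "\<sigma> 0 = \<one>" "\<sigma>' 0 = \<one>" using assms by (auto simp: divided_powers_def)
  have mul: "\<sigma> i \<otimes> \<sigma> j = [((i + j) choose i)] \<cdot> \<sigma> (i + j)"
    "\<sigma>' i \<otimes> \<sigma>' j = [((i + j) choose i)] \<cdot> \<sigma>' (i + j)" for i j
    using assms by (auto simp: divided_powers_def)
  have "convolve \<sigma> \<sigma>' i \<otimes> convolve \<sigma> \<sigma>' j = [((i + j) choose i)] \<cdot> convolve \<sigma> \<sigma>' (i + j)" for i j
  proof -
    define \<tau> where "\<tau> e = \<sigma> e \<otimes> \<sigma>' (i + j - e)" for e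
    have \<tau>: "\<tau> e \<in> carrier A" for e by (simp add: \<tau>_def)
    let ?w = "\<lambda>x. ((fst x + snd x) choose fst x) * ((i - fst x + (j - snd x)) choose (i - fst x))"
    have product: "(\<sigma> a \<otimes> \<sigma>' (i - a)) \<otimes> (\<sigma> b \<otimes> \<sigma>' (j - b)) = [(?w (a, b))] \<cdot> \<tau> (a + b)"
      if "a \<le> i" "b \<le> j" for a b
    proof -
      have "(\<sigma> a \<otimes> \<sigma>' (i - a)) \<otimes> (\<sigma> b \<otimes> \<sigma>' (j - b)) =
        (\<sigma> a \<otimes> \<sigma> b) \<otimes> (\<sigma>' (i - a) \<otimes> \<sigma>' (j - b))"
        using ev by (intro even_mult_mult) auto
      also have "\<dots> = [(?w (a, b))] \<cdot> (\<sigma> (a + b) \<otimes> \<sigma>' (i - a + (j - b)))"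
        by (simp add: mul add_pow_ldistr add_pow_rdistr add.nat_pow_pow mult.commute)
      also have "i - a + (j - b) = i + j - (a + b)" using that by simp
      finally show ?thesis by (simp add: \<tau>_def)
    qed
    have "convolve \<sigma> \<sigma>' i \<otimes> convolve \<sigma> \<sigma>' j =
      (\<Oplus>a\<in>{..i}. \<Oplus>b\<in>{..j}. (\<sigma> a \<otimes> \<sigma>' (i - a)) \<otimes> (\<sigma> b \<otimes> \<sigma>' (j - b)))"
    proof -
      have "convolve \<sigma> \<sigma>' i \<otimes> convolve \<sigma> \<sigma>' j =
        (\<Oplus>a\<in>{..i}. (\<sigma> a \<otimes> \<sigma>' (i - a)) \<otimes> (\<Oplus>b\<in>{..j}. \<sigma> b \<otimes> \<sigma>' (j - b)))"
        unfolding convolve_def by (rule finsum_ldistr) (auto intro!: finsum_closed)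
      also have "\<dots> = (\<Oplus>a\<in>{..i}. \<Oplus>b\<in>{..j}. (\<sigma> a \<otimes> \<sigma>' (i - a)) \<otimes> (\<sigma> b \<otimes> \<sigma>' (j - b)))"
        by (intro finsum_cong' refl finsum_rdistr) (auto intro!: finsum_closed)
      finally show ?thesis .
    qed
    also have "\<dots> = (\<Oplus>a\<in>{..i}. \<Oplus>b\<in>{..j}. [(?w (a, b))] \<cdot> \<tau> (a + b))"
      by (intro finsum_cong' refl funcsetI finsum_closed add.nat_pow_closed \<tau>) (simp only: product atMost_iff)
    also have "\<dots> = (\<Oplus>x\<in>{..i}\<times>{..j}. [(?w x)] \<cdot> \<tau> (fst x + snd x))"
    proof -
      have "(\<lambda>x. [(?w x)] \<cdot> \<tau> (fst x + snd x)) \<in> {..i}\<times>{..j} \<rightarrow> carrier A" using \<tau> by auto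
      from finsum_Times[OF finite_atMost finite_atMost this] show ?thesis by (simp only: fst_conv snd_conv)
    qed
    also have "\<dots> = (\<Oplus>e\<in>{..i + j}. [(\<Sum>x\<in>{x\<in>{..i}\<times>{..j}. fst x + snd x = e}. ?w x)] \<cdot> \<tau> e)"
      by (intro finsum_group_by finite_cartesian_product finite_atMost funcsetI \<tau>) auto
    also have "\<dots> = (\<Oplus>e\<in>{..i + j}. [((i + j) choose i)] \<cdot> \<tau> e)"
      by (intro finsum_cong' refl funcsetI add.nat_pow_closed \<tau>) (simp only: sum_choose_choose atMost_iff)
    also have "\<dots> = [((i + j) choose i)] \<cdot> convolve \<sigma> \<sigma>' (i + j)"
      unfolding convolve_def \<tau>_def[symmetric] using \<tau> by (simp add: finsum_add_pow)
    finally show ?thesis .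
  qed
  moreover have "convolve \<sigma> \<sigma>' n \<in> evens A" for n
    unfolding convolve_def using ev by (intro evens_finsum) (auto simp: even_even)
  moreover have "convolve \<sigma> \<sigma>' 0 = \<one>" by (simp add: convolve_def one)
  ultimately show ?thesis by (simp add: divided_powers_def)
qed

end

section \<open>The multiplication of M on points\<close>

context comm_superalgebra
begin

lemma divided_powers_even: "divided_powers \<sigma> \<Longrightarrow> \<sigma> n \<in> evens A"
  by (simp only: divided_powers_def)

text \<open>
  With \<open>w = t * t'\<close> for two odd elements, this is the passage from the first sum in the comultiplication
  of \<open>\<sigma>\<^sub>n\<close> to the full comultiplication. Since \<open>w * w = 0\<close>, only the terms linear in \<open>w\<close> have to be
  compared, and their coefficients agree modulo \<open>p\<close> by the congruence for \<open>(1 + X) ^ p = 1 + X ^ p\<close>.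
\<close>

lemma divided_powers_twist:
  assumes p: "prime p" "\<And>x. x \<in> carrier A \<Longrightarrow> [(p :: nat)] \<cdot> x = \<zero>"
    and E: "divided_powers E" and w: "w \<in> evens A" "w \<otimes> w = \<zero>"
  shows "divided_powers (\<lambda>n. E n \<oplus> (if p \<le> n then E (n - p) \<otimes> w else \<zero>))"
proof -
  have ev: "E n \<in> evens A" and one: "E 0 = \<one>"
    and mul: "E i \<otimes> E j = [((i + j) choose i)] \<cdot> E (i + j)" for n i j
    using E by (auto simp: divided_powers_def)
  have cl [simp]: "E n \<in> carrier A" "w \<in> carrier A" for n using ev w(1) by auto
  define T where "T n = (if p \<le> n then E (n - p) else \<zero>)" for n
  define F where "F n = E n \<oplus> T n \<otimes> w" for n
  have T [simp]: "T n \<in> evens A" "T n \<in> carrier A" for n using ev by (auto simp: T_def)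
  have F: "E n \<oplus> (if p \<le> n then E (n - p) \<otimes> w else \<zero>) = F n" for n
    by (simp add: F_def T_def)
  have TE: "T i \<otimes> E j = [(if p \<le> i then (i + j - p) choose (i - p) else 0)] \<cdot> T (i + j)" for i j
    by (simp add: T_def mul)
  have ET: "E i \<otimes> T j = [(if p \<le> j then (i + j - p) choose i else 0)] \<cdot> T (i + j)" for i j
    by (simp add: T_def mul)
  have TT: "(T i \<otimes> w) \<otimes> (T j \<otimes> w) = \<zero>" for i j
    using even_mult_mult[of "T i" w "T j" w] w by simp
  have "F i \<otimes> F j = [((i + j) choose i)] \<cdot> F (i + j)" for i j
  proof -
    have "F i \<otimes> F j = E i \<otimes> E j \<oplus> (E i \<otimes> (T j \<otimes> w) \<oplus> ((T i \<otimes> w) \<otimes> E j \<oplus> (T i \<otimes> w) \<otimes> (T j \<otimes> w)))"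
      by (simp add: F_def l_distr r_distr a_assoc a_ac)
    also have "(T i \<otimes> w) \<otimes> E j = (T i \<otimes> E j) \<otimes> w"
      using even_central[of w "E j"] w by (simp add: m_assoc)
    also have "E i \<otimes> E j \<oplus> (E i \<otimes> (T j \<otimes> w) \<oplus> ((T i \<otimes> E j) \<otimes> w \<oplus> (T i \<otimes> w) \<otimes> (T j \<otimes> w))) =
      E i \<otimes> E j \<oplus> (E i \<otimes> T j \<oplus> T i \<otimes> E j) \<otimes> w"
      by (simp add: TT m_assoc[symmetric] l_distr)
    also have "E i \<otimes> T j \<oplus> T i \<otimes> E j = [((if p \<le> j then (i + j - p) choose i else 0) +
        (if p \<le> i then (i + j - p) choose (i - p) else 0))] \<cdot> T (i + j)"
      by (simp add: TE ET add.nat_pow_mult)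
    also have "\<dots> = [((i + j) choose i)] \<cdot> T (i + j)"
    proof (cases "p \<le> i + j")
      case True
      have "((if p \<le> j then (i + j - p) choose i else 0) +
          (if p \<le> i then (i + j - p) choose (i - p) else 0)) mod p = ((i + j) choose i) mod p"
      proof -
        have "(if p \<le> j then (i + j - p) choose i else 0) = (i + j - p) choose i"
          using True by (simp add: binomial_eq_0)
        moreover have "p ^ 1 + (i + j - p) = i + j" using True by simp
        ultimately show ?thesis
          using choose_add_prime_power_mod[OF p(1), of 1 "i + j - p" i] by (simp only: power_one_right)
      qed
      from add_pow_eq_mod[of p, OF _ T(2) this] p(2) show ?thesis by blast
    next
      case False
      then show ?thesis by (simp add: T_def)
    qed
    finally show ?thesis
      using ev by (simp add: mul F_def add.nat_pow_distrib add_pow_ldistr)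
  qed
  moreover have "F n \<in> evens A" for n
    using ev w by (simp add: F_def even_even)
  moreover have "F 0 = \<one>" using prime_gt_0_nat[OF p(1)] by (simp add: F_def T_def one)
  ultimately show ?thesis unfolding F by (simp add: divided_powers_def)
qed

end

locale odd_char_superalgebra = comm_superalgebra K A
  for K :: "'u ring" and A :: "('u, 'u) superalg" (structure) +
  fixes p r s :: nat
  assumes prime_p: "prime p" and odd_p: "odd p" and r_pos: "r \<ge> 1" and s_pos: "s \<ge> 1"
    and char_p: "x \<in> carrier A \<Longrightarrow> [p] \<cdot> x = \<zero>"
begin

lemma p_gt_1: "p > 1" using prime_gt_1_nat[OF prime_p] .

lemma p_pow_s_gt_1: "1 < p ^ s" using one_less_power[OF p_gt_1] s_pos by simp

lemma M_carrierD:
  assumes "(t, h, \<sigma>) \<in> M_carrier p r s A"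
  shows "t \<in> odds A" "h \<in> evens A" "\<sigma> \<in> {..<p ^ s} \<rightarrow>\<^sub>E evens A" "\<sigma> 0 = \<one>" "t \<otimes> t = \<zero>"
    "h [^] (p ^ (r - 1)) = \<sigma> 1"
    "\<And>i j. \<lbrakk>i < p ^ s; j < p ^ s\<rbrakk> \<Longrightarrow> \<sigma> i \<otimes> \<sigma> j =
       (if i + j < p ^ s then [((i + j) choose i)] \<cdot> \<sigma> (i + j) else \<zero>)"
  using assms by (auto simp: M_carrier_def)

lemma divided_powers_extend:
  assumes "(t, h, \<sigma>) \<in> M_carrier p r s A"
  shows "divided_powers (\<lambda>n. if n < p ^ s then \<sigma> n else \<zero>)"
  using M_carrierD[OF assms] p_gt_1 unfolding divided_powers_def
  by (auto simp: PiE_iff)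

text \<open>
  Forgetting the terms from \<open>p ^ s\<close> on is harmless: a product of two of the remaining terms
  that would reach them has a coefficient divisible by \<open>p\<close>.
\<close>

lemma divided_powers_restrict:
  assumes F: "divided_powers F"
    and t: "t \<in> odds A" "t \<otimes> t = \<zero>" and h: "h \<in> evens A" "h [^] (p ^ (r - 1)) = F 1"
  shows "(t, h, restrict F {..<p ^ s}) \<in> M_carrier p r s A"
proof -
  have ev: "F n \<in> evens A" and one: "F 0 = \<one>"
    and mul: "F i \<otimes> F j = [((i + j) choose i)] \<cdot> F (i + j)" for n i j
    using F by (auto simp: divided_powers_def)
  have "[((i + j) choose i)] \<cdot> F (i + j) = \<zero>" if "i < p ^ s" "j < p ^ s" "\<not> i + j < p ^ s" for i j
    using add_pow_eq_mod[OF char_p, of "F (i + j)" "(i + j) choose i" 0]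
      prime_dvd_choose_carry[OF prime_p, of i s j] that ev by simp
  then show ?thesis using p_gt_1 p_pow_s_gt_1 t h ev one mul by (auto simp: M_carrier_def)
qed

lemma M_mult_eq:
  assumes m: "(t, h, \<sigma>) \<in> M_carrier p r s A" "(t', h', \<sigma>') \<in> M_carrier p r s A"
  defines "\<rho> \<equiv> \<lambda>n. if n < p ^ s then \<sigma> n else \<zero>" and "\<rho>' \<equiv> \<lambda>n. if n < p ^ s then \<sigma>' n else \<zero>"
  shows "M_mult p s A (t, h, \<sigma>) (t', h', \<sigma>') = (t \<oplus> t', h \<oplus> h',
    restrict (\<lambda>n. convolve \<rho> \<rho>' n \<oplus>
      (if p \<le> n then convolve \<rho> \<rho>' (n - p) \<otimes> (t \<otimes> t') else \<zero>)) {..<p ^ s})"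
proof -
  have ev: "\<sigma> n \<in> evens A" "\<sigma>' n \<in> evens A" if "n < p ^ s" for n
    using M_carrierD(3)[OF m(1)] M_carrierD(3)[OF m(2)] that by auto
  have tt [simp]: "t \<in> carrier A" "t' \<in> carrier A" using M_carrierD(1)[OF m(1)] M_carrierD(1)[OF m(2)] by auto
  have sum: "(\<Oplus>w\<in>{(a, b). a + b + c = n}. f (fst w) (snd w)) =
      (if c \<le> n then \<Oplus>a\<in>{..n - c}. f a (n - c - a) else \<zero>)"
    if "\<And>a b. a + b + c = n \<Longrightarrow> f a b \<in> carrier A" for f and c n :: nat
  proof (cases "c \<le> n")
    case True
    have "{(a, b). a + b + c = n} = (\<lambda>a. (a, n - c - a)) ` {..n - c}"
      using True by (auto simp: image_iff)
    then have "(\<Oplus>w\<in>{(a, b). a + b + c = n}. f (fst w) (snd w)) =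
        (\<Oplus>a\<in>{..n - c}. f (fst (a, n - c - a)) (snd (a, n - c - a)))"
      using that True by (simp only:) (intro finsum_reindex, auto simp: inj_on_def)
    then show ?thesis using True by simp
  next
    case False
    then have "{(a, b). a + b + c = n} = {}" by auto
    then show ?thesis using False by (simp only: finsum_empty if_False)
  qed
  have "(\<Oplus>w\<in>{(a, b). a + b = n}. \<sigma> (fst w) \<otimes> \<sigma>' (snd w)) = convolve \<rho> \<rho>' n" if "n < p ^ s" for n
  proof -
    have "(\<Oplus>w\<in>{(a, b). a + b = n}. \<sigma> (fst w) \<otimes> \<sigma>' (snd w)) = (\<Oplus>a\<in>{..n}. \<sigma> a \<otimes> \<sigma>' (n - a))"
      using sum[of 0 n "\<lambda>a b. \<sigma> a \<otimes> \<sigma>' b"] ev that by simp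
    also have "\<dots> = convolve \<rho> \<rho>' n"
      unfolding convolve_def using ev that by (intro finsum_cong') (auto simp: \<rho>_def \<rho>'_def)
    finally show ?thesis .
  qed
  moreover have "(\<Oplus>w\<in>{(a, b). a + b + p = n}. (\<sigma> (fst w) \<otimes> t) \<otimes> (\<sigma>' (snd w) \<otimes> t')) =
     (if p \<le> n then convolve \<rho> \<rho>' (n - p) \<otimes> (t \<otimes> t') else \<zero>)" if "n < p ^ s" for n
  proof -
    have "(\<Oplus>w\<in>{(a, b). a + b + p = n}. (\<sigma> (fst w) \<otimes> t) \<otimes> (\<sigma>' (snd w) \<otimes> t')) =
      (if p \<le> n then \<Oplus>a\<in>{..n - p}. (\<sigma> a \<otimes> t) \<otimes> (\<sigma>' (n - p - a) \<otimes> t') else \<zero>)"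
      using sum[where f = "\<lambda>a b. (\<sigma> a \<otimes> t) \<otimes> (\<sigma>' b \<otimes> t')" and c = p and n = n] ev that by simp
    also have "(\<Oplus>a\<in>{..n - p}. (\<sigma> a \<otimes> t) \<otimes> (\<sigma>' (n - p - a) \<otimes> t')) =
       (\<Oplus>a\<in>{..n - p}. (\<rho> a \<otimes> \<rho>' (n - p - a)) \<otimes> (t \<otimes> t'))"
    proof (intro finsum_cong' refl funcsetI)
      fix a assume "a \<in> {..n - p}"
      then have a: "\<sigma> a \<in> evens A" "\<sigma>' (n - p - a) \<in> evens A" "\<rho> a = \<sigma> a" "\<rho>' (n - p - a) = \<sigma>' (n - p - a)"
        using ev that by (auto simp: \<rho>_def \<rho>'_def)
      then show "\<rho> a \<otimes> \<rho>' (n - p - a) \<otimes> (t \<otimes> t') \<in> carrier A" by simp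
      show "(\<sigma> a \<otimes> t) \<otimes> (\<sigma>' (n - p - a) \<otimes> t') = (\<rho> a \<otimes> \<rho>' (n - p - a)) \<otimes> (t \<otimes> t')"
        using a even_left_commute[of "\<sigma>' (n - p - a)" t t'] by (simp add: m_assoc)
    qed
    also have "\<dots> = convolve \<rho> \<rho>' (n - p) \<otimes> (t \<otimes> t')"
      unfolding convolve_def using ev by (intro finsum_ldistr[symmetric]) (auto simp: \<rho>_def \<rho>'_def)
    finally show ?thesis .
  qed
  ultimately show ?thesis by (auto simp: M_mult_def restrict_def)
qed

text \<open>
  The comultiplication respects the relations of \<open>k[M]\<close>. A homomorphism out of \<open>M\<close> is only determined
  on points of \<open>M\<close>, so this is needed before homomorphisms can be composed with endomorphisms of \<open>M\<close>.
\<close>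

lemma M_mult_closed:
  assumes "m \<in> M_carrier p r s A" "m' \<in> M_carrier p r s A"
  shows "M_mult p s A m m' \<in> M_carrier p r s A"
proof -
  obtain t h \<sigma> t' h' \<sigma>' where m_eq: "m = (t, h, \<sigma>)" "m' = (t', h', \<sigma>')" by (metis prod_cases3)
  note m = assms(1)[unfolded m_eq] and m' = assms(2)[unfolded m_eq]
  note M = M_carrierD[OF m] and M' = M_carrierD[OF m']
  define \<rho> where "\<rho> n = (if n < p ^ s then \<sigma> n else \<zero>)" for n
  define \<rho>' where "\<rho>' n = (if n < p ^ s then \<sigma>' n else \<zero>)" for n
  have dp: "divided_powers \<rho>" "divided_powers \<rho>'"
    using divided_powers_extend[OF m] divided_powers_extend[OF m']
    by (simp_all add: \<rho>_def[abs_def] \<rho>'_def[abs_def])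
  have cl [simp]: "t \<in> carrier A" "t' \<in> carrier A" using M(1) M'(1) by auto
  have tt: "t' \<otimes> t = \<ominus> (t \<otimes> t')" by (rule odd_anticomm[OF M(1) M'(1)])
  \<comment> \<open>The odd elements anticommute, so the square is \<open>- (t * t) * (t' * t')\<close>.\<close>
  have sq: "(t \<otimes> t') \<otimes> (t \<otimes> t') = \<zero>"
  proof -
    have "(t \<otimes> t') \<otimes> (t \<otimes> t') = t \<otimes> ((t' \<otimes> t) \<otimes> t')" by (simp add: m_assoc)
    also have "\<dots> = \<ominus> ((t \<otimes> t) \<otimes> (t' \<otimes> t'))" by (simp add: tt m_assoc l_minus r_minus)
    finally show ?thesis using M(5) by simp
  qed
  define F where "F n = convolve \<rho> \<rho>' n \<oplus> (if p \<le> n then convolve \<rho> \<rho>' (n - p) \<otimes> (t \<otimes> t') else \<zero>)" for n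
  have F: "divided_powers F" unfolding F_def
    by (intro divided_powers_twist prime_p char_p divided_powers_convolve dp odd_odd M(1) M'(1) sq)
  have "(t \<oplus> t') \<otimes> (t \<oplus> t') = \<zero>"
    using M(5) M'(5) by (simp add: l_distr r_distr tt l_neg)
  moreover have "(h \<oplus> h') [^] (p ^ (r - 1)) = F 1"
  proof -
    have "(h \<oplus> h') [^] (p ^ (r - 1)) = \<sigma> 1 \<oplus> \<sigma>' 1"
      using add_pow_prime_power_distrib[OF prime_p char_p, of h h' "r - 1"] M(2,6) M'(2,6) even_central[of h' h] by simp
    also have "\<dots> = F 1"
    proof -
      have r: "\<rho> 1 = \<sigma> 1" "\<rho>' 1 = \<sigma>' 1" "\<rho> 0 = \<one>" "\<rho>' 0 = \<one>"
        using p_gt_1 p_pow_s_gt_1 M(4) M'(4) by (simp_all add: \<rho>_def \<rho>'_def)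
      have cl: "\<rho> n \<in> carrier A" "\<rho>' n \<in> carrier A" for n
        by (rule evens_closed[OF divided_powers_even[OF dp(1)]], rule evens_closed[OF divided_powers_even[OF dp(2)]])
      have s1: "\<sigma> 1 \<in> carrier A" "\<sigma>' 1 \<in> carrier A" using cl(1)[of 1] cl(2)[of 1] by (simp_all only: r)
      have "convolve \<rho> \<rho>' 1 = \<rho> 1 \<otimes> \<rho>' 0 \<oplus> \<rho> 0 \<otimes> \<rho>' 1"
      proof -
        have "convolve \<rho> \<rho>' 1 = (\<Oplus>a\<in>{..Suc 0}. \<rho> a \<otimes> \<rho>' (Suc 0 - a))"
          by (simp only: convolve_def One_nat_def)
        also have "\<dots> = \<rho> (Suc 0) \<otimes> \<rho>' (Suc 0 - Suc 0) \<oplus> (\<Oplus>a\<in>{..0}. \<rho> a \<otimes> \<rho>' (Suc 0 - a))"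
          by (rule finsum_Suc) (simp add: cl)
        also have "(\<Oplus>a\<in>{..0}. \<rho> a \<otimes> \<rho>' (Suc 0 - a)) = \<rho> 0 \<otimes> \<rho>' (Suc 0 - 0)"
          using finsum_0[of "\<lambda>a. \<rho> a \<otimes> \<rho>' (Suc 0 - a)"] by (simp add: cl)
        finally show ?thesis by simp
      qed
      also have "\<dots> = \<sigma> 1 \<oplus> \<sigma>' 1" using s1 by (simp only: r r_one l_one)
      finally have conv: "convolve \<rho> \<rho>' 1 = \<sigma> 1 \<oplus> \<sigma>' 1" .
      have "\<not> p \<le> 1" using p_gt_1 by simp
      then have "F 1 = (\<sigma> 1 \<oplus> \<sigma>' 1) \<oplus> \<zero>" by (simp only: F_def conv if_False)
      then show ?thesis using s1 by simp
    qed
    finally show ?thesis .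
  qed
  ultimately have "(t \<oplus> t', h \<oplus> h', restrict F {..<p ^ s}) \<in> M_carrier p r s A"
    using M(1,2) M'(1,2) by (intro divided_powers_restrict F) auto
  then show ?thesis
    unfolding m_eq M_mult_eq[OF m m'] \<rho>_def[abs_def, symmetric] \<rho>'_def[abs_def, symmetric] F_def[symmetric] .
qed

end

section \<open>Endomorphisms of M from points of Spec(B)\<close>

lemma superhomD:
  assumes "f \<in> superhom K A B"
  shows "f \<in> ring_hom A B" "f \<in> extensional (carrier A)"
    "x \<in> carrier A \<Longrightarrow> f x \<in> carrier B"
    "\<lbrakk>x \<in> carrier A; y \<in> carrier A\<rbrakk> \<Longrightarrow> f (x \<oplus>\<^bsub>A\<^esub> y) = f x \<oplus>\<^bsub>B\<^esub> f y"
    "\<lbrakk>x \<in> carrier A; y \<in> carrier A\<rbrakk> \<Longrightarrow> f (x \<otimes>\<^bsub>A\<^esub> y) = f x \<otimes>\<^bsub>B\<^esub> f y"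
    "f \<one>\<^bsub>A\<^esub> = \<one>\<^bsub>B\<^esub>"
    "\<lbrakk>c \<in> carrier K; x \<in> carrier A\<rbrakk> \<Longrightarrow> f (c \<odot>\<^bsub>A\<^esub> x) = c \<odot>\<^bsub>B\<^esub> f x"
    "x \<in> evens A \<Longrightarrow> f x \<in> evens B"
    "x \<in> odds A \<Longrightarrow> f x \<in> odds B"
  using assms by (auto simp: superhom_def ring_hom_def)

lemma superhomI:
  assumes "\<And>x. x \<in> carrier A \<Longrightarrow> f x \<in> carrier B"
    "\<And>x y. \<lbrakk>x \<in> carrier A; y \<in> carrier A\<rbrakk> \<Longrightarrow> f (x \<oplus>\<^bsub>A\<^esub> y) = f x \<oplus>\<^bsub>B\<^esub> f y"
    "\<And>x y. \<lbrakk>x \<in> carrier A; y \<in> carrier A\<rbrakk> \<Longrightarrow> f (x \<otimes>\<^bsub>A\<^esub> y) = f x \<otimes>\<^bsub>B\<^esub> f y"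
    "f \<one>\<^bsub>A\<^esub> = \<one>\<^bsub>B\<^esub>"
    "\<And>c x. \<lbrakk>c \<in> carrier K; x \<in> carrier A\<rbrakk> \<Longrightarrow> f (c \<odot>\<^bsub>A\<^esub> x) = c \<odot>\<^bsub>B\<^esub> f x"
    "\<And>x. x \<in> evens A \<Longrightarrow> f x \<in> evens B"
    "\<And>x. x \<in> odds A \<Longrightarrow> f x \<in> odds B"
    "f \<in> extensional (carrier A)"
  shows "f \<in> superhom K A B"
  using assms by (auto simp: superhom_def ring_hom_def)

lemma superhom_eqI:
  assumes "f \<in> superhom K A B" "g \<in> superhom K A B" "\<And>x. x \<in> carrier A \<Longrightarrow> f x = g x"
  shows "f = g"
  using extensionalityI[OF superhomD(2)[OF assms(1)] superhomD(2)[OF assms(2)] assms(3)] .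

lemma superhom_compose:
  assumes "superalgebra K A" "f \<in> superhom K A B" "g \<in> superhom K B C"
  shows "compose (carrier A) g f \<in> superhom K A C"
proof -
  interpret superalgebra K A by fact
  note f = superhomD[OF assms(2)] and g = superhomD[OF assms(3)]
  show ?thesis
    by (rule superhomI) (auto simp: compose_def f g)
qed

lemma superhom_id:
  assumes "superalgebra K A"
  shows "(\<lambda>x\<in>carrier A. x) \<in> superhom K A A"
proof -
  interpret superalgebra K A by fact
  show ?thesis by (rule superhomI) auto
qed

lemma
  assumes "superalgebra K A" "superalgebra K B" "f \<in> superhom K A B"
  shows superhom_zero: "f \<zero>\<^bsub>A\<^esub> = \<zero>\<^bsub>B\<^esub>"
    and superhom_pow: "x \<in> carrier A \<Longrightarrow> f (x [^]\<^bsub>A\<^esub> (n :: nat)) = f x [^]\<^bsub>B\<^esub> n"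
    and superhom_add_pow: "x \<in> carrier A \<Longrightarrow> f ([n] \<cdot>\<^bsub>A\<^esub> x) = [n] \<cdot>\<^bsub>B\<^esub> f x"
    and superhom_finsum: "g \<in> I \<rightarrow> carrier A \<Longrightarrow> f (\<Oplus>\<^bsub>A\<^esub>i\<in>I. g i) = (\<Oplus>\<^bsub>B\<^esub>i\<in>I. f (g i))"
proof -
  interpret A: superalgebra K A by fact
  interpret B: superalgebra K B by fact
  note f = superhomD[OF assms(3)]
  show zero: "f \<zero>\<^bsub>A\<^esub> = \<zero>\<^bsub>B\<^esub>"
    using f(4)[of "\<zero>\<^bsub>A\<^esub>" "\<zero>\<^bsub>A\<^esub>"] f(3)[of "\<zero>\<^bsub>A\<^esub>"] by (simp add: B.add.r_cancel_one)
  show "x \<in> carrier A \<Longrightarrow> f (x [^]\<^bsub>A\<^esub> (n :: nat)) = f x [^]\<^bsub>B\<^esub> n"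
    by (induction n) (auto simp: f)
  show "x \<in> carrier A \<Longrightarrow> f ([n] \<cdot>\<^bsub>A\<^esub> x) = [n] \<cdot>\<^bsub>B\<^esub> f x"
    by (induction n) (auto simp: f zero)
  show "g \<in> I \<rightarrow> carrier A \<Longrightarrow> f (\<Oplus>\<^bsub>A\<^esub>i\<in>I. g i) = (\<Oplus>\<^bsub>B\<^esub>i\<in>I. f (g i))"
    by (rule finsum_additive[OF A.abelian_monoid_axioms B.abelian_monoid_axioms]) (auto simp: f zero)
qed

context odd_char_superalgebra
begin

lemma M_sigma_even: "\<lbrakk>(t, h, \<sigma>) \<in> M_carrier p r s A; i < p ^ s\<rbrakk> \<Longrightarrow> \<sigma> i \<in> evens A"
  using M_carrierD(3) by auto

lemma Spec_BD:
  assumes "(\<mu>, a) \<in> Spec_B p r A"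
  shows "\<mu> \<in> evens A" "a \<in> evens A" "\<mu> \<otimes> \<mu> = a [^] (p ^ r)"
  using assms by (auto simp: Spec_B_def)

lemma Spec_B_one: "(\<one>, \<one>) \<in> Spec_B p r A"
  by (simp add: Spec_B_def one_even)

lemma Spec_B_zero: "(\<zero>, \<zero>) \<in> Spec_B p r A"
  using p_gt_1 by (simp add: Spec_B_def nat_pow_zero)

lemma Spec_B_mult:
  assumes "(\<mu>, a) \<in> Spec_B p r A" "(\<mu>', a') \<in> Spec_B p r A"
  shows "(\<mu> \<otimes> \<mu>', a \<otimes> a') \<in> Spec_B p r A"
proof -
  note b = Spec_BD[OF assms(1)] Spec_BD[OF assms(2)]
  have "(\<mu> \<otimes> \<mu>') \<otimes> (\<mu> \<otimes> \<mu>') = (\<mu> \<otimes> \<mu>) \<otimes> (\<mu>' \<otimes> \<mu>')"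
    using b by (intro even_mult_mult) auto
  also have "\<dots> = (a \<otimes> a') [^] (p ^ r)"
    using b pow_mult_distrib[OF even_central[of a' a], of "p ^ r"] by simp
  finally show ?thesis using b by (simp add: Spec_B_def even_even)
qed

lemma M_endo_closed:
  assumes "b \<in> Spec_B p r A" "m \<in> M_carrier p r s A"
  shows "M_endo p r s A b m \<in> M_carrier p r s A"
proof -
  obtain \<mu> a t h \<sigma> where eq: "b = (\<mu>, a)" "m = (t, h, \<sigma>)" by (metis prod_cases3 surj_pair)
  note b = Spec_BD[OF assms(1)[unfolded eq]] and m = M_carrierD[OF assms(2)[unfolded eq]]
  note \<sigma> = M_sigma_even[OF assms(2)[unfolded eq]]
  let ?P = "p ^ (r - 1)"
  let ?x = "\<lambda>i. a [^] (i * ?P)"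
  have cl [simp]: "t \<in> carrier A" "h \<in> carrier A" "a \<in> carrier A" "\<mu> \<in> carrier A" using m(1,2) b by auto
  have x [simp]: "?x i \<in> evens A" for i using b by simp
  have xx: "?x i \<otimes> ?x j = ?x (i + j)" for i j by (simp add: nat_pow_mult add_mult_distrib)
  have prod: "(\<sigma> i \<otimes> ?x i) \<otimes> (\<sigma> j \<otimes> ?x j) =
      (if i + j < p ^ s then [((i + j) choose i)] \<cdot> (\<sigma> (i + j) \<otimes> ?x (i + j)) else \<zero>)"
    if "i < p ^ s" "j < p ^ s" for i j
  proof -
    have "(\<sigma> i \<otimes> ?x i) \<otimes> (\<sigma> j \<otimes> ?x j) = (\<sigma> i \<otimes> \<sigma> j) \<otimes> ?x (i + j)"
      using \<sigma> that even_mult_mult[of "\<sigma> i" "?x i" "\<sigma> j" "?x j"] x by (simp only: xx[of i j, symmetric]) simp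
    also have "\<dots> = (if i + j < p ^ s then [((i + j) choose i)] \<cdot> (\<sigma> (i + j) \<otimes> ?x (i + j)) else \<zero>)"
      using \<sigma> that by (simp add: m(7) add_pow_ldistr)
    finally show ?thesis .
  qed
  have tm: "(t \<otimes> \<mu>) \<otimes> (t \<otimes> \<mu>) = \<zero>"
    using even_mult_mult[of t \<mu> t \<mu>] b m(5) by simp
  have hP: "(h \<otimes> a) [^] ?P = \<sigma> 1 \<otimes> ?x 1"
    using m(2,6) b pow_mult_distrib[OF even_central[of a h], of ?P] by simp
  have ps: "0 < p ^ s" "Suc 0 < p ^ s" using p_gt_1 p_pow_s_gt_1 by auto
  have "(\<lambda>i\<in>{..<p ^ s}. \<sigma> i \<otimes> ?x i) \<in> {..<p ^ s} \<rightarrow>\<^sub>E evens A"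
    using \<sigma> x by (auto simp: even_even)
  moreover have "t \<otimes> \<mu> \<in> odds A" "h \<otimes> a \<in> evens A" using m(1,2) b by (auto simp: odd_even even_even)
  ultimately show ?thesis
    using tm hP ps prod m(4) by (simp add: eq M_endo_def M_carrier_def)
qed

lemma convolve_scale:
  assumes "\<And>n. \<rho> n \<in> evens A" "\<And>n. \<rho>' n \<in> evens A" "a \<in> evens A"
  shows "convolve (\<lambda>n. \<rho> n \<otimes> a [^] (n * P)) (\<lambda>n. \<rho>' n \<otimes> a [^] (n * P)) n =
    convolve \<rho> \<rho>' n \<otimes> a [^] ((n :: nat) * P)"
proof -
  have "convolve (\<lambda>n. \<rho> n \<otimes> a [^] (n * P)) (\<lambda>n. \<rho>' n \<otimes> a [^] (n * P)) n =
    (\<Oplus>i\<in>{..n}. (\<rho> i \<otimes> \<rho>' (n - i)) \<otimes> a [^] (n * P))"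
    unfolding convolve_def
  proof (intro finsum_cong' refl funcsetI)
    fix i assume i: "i \<in> {..n}"
    have "a [^] (i * P) \<otimes> a [^] ((n - i) * P) = a [^] (n * P)"
      using i assms(3) by (simp add: nat_pow_mult add_mult_distrib[symmetric])
    then show "(\<rho> i \<otimes> a [^] (i * P)) \<otimes> (\<rho>' (n - i) \<otimes> a [^] ((n - i) * P)) = (\<rho> i \<otimes> \<rho>' (n - i)) \<otimes> a [^] (n * P)"
      using assms even_mult_mult[of "\<rho> i" "a [^] (i * P)" "\<rho>' (n - i)" "a [^] ((n - i) * P)"] by simp
  qed (use assms in auto)
  also have "\<dots> = convolve \<rho> \<rho>' n \<otimes> a [^] (n * P)"
    unfolding convolve_def using assms by (intro finsum_ldistr[symmetric]) auto
  finally show ?thesis .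
qed

text \<open>
  This is where the relation \<open>\<mu>\<^sup>2 = a ^ (p ^ r)\<close> of \<open>Spec(B)\<close> enters: in the two sums of the comultiplication of
  \<open>\<sigma>\<^sub>n\<close> the scaling factors are \<open>a ^ (n * p ^ (r - 1))\<close> and \<open>a ^ ((n - p) * p ^ (r - 1)) * \<mu>\<^sup>2\<close>, and these must agree.
\<close>

lemma M_endo_mult:
  assumes "b \<in> Spec_B p r A" "m \<in> M_carrier p r s A" "m' \<in> M_carrier p r s A"
  shows "M_endo p r s A b (M_mult p s A m m') = M_mult p s A (M_endo p r s A b m) (M_endo p r s A b m')"
proof -
  obtain \<mu> a t h \<sigma> t' h' \<sigma>' where eq: "b = (\<mu>, a)" "m = (t, h, \<sigma>)" "m' = (t', h', \<sigma>')"
    by (metis prod_cases3 surj_pair)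
  note m = assms(2)[unfolded eq] and m' = assms(3)[unfolded eq]
  note b = Spec_BD[OF assms(1)[unfolded eq]]
  let ?P = "p ^ (r - 1)"
  let ?x = "\<lambda>i. a [^] (i * ?P)"
  define \<rho> where "\<rho> n = (if n < p ^ s then \<sigma> n else \<zero>)" for n
  define \<rho>' where "\<rho>' n = (if n < p ^ s then \<sigma>' n else \<zero>)" for n
  have cl [simp]: "t \<in> carrier A" "t' \<in> carrier A" "h \<in> carrier A" "h' \<in> carrier A" "a \<in> carrier A" "\<mu> \<in> carrier A"
    using M_carrierD(1,2)[OF m] M_carrierD(1,2)[OF m'] b by auto
  have \<rho>: "\<rho> n \<in> evens A" "\<rho>' n \<in> evens A" for n
    using M_sigma_even[OF m] M_sigma_even[OF m'] by (auto simp: \<rho>_def \<rho>'_def)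
  then have c: "convolve \<rho> \<rho>' n \<in> evens A" for n
    unfolding convolve_def by (intro evens_finsum) (auto simp: even_even)
  have e: "(t \<otimes> \<mu>, h \<otimes> a, \<lambda>i\<in>{..<p ^ s}. \<sigma> i \<otimes> ?x i) \<in> M_carrier p r s A"
    "(t' \<otimes> \<mu>, h' \<otimes> a, \<lambda>i\<in>{..<p ^ s}. \<sigma>' i \<otimes> ?x i) \<in> M_carrier p r s A"
    using M_endo_closed[OF assms(1,2)] M_endo_closed[OF assms(1,3)] by (simp_all add: eq M_endo_def)
  have ext: "(\<lambda>n. if n < p ^ s then (\<lambda>i\<in>{..<p ^ s}. \<sigma> i \<otimes> ?x i) n else \<zero>) = (\<lambda>n. \<rho> n \<otimes> ?x n)"
    "(\<lambda>n. if n < p ^ s then (\<lambda>i\<in>{..<p ^ s}. \<sigma>' i \<otimes> ?x i) n else \<zero>) = (\<lambda>n. \<rho>' n \<otimes> ?x n)"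
    by (auto simp: \<rho>_def \<rho>'_def)
  have odd_part: "convolve \<rho> \<rho>' (n - p) \<otimes> ?x (n - p) \<otimes> ((t \<otimes> \<mu>) \<otimes> (t' \<otimes> \<mu>)) =
      convolve \<rho> \<rho>' (n - p) \<otimes> (t \<otimes> t') \<otimes> ?x n" if "p \<le> n" for n
  proof -
    have "(t \<otimes> \<mu>) \<otimes> (t' \<otimes> \<mu>) = (t \<otimes> t') \<otimes> (\<mu> \<otimes> \<mu>)" using b by (intro even_mult_mult) auto
    moreover have "p ^ r = p * ?P" using r_pos by (simp add: power_eq_if)
    ultimately have "(t \<otimes> \<mu>) \<otimes> (t' \<otimes> \<mu>) = (t \<otimes> t') \<otimes> ?x p" using b by simp
    moreover have "?x (n - p) \<otimes> ?x p = ?x n"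
      using that by (simp add: nat_pow_mult add_mult_distrib[symmetric])
    ultimately show ?thesis
      using even_mult_mult[of "convolve \<rho> \<rho>' (n - p)" "?x (n - p)" "t \<otimes> t'" "?x p"] b c by simp
  qed
  have third: "(convolve \<rho> \<rho>' n \<oplus> (if p \<le> n then convolve \<rho> \<rho>' (n - p) \<otimes> (t \<otimes> t') else \<zero>)) \<otimes> ?x n =
    convolve (\<lambda>n. \<rho> n \<otimes> ?x n) (\<lambda>n. \<rho>' n \<otimes> ?x n) n \<oplus>
      (if p \<le> n then convolve (\<lambda>n. \<rho> n \<otimes> ?x n) (\<lambda>n. \<rho>' n \<otimes> ?x n) (n - p) \<otimes> ((t \<otimes> \<mu>) \<otimes> (t' \<otimes> \<mu>)) else \<zero>)" for n
    using odd_part[of n] c b by (auto simp: convolve_scale[OF \<rho> b(2)] l_distr)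
  have "M_mult p s A (M_endo p r s A b m) (M_endo p r s A b m') =
    ((t \<otimes> \<mu>) \<oplus> (t' \<otimes> \<mu>), (h \<otimes> a) \<oplus> (h' \<otimes> a),
     restrict (\<lambda>n. convolve (\<lambda>n. \<rho> n \<otimes> ?x n) (\<lambda>n. \<rho>' n \<otimes> ?x n) n \<oplus>
      (if p \<le> n then convolve (\<lambda>n. \<rho> n \<otimes> ?x n) (\<lambda>n. \<rho>' n \<otimes> ?x n) (n - p) \<otimes> ((t \<otimes> \<mu>) \<otimes> (t' \<otimes> \<mu>)) else \<zero>))
      {..<p ^ s})"
    using M_mult_eq[OF e] unfolding ext by (simp add: eq M_endo_def)
  also have "\<dots> = M_endo p r s A b (M_mult p s A m m')"
    unfolding third[symmetric] eq M_mult_eq[OF m m'] \<rho>_def[abs_def, symmetric] \<rho>'_def[abs_def, symmetric]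
    by (auto simp: M_endo_def l_distr)
  finally show ?thesis ..
qed

lemma M_endo_comp:
  assumes "(\<mu>, a) \<in> Spec_B p r A" "(\<mu>', a') \<in> Spec_B p r A" "m \<in> M_carrier p r s A"
  shows "M_endo p r s A (\<mu>, a) (M_endo p r s A (\<mu>', a') m) = M_endo p r s A (\<mu> \<otimes> \<mu>', a \<otimes> a') m"
proof -
  obtain t h \<sigma> where eq: "m = (t, h, \<sigma>)" by (metis prod_cases3)
  note m = assms(3)[unfolded eq]
  have cl: "\<mu> \<in> carrier A" "a \<in> carrier A" "\<mu>' \<in> carrier A" "a' \<in> carrier A" "t \<in> carrier A" "h \<in> carrier A"
    using Spec_BD[OF assms(1)] Spec_BD[OF assms(2)] M_carrierD(1,2)[OF m] by auto
  have c: "\<mu>' \<otimes> \<mu> = \<mu> \<otimes> \<mu>'" "a' \<otimes> a = a \<otimes> a'"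
    using even_central cl Spec_BD[OF assms(1)] by auto
  have "\<sigma> i \<otimes> a' [^] n \<otimes> a [^] n = \<sigma> i \<otimes> (a \<otimes> a') [^] n" if "i < p ^ s" for i and n :: nat
    using M_sigma_even[OF m that] cl c by (simp add: m_assoc pow_mult_distrib[symmetric])
  then show ?thesis using cl c by (auto simp: eq M_endo_def m_assoc)
qed

lemma M_endo_one:
  assumes "m \<in> M_carrier p r s A"
  shows "M_endo p r s A (\<one>, \<one>) m = m"
proof -
  obtain t h \<sigma> where eq: "m = (t, h, \<sigma>)" by (metis prod_cases3)
  note m = assms[unfolded eq]
  have "(\<lambda>i\<in>{..<p ^ s}. \<sigma> i \<otimes> \<one>) = \<sigma>"
    using M_carrierD(3)[OF m] by (auto simp: fun_eq_iff PiE_iff extensional_def)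
  then show ?thesis using M_carrierD(1,2)[OF m] by (simp add: eq M_endo_def)
qed

text \<open>
  The right hand side is the identity of \<open>M\<close>; the factor \<open>0 ^ 0 = 1\<close> keeps \<open>\<sigma>\<^sub>0\<close>.
\<close>

lemma M_endo_zero:
  assumes "m \<in> M_carrier p r s A"
  shows "M_endo p r s A (\<zero>, \<zero>) m = (\<zero>, \<zero>, \<lambda>i\<in>{..<p ^ s}. if i = 0 then \<one> else \<zero>)"
proof -
  obtain t h \<sigma> where eq: "m = (t, h, \<sigma>)" by (metis prod_cases3)
  note m = assms[unfolded eq]
  have "\<sigma> i \<otimes> \<zero> [^] (i * p ^ (r - 1)) = (if i = 0 then \<one> else \<zero>)" if "i < p ^ s" for i
    using M_carrierD(4)[OF m] M_sigma_even[OF m that] p_gt_1 by (simp add: nat_pow_zero)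
  then show ?thesis using M_carrierD(1,2)[OF m] by (auto simp: eq M_endo_def)
qed

end

section \<open>The action on homomorphisms from M to G\<close>

lemma fobj_M_scheme [simp]:
  "carrier (fobj (M_scheme p r s) A) = M_carrier p r s A"
  "monoid.mult (fobj (M_scheme p r s) A) = M_mult p s A"
  by (simp_all add: M_scheme_def)

lemma fmap_M_scheme: "fmap (M_scheme p r s) A B f (t, h, \<sigma>) = (f t, f h, \<lambda>i\<in>{..<p ^ s}. f (\<sigma> i))"
  by (simp add: M_scheme_def)

locale M_setting =
  fixes K :: "'u ring" and p r s :: nat
  assumes infinite_universe: "infinite (UNIV :: 'u set)"
    and field_K: "field K" and char_K: "has_characteristic K p" and p_ge_3: "p \<ge> 3"
    and r_pos: "r \<ge> 1" and s_pos: "s \<ge> 1"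
begin

abbreviation "M \<equiv> M_scheme p r s"

lemma prime_p: "prime p" and odd_p: "odd p"
  using characteristic_odd_prime[OF field_K char_K p_ge_3] by auto

lemma odd_char_superalgebra:
  assumes "comm_superalgebra K A"
  shows "odd_char_superalgebra K A p r s"
proof -
  interpret comm_superalgebra K A by fact
  show ?thesis
    by unfold_locales (use prime_p odd_p r_pos s_pos characteristic_add_pow[OF char_K] in auto)
qed

lemma comm_superalgebra_superalgebra: "comm_superalgebra K A \<Longrightarrow> superalgebra K A"
  by (rule comm_superalgebra.axioms(1))

lemma fmap_M_closed:
  assumes "comm_superalgebra K A" "comm_superalgebra K B" "f \<in> superhom K A B" "m \<in> M_carrier p r s A"
  shows "fmap M A B f m \<in> M_carrier p r s B"
proof -
  interpret A: odd_char_superalgebra K A p r s by (rule odd_char_superalgebra) fact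
  interpret B: odd_char_superalgebra K B p r s by (rule odd_char_superalgebra) fact
  note sup = A.superalgebra_axioms B.superalgebra_axioms assms(3)
  note f = superhomD[OF assms(3)] superhom_zero[OF sup]
  obtain t h \<sigma> where eq: "m = (t, h, \<sigma>)" by (metis prod_cases3)
  note m = A.M_carrierD[OF assms(4)[unfolded eq]]
  have \<sigma>: "\<sigma> i \<in> evens A" "\<sigma> i \<in> carrier A" if "i < p ^ s" for i
    using A.M_sigma_even[OF assms(4)[unfolded eq] that] by auto
  have "f t \<otimes>\<^bsub>B\<^esub> f t = \<zero>\<^bsub>B\<^esub>" using f(5)[of t t] m(1,5) f(10) by simp
  moreover have "f h [^]\<^bsub>B\<^esub> (p ^ (r - 1)) = f (\<sigma> 1)"
    using superhom_pow[OF sup, of h "p ^ (r - 1)"] m(2,6) by simp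
  moreover have "f (\<sigma> i) \<otimes>\<^bsub>B\<^esub> f (\<sigma> j) =
      (if i + j < p ^ s then [((i + j) choose i)] \<cdot>\<^bsub>B\<^esub> f (\<sigma> (i + j)) else \<zero>\<^bsub>B\<^esub>)"
    if "i < p ^ s" "j < p ^ s" for i j
    using f(5)[of "\<sigma> i" "\<sigma> j"] \<sigma> that m(7)[OF that] superhom_add_pow[OF sup, of "\<sigma> (i + j)"] f(10) by auto
  ultimately show ?thesis
    using A.p_gt_1 A.p_pow_s_gt_1 m(1,2,4) f(6,8,9) \<sigma>(1) by (simp add: eq fmap_M_scheme M_carrier_def)
qed

lemma Spec_B_map:
  assumes "comm_superalgebra K A" "comm_superalgebra K B" "f \<in> superhom K A B" "(\<mu>, a) \<in> Spec_B p r A"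
  shows "(f \<mu>, f a) \<in> Spec_B p r B"
proof -
  interpret A: odd_char_superalgebra K A p r s by (rule odd_char_superalgebra) fact
  interpret B: odd_char_superalgebra K B p r s by (rule odd_char_superalgebra) fact
  note sup = A.superalgebra_axioms B.superalgebra_axioms assms(3)
  note f = superhomD[OF assms(3)] and b = A.Spec_BD[OF assms(4)]
  show ?thesis
    using f(5)[of \<mu> \<mu>] superhom_pow[OF sup, of a "p ^ r"] b f(8) by (simp add: Spec_B_def)
qed

lemma M_endo_natural:
  assumes "comm_superalgebra K A" "comm_superalgebra K B" "f \<in> superhom K A B"
    "(\<mu>, a) \<in> Spec_B p r A" "m \<in> M_carrier p r s A"
  shows "fmap M A B f (M_endo p r s A (\<mu>, a) m) =
    M_endo p r s B (f \<mu>, f a) (fmap M A B f m)"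
proof -
  interpret A: odd_char_superalgebra K A p r s by (rule odd_char_superalgebra) fact
  interpret B: odd_char_superalgebra K B p r s by (rule odd_char_superalgebra) fact
  note sup = A.superalgebra_axioms B.superalgebra_axioms assms(3)
  note f = superhomD[OF assms(3)] and b = A.Spec_BD[OF assms(4)]
  obtain t h \<sigma> where eq: "m = (t, h, \<sigma>)" by (metis prod_cases3)
  note m = A.M_carrierD[OF assms(5)[unfolded eq]]
  have "\<sigma> i \<in> carrier A" if "i < p ^ s" for i
    using A.M_sigma_even[OF assms(5)[unfolded eq] that] by auto
  then show ?thesis
    using b m(1,2) superhom_pow[OF sup] by (auto simp: eq fmap_M_scheme M_endo_def f(5))
qed

lemma superalgebras_overD:
  assumes "(B, j) \<in> superalgebras_over K A"
  shows "comm_superalgebra K B" "j \<in> superhom K A B"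
  using assms by (auto simp: superalgebras_over_def)

lemma base_changed_homsD:
  assumes "\<eta> \<in> base_changed_homs K N G A" "(B, j) \<in> superalgebras_over K A"
  shows "\<eta> (B, j) \<in> hom (fobj N B) (fobj G B)" "\<eta> (B, j) \<in> extensional (carrier (fobj N B))"
    "\<lbrakk>(B', j') \<in> superalgebras_over K A; g \<in> superhom K B B'; compose (carrier A) g j = j';
      x \<in> carrier (fobj N B)\<rbrakk> \<Longrightarrow> \<eta> (B', j') (fmap N B B' g x) = fmap G B B' g (\<eta> (B, j) x)"
  using assms unfolding base_changed_homs_def
  by (simp_all only: mem_Collect_eq Ball_def split_paired_All prod.case) blast+

lemma base_changed_homs_extensional: "\<eta> \<in> base_changed_homs K N G A \<Longrightarrow> \<eta> \<in> extensional (superalgebras_over K A)"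
  by (simp add: base_changed_homs_def)

lemma base_changed_homsI:
  assumes "\<eta> \<in> extensional (superalgebras_over K A)"
    "\<And>B j. (B, j) \<in> superalgebras_over K A \<Longrightarrow> \<eta> (B, j) \<in> hom (fobj N B) (fobj G B)"
    "\<And>B j. (B, j) \<in> superalgebras_over K A \<Longrightarrow> \<eta> (B, j) \<in> extensional (carrier (fobj N B))"
    "\<And>B j B' j' g x. \<lbrakk>(B, j) \<in> superalgebras_over K A; (B', j') \<in> superalgebras_over K A; g \<in> superhom K B B';
      compose (carrier A) g j = j'; x \<in> carrier (fobj N B)\<rbrakk> \<Longrightarrow>
      \<eta> (B', j') (fmap N B B' g x) = fmap G B B' g (\<eta> (B, j) x)"
  shows "\<eta> \<in> base_changed_homs K N G A"
  using assms by (auto simp: base_changed_homs_def)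

lemma right_action_apply:
  assumes "(B, j) \<in> superalgebras_over K A" "m \<in> M_carrier p r s B"
  shows "right_action K p r s A (\<mu>, a) \<eta> (B, j) m = \<eta> (B, j) (M_endo p r s B (j \<mu>, j a) m)"
  using assms by (simp add: right_action_def)

lemma right_action_closed:
  assumes A: "comm_superalgebra K A" and b: "b \<in> Spec_B p r A"
    and \<eta>: "\<eta> \<in> base_changed_homs K M G A"
  shows "right_action K p r s A b \<eta> \<in> base_changed_homs K M G A"
proof -
  obtain \<mu> a where eq: "b = (\<mu>, a)" by (cases b)
  show ?thesis unfolding eq
  proof (rule base_changed_homsI)
    fix B j assume B: "(B, j) \<in> superalgebras_over K A"
    note B' = superalgebras_overD[OF B] and h = base_changed_homsD[OF \<eta> B]
    interpret B: odd_char_superalgebra K B p r s by (rule odd_char_superalgebra) fact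
    have jb: "(j \<mu>, j a) \<in> Spec_B p r B" using Spec_B_map[OF A B'] b eq by simp
    show "right_action K p r s A (\<mu>, a) \<eta> (B, j) \<in> hom (fobj M B) (fobj G B)"
    proof (rule homI)
      fix x assume "x \<in> carrier (fobj M B)"
      then show "right_action K p r s A (\<mu>, a) \<eta> (B, j) x \<in> carrier (fobj G B)"
        using hom_in_carrier[OF h(1)] B.M_endo_closed[OF jb] by (simp add: right_action_apply[OF B])
    next
      fix x y assume "x \<in> carrier (fobj M B)" "y \<in> carrier (fobj M B)"
      then show "right_action K p r s A (\<mu>, a) \<eta> (B, j) (x \<otimes>\<^bsub>fobj M B\<^esub> y) =
        right_action K p r s A (\<mu>, a) \<eta> (B, j) x \<otimes>\<^bsub>fobj G B\<^esub> right_action K p r s A (\<mu>, a) \<eta> (B, j) y"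
        using hom_mult[OF h(1)] B.M_endo_closed[OF jb] B.M_endo_mult[OF jb] B.M_mult_closed
        by (simp add: right_action_apply[OF B])
    qed
    show "right_action K p r s A (\<mu>, a) \<eta> (B, j) \<in> extensional (carrier (fobj M B))"
      using B by (simp add: right_action_def)
  next
    fix B j B' j' g x
    assume B: "(B, j) \<in> superalgebras_over K A" and C: "(B', j') \<in> superalgebras_over K A"
      and g: "g \<in> superhom K B B'" and gj: "compose (carrier A) g j = j'"
      and "x \<in> carrier (fobj M B)"
    then have x: "x \<in> M_carrier p r s B" by simp
    note B' = superalgebras_overD[OF B] and C' = superalgebras_overD[OF C]
    interpret A: odd_char_superalgebra K A p r s by (rule odd_char_superalgebra) fact
    interpret B: odd_char_superalgebra K B p r s by (rule odd_char_superalgebra) fact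
    have jb: "(j \<mu>, j a) \<in> Spec_B p r B" using Spec_B_map[OF A B'] b eq by simp
    have "\<mu> \<in> carrier A" "a \<in> carrier A" using A.Spec_BD b eq by auto
    then have j': "j' \<mu> = g (j \<mu>)" "j' a = g (j a)" using gj by (auto simp: compose_def)
    show "right_action K p r s A (\<mu>, a) \<eta> (B', j') (fmap M B B' g x) =
      fmap G B B' g (right_action K p r s A (\<mu>, a) \<eta> (B, j) x)"
      using base_changed_homsD(3)[OF \<eta> B C g gj] B.M_endo_closed[OF jb x] M_endo_natural[OF B'(1) C'(1) g jb x, symmetric]
      by (simp add: j' right_action_apply[OF B x] right_action_apply[OF C fmap_M_closed[OF B'(1) C'(1) g x]])
  qed (simp add: right_action_def)
qed

lemma base_change_apply:
  assumes "(B, j) \<in> superalgebras_over K A'"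
  shows "base_change K A A' f \<eta> (B, j) = \<eta> (B, compose (carrier A) j f)"
  using assms by (simp add: base_change_def)

lemma superalgebras_over_compose:
  assumes "comm_superalgebra K A" "f \<in> superhom K A A'" "(B, j) \<in> superalgebras_over K A'"
  shows "(B, compose (carrier A) j f) \<in> superalgebras_over K A"
  using superhom_compose[OF comm_superalgebra_superalgebra[OF assms(1)] assms(2)] superalgebras_overD[OF assms(3)]
  by (simp add: superalgebras_over_def)

lemma eq_on_superalgebras_over:
  assumes "\<eta> \<in> extensional (superalgebras_over K A)" "\<eta>' \<in> extensional (superalgebras_over K A)"
    and "\<And>B j. (B, j) \<in> superalgebras_over K A \<Longrightarrow> \<eta> (B, j) = \<eta>' (B, j)"
  shows "\<eta> = \<eta>'"
  using assms(3) by (intro extensionalityI[OF assms(1,2)]) auto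

text \<open>
  The action is natural in the test superalgebra. Together with representability this transports it to
  homomorphisms out of \<open>R\<close>.
\<close>

lemma base_change_right_action:
  assumes "comm_superalgebra K A" "comm_superalgebra K A'" "f \<in> superhom K A A'" "(\<mu>, a) \<in> Spec_B p r A"
  shows "base_change K A A' f (right_action K p r s A (\<mu>, a) \<eta>) =
    right_action K p r s A' (f \<mu>, f a) (base_change K A A' f \<eta>)"
proof (rule eq_on_superalgebras_over)
  interpret A: odd_char_superalgebra K A p r s by (rule odd_char_superalgebra) fact
  have \<mu>: "\<mu> \<in> carrier A" "a \<in> carrier A" using A.Spec_BD[OF assms(4)] by auto
  fix B j assume B: "(B, j) \<in> superalgebras_over K A'"
  show "base_change K A A' f (right_action K p r s A (\<mu>, a) \<eta>) (B, j) =
    right_action K p r s A' (f \<mu>, f a) (base_change K A A' f \<eta>) (B, j)"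
    using superalgebras_over_compose[OF assms(1,3) B] B \<mu>
    by (simp add: base_change_apply right_action_def compose_eq restrict_def fun_eq_iff del: split_paired_All)
qed (auto simp: base_change_def right_action_def)

lemma right_action_comp:
  assumes A: "comm_superalgebra K A" and "(\<mu>, a) \<in> Spec_B p r A" "(\<mu>', a') \<in> Spec_B p r A"
  shows "right_action K p r s A (\<mu>', a') (right_action K p r s A (\<mu>, a) \<eta>) =
    right_action K p r s A (\<mu> \<otimes>\<^bsub>A\<^esub> \<mu>', a \<otimes>\<^bsub>A\<^esub> a') \<eta>"
proof (rule eq_on_superalgebras_over)
  interpret A: odd_char_superalgebra K A p r s by (rule odd_char_superalgebra) fact
  fix B j assume B: "(B, j) \<in> superalgebras_over K A"
  note B' = superalgebras_overD[OF B]
  interpret B: odd_char_superalgebra K B p r s by (rule odd_char_superalgebra) fact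
  note jb = Spec_B_map[OF A B' assms(2)] and jb' = Spec_B_map[OF A B' assms(3)]
  have j: "j (\<mu> \<otimes>\<^bsub>A\<^esub> \<mu>') = j \<mu> \<otimes>\<^bsub>B\<^esub> j \<mu>'" "j (a \<otimes>\<^bsub>A\<^esub> a') = j a \<otimes>\<^bsub>B\<^esub> j a'"
    using A.Spec_BD[OF assms(2)] A.Spec_BD[OF assms(3)] by (auto intro!: superhomD(5)[OF B'(2)])
  show "right_action K p r s A (\<mu>', a') (right_action K p r s A (\<mu>, a) \<eta>) (B, j) =
    right_action K p r s A (\<mu> \<otimes>\<^bsub>A\<^esub> \<mu>', a \<otimes>\<^bsub>A\<^esub> a') \<eta> (B, j)"
    using B B.M_endo_closed[OF jb'] B.M_endo_comp[OF jb jb'] j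
    by (auto simp: right_action_def restrict_def fun_eq_iff)
qed (auto simp: right_action_def)

lemma right_action_one:
  assumes A: "comm_superalgebra K A" and \<eta>: "\<eta> \<in> base_changed_homs K M G A"
  shows "right_action K p r s A (\<one>\<^bsub>A\<^esub>, \<one>\<^bsub>A\<^esub>) \<eta> = \<eta>"
proof (rule eq_on_superalgebras_over)
  fix B j assume B: "(B, j) \<in> superalgebras_over K A"
  note B' = superalgebras_overD[OF B]
  interpret B: odd_char_superalgebra K B p r s by (rule odd_char_superalgebra) fact
  show "right_action K p r s A (\<one>\<^bsub>A\<^esub>, \<one>\<^bsub>A\<^esub>) \<eta> (B, j) = \<eta> (B, j)"
    using B B.M_endo_one base_changed_homsD(2)[OF \<eta> B]
    by (auto simp: right_action_def restrict_def fun_eq_iff extensional_def superhomD(6)[OF B'(2)])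
qed (use base_changed_homs_extensional[OF \<eta>] in \<open>auto simp: right_action_def\<close>)

definition trivial_hom ::
  "('u, 'g) group_functor \<Rightarrow> ('u, 'u) superalg \<Rightarrow> ('u, 'u) superalg \<times> ('u \<Rightarrow> 'u) \<Rightarrow> 'u M_point \<Rightarrow> 'g" where
  "trivial_hom G A = restrict (\<lambda>(B, j). \<lambda>m\<in>M_carrier p r s B. \<one>\<^bsub>fobj G B\<^esub>) (superalgebras_over K A)"

lemma fmap_group_one:
  assumes "is_group_functor K G" "comm_superalgebra K A" "comm_superalgebra K B" "f \<in> superhom K A B"
  shows "fmap G A B f \<one>\<^bsub>fobj G A\<^esub> = \<one>\<^bsub>fobj G B\<^esub>"
  using assms unfolding is_group_functor_def by (meson hom_one)

lemma trivial_hom_closed: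
  assumes G: "is_group_functor K G"
  shows "trivial_hom G A \<in> base_changed_homs K M G A"
proof (rule base_changed_homsI)
  fix B j assume B: "(B, j) \<in> superalgebras_over K A"
  note B' = superalgebras_overD[OF B]
  interpret B: odd_char_superalgebra K B p r s by (rule odd_char_superalgebra) fact
  interpret GB: group "fobj G B" using G B' by (simp add: is_group_functor_def)
  show "trivial_hom G A (B, j) \<in> hom (fobj M B) (fobj G B)"
    using B B.M_mult_closed by (simp add: trivial_hom_def hom_def)
  show "trivial_hom G A (B, j) \<in> extensional (carrier (fobj M B))"
    using B by (simp add: trivial_hom_def)
next
  fix B j B' j' g x
  assume B: "(B, j) \<in> superalgebras_over K A" and C: "(B', j') \<in> superalgebras_over K A"
    and g: "g \<in> superhom K B B'" and "x \<in> carrier (fobj M B)"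
  then show "trivial_hom G A (B', j') (fmap M B B' g x) =
      fmap G B B' g (trivial_hom G A (B, j) x)"
    using fmap_group_one[OF G _ _ g] fmap_M_closed[OF _ _ g] superalgebras_overD(1)[OF B] superalgebras_overD(1)[OF C]
    by (simp add: trivial_hom_def)
qed (simp add: trivial_hom_def)

lemma base_change_trivial_hom:
  assumes "comm_superalgebra K A" "f \<in> superhom K A A'"
  shows "base_change K A A' f (trivial_hom G A) = trivial_hom G A'"
  by (rule eq_on_superalgebras_over)
    (use superalgebras_over_compose[OF assms] in \<open>auto simp: base_change_def trivial_hom_def\<close>)

text \<open>
  The endomorphism of the point \<open>(0, 0)\<close> is constant. Its value is idempotent because the endomorphism is
  multiplicative, and the identity is the only idempotent of a group.
\<close>

lemma right_action_zero:
  assumes G: "is_group_functor K G" and A: "comm_superalgebra K A"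
    and \<eta>: "\<eta> \<in> base_changed_homs K M G A"
  shows "right_action K p r s A (\<zero>\<^bsub>A\<^esub>, \<zero>\<^bsub>A\<^esub>) \<eta> = trivial_hom G A"
proof (rule eq_on_superalgebras_over)
  fix B j assume B: "(B, j) \<in> superalgebras_over K A"
  note B' = superalgebras_overD[OF B]
  interpret A: odd_char_superalgebra K A p r s by (rule odd_char_superalgebra) fact
  interpret B: odd_char_superalgebra K B p r s by (rule odd_char_superalgebra) fact
  interpret GB: group "fobj G B" using G B' by (simp add: is_group_functor_def)
  note h = base_changed_homsD(1)[OF \<eta> B]
  have j0: "j \<zero>\<^bsub>A\<^esub> = \<zero>\<^bsub>B\<^esub>" using superhom_zero[OF A.superalgebra_axioms B.superalgebra_axioms B'(2)] .
  have "\<eta> (B, j) (M_endo p r s B (\<zero>\<^bsub>B\<^esub>, \<zero>\<^bsub>B\<^esub>) m) = \<one>\<^bsub>fobj G B\<^esub>" if m: "m \<in> M_carrier p r s B" for m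
  proof -
    let ?e = "M_endo p r s B (\<zero>\<^bsub>B\<^esub>, \<zero>\<^bsub>B\<^esub>)"
    have e: "?e m' = ?e m" if "m' \<in> M_carrier p r s B" for m' using B.M_endo_zero m that by simp
    have c: "?e m \<in> M_carrier p r s B" by (rule B.M_endo_closed[OF B.Spec_B_zero m])
    have "?e m = M_mult p s B (?e m) (?e m)"
      using B.M_endo_mult[OF B.Spec_B_zero m m] e[OF B.M_mult_closed[OF m m]] by simp
    then have "\<eta> (B, j) (?e m) = \<eta> (B, j) (?e m) \<otimes>\<^bsub>fobj G B\<^esub> \<eta> (B, j) (?e m)"
      using h c unfolding hom_def by simp (metis fobj_M_scheme(2))
    moreover have "\<eta> (B, j) (?e m) \<in> carrier (fobj G B)" using h c by (auto simp: hom_def)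
    ultimately show ?thesis using GB.l_cancel_one' by metis
  qed
  then show "right_action K p r s A (\<zero>\<^bsub>A\<^esub>, \<zero>\<^bsub>A\<^esub>) \<eta> (B, j) = trivial_hom G A (B, j)"
    using B by (auto simp: right_action_def trivial_hom_def j0 restrict_def)
qed (auto simp: right_action_def trivial_hom_def)

lemma pushforward_closed:
  assumes f: "supergroup_scheme_hom K G G' f"
    and G': "\<eta> \<in> base_changed_homs K M G A"
  shows "pushforward K M f A \<eta> \<in> base_changed_homs K M G' A"
proof (rule base_changed_homsI)
  fix B j assume B: "(B, j) \<in> superalgebras_over K A"
  note B' = superalgebras_overD[OF B]
  interpret B: odd_char_superalgebra K B p r s by (rule odd_char_superalgebra) fact
  have "f B \<in> hom (fobj G B) (fobj G' B)" using f B' by (simp add: supergroup_scheme_hom_def)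
  from hom_compose[OF base_changed_homsD(1)[OF G' B] this]
  have fh: "f B \<circ> \<eta> (B, j) \<in> hom (fobj M B) (fobj G' B)" .
  show "pushforward K M f A \<eta> (B, j) \<in> hom (fobj M B) (fobj G' B)"
    using hom_in_carrier[OF fh] hom_mult[OF fh] B B.M_mult_closed
    by (intro homI) (simp_all add: pushforward_def)
  show "pushforward K M f A \<eta> (B, j) \<in> extensional (carrier (fobj M B))"
    using B by (simp add: pushforward_def)
next
  fix B j B' j' g x
  assume B: "(B, j) \<in> superalgebras_over K A" and C: "(B', j') \<in> superalgebras_over K A"
    and g: "g \<in> superhom K B B'" and gj: "compose (carrier A) g j = j'"
    and x: "x \<in> carrier (fobj M B)"
  note B' = superalgebras_overD(1)[OF B] and C' = superalgebras_overD(1)[OF C]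
  have "\<eta> (B, j) x \<in> carrier (fobj G B)" using base_changed_homsD(1)[OF G' B] x by (auto simp: hom_def)
  then have "f B' (fmap G B B' g (\<eta> (B, j) x)) = fmap G' B B' g (f B (\<eta> (B, j) x))"
    using f B' C' g unfolding supergroup_scheme_hom_def by blast
  then show "pushforward K M f A \<eta> (B', j') (fmap M B B' g x) =
      fmap G' B B' g (pushforward K M f A \<eta> (B, j) x)"
    using base_changed_homsD(3)[OF G' B C g gj x] fmap_M_closed[OF B' C' g] x B C by (simp add: pushforward_def)
qed (simp add: pushforward_def)

lemma base_change_pushforward:
  assumes "comm_superalgebra K A" "h \<in> superhom K A A'"
  shows "base_change K A A' h (pushforward K M f A \<eta>) =
    pushforward K M f A' (base_change K A A' h \<eta>)"
  by (rule eq_on_superalgebras_over)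
    (use superalgebras_over_compose[OF assms] in \<open>auto simp: base_change_def pushforward_def\<close>)

lemma right_action_pushforward:
  assumes "comm_superalgebra K A" "b \<in> Spec_B p r A"
  shows "right_action K p r s A b (pushforward K M f A \<eta>) =
    pushforward K M f A (right_action K p r s A b \<eta>)"
proof (rule eq_on_superalgebras_over)
  fix B j assume B: "(B, j) \<in> superalgebras_over K A"
  note B' = superalgebras_overD[OF B]
  interpret B: odd_char_superalgebra K B p r s by (rule odd_char_superalgebra) fact
  obtain \<mu> a where eq: "b = (\<mu>, a)" by (cases b)
  have jb: "(j \<mu>, j a) \<in> Spec_B p r B" using Spec_B_map[OF assms(1) B'] assms(2) eq by simp
  show "right_action K p r s A b (pushforward K M f A \<eta>) (B, j) =
    pushforward K M f A (right_action K p r s A b \<eta>) (B, j)"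
    using B B.M_endo_closed[OF jb] by (simp add: eq right_action_def pushforward_def restrict_def fun_eq_iff del: split_paired_All)
qed (auto simp: right_action_def pushforward_def split: prod.splits)

end

section \<open>The superalgebra of polynomials with exponents in a submonoid\<close>

text \<open>
  An infinite type contains a copy of its square. Iterating a pairing function codes the lists of a given
  length, and one more pairing adds the length.
\<close>

lemma infinite_inj_list:
  assumes "infinite (UNIV :: 'u set)"
  shows "\<exists>e :: 'u list \<Rightarrow> 'u. inj e"
proof -
  obtain f :: "'u \<times> 'u \<Rightarrow> 'u" where f: "inj f"
    using card_of_Times_same_infinite[OF assms, folded card_of_ordIso] by (auto simp: bij_betw_def)
  obtain g :: "nat \<Rightarrow> 'u" where g: "inj g"
    using infinite_countable_subset[OF assms] by blast
  define c where "c = (\<lambda>xs. foldr (\<lambda>x a. f (x, a)) xs undefined)"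
  have c: "xs = ys" if "length xs = length ys" "c xs = c ys" for xs ys
    using that by (induction xs ys rule: list_induct2) (auto simp: c_def inj_eq[OF f])
  have "inj (\<lambda>xs. f (g (length xs), c xs))"
    using c by (intro injI) (auto simp: inj_eq[OF f] inj_eq[OF g])
  then show ?thesis by blast
qed

text \<open>
  The polynomial ring is no larger than the universe, because a polynomial is determined by the list of its
  coefficients up to a minimal bound. The bound is needed: zeros at the end would make the list ambiguous.
\<close>

lemma (in ring) infinite_inj_up:
  assumes "infinite (UNIV :: 'a set)"
  shows "\<exists>\<iota> :: (nat \<Rightarrow> 'a) \<Rightarrow> 'a. inj_on \<iota> (up R)"
proof -
  obtain e :: "'a list \<Rightarrow> 'a" where e: "inj e" using infinite_inj_list[OF assms] by blast
  let ?d = "\<lambda>f. LEAST n. bound \<zero> n f"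
  let ?l = "\<lambda>f. map f [0..<Suc (?d f)]"
  have d: "bound \<zero> (?d f) f" if "f \<in> up R" for f
    using LeastI_ex[OF bound_upD[OF that]] .
  have "inj_on ?l (up R)"
  proof (rule inj_onI)
    fix f g assume f: "f \<in> up R" and g: "g \<in> up R" and l: "?l f = ?l g"
    have dd: "?d f = ?d g" using arg_cong[OF l, of length] by simp
    show "f = g"
    proof
      fix i
      show "f i = g i"
      proof (cases "i \<le> ?d f")
        case True
        then have "?l f ! i = f i" "?l g ! i = g i" using dd by (simp_all del: upt_Suc)
        then show ?thesis using l by simp
      next
        case False
        then show ?thesis using bound.bound[OF d[OF f]] bound.bound[OF d[OF g]] dd by simp
      qed
    qed
  qed
  then have "inj_on (e \<circ> ?l) (up R)" using e by (auto intro!: comp_inj_on simp: inj_on_def)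
  then show ?thesis by blast
qed

definition polys_on :: "('a, 'm) ring_scheme \<Rightarrow> nat set \<Rightarrow> (nat \<Rightarrow> 'a) set" where
  "polys_on R S = {u \<in> up R. \<forall>n. n \<notin> S \<longrightarrow> u n = \<zero>\<^bsub>R\<^esub>}"

text \<open>
  The tensor product of \<open>R\<close> and the monoid algebra of \<open>S\<close>, copied into the universe along \<open>\<iota>\<close>, so that it
  is again a test superalgebra of the functors. The operations come from the polynomial ring over \<open>R\<close>, whose
  ring axioms hold for noncommutative coefficients too; the indeterminate is even and central.
\<close>

definition poly_superalg ::
  "('u, 'u) superalg \<Rightarrow> nat set \<Rightarrow> ((nat \<Rightarrow> 'u) \<Rightarrow> 'u) \<Rightarrow> ('u, 'u) superalg" where
  "poly_superalg R S \<iota> = (let X = polys_on R S; c = inv_into X \<iota> in \<lparr>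
     carrier = \<iota> ` X,
     monoid.mult = (\<lambda>x y. \<iota> (c x \<otimes>\<^bsub>UP R\<^esub> c y)),
     one = \<iota> \<one>\<^bsub>UP R\<^esub>,
     zero = \<iota> \<zero>\<^bsub>UP R\<^esub>,
     add = (\<lambda>x y. \<iota> (c x \<oplus>\<^bsub>UP R\<^esub> c y)),
     smult = (\<lambda>a x. \<iota> (\<lambda>n. a \<odot>\<^bsub>R\<^esub> c x n)),
     evens = \<iota> ` {u \<in> X. \<forall>n. u n \<in> evens R},
     odds = \<iota> ` {u \<in> X. \<forall>n. u n \<in> odds R}\<rparr>)"

locale poly_superalgebra = R: comm_superalgebra K R
  for K :: "'u ring" and R :: "('u, 'u) superalg" (structure) +
  fixes S :: "nat set" and \<iota> :: "(nat \<Rightarrow> 'u) \<Rightarrow> 'u"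
  assumes inj_\<iota>: "inj_on \<iota> (polys_on R S)"
    and zero_S: "0 \<in> S" and add_S: "\<lbrakk>m \<in> S; n \<in> S\<rbrakk> \<Longrightarrow> m + n \<in> S"
begin

abbreviation "A \<equiv> poly_superalg R S \<iota>"
abbreviation "X \<equiv> polys_on R S"

definition coef :: "'u \<Rightarrow> nat \<Rightarrow> 'u" where "coef = inv_into X \<iota>"

lemma coef_\<iota> [simp]: "u \<in> X \<Longrightarrow> coef (\<iota> u) = u"
  using inj_\<iota> by (simp add: coef_def)

lemma \<iota>_closed [simp]: "u \<in> X \<Longrightarrow> \<iota> u \<in> carrier A"
  by (simp add: poly_superalg_def Let_def)

lemma coef_X: "x \<in> carrier A \<Longrightarrow> coef x \<in> X"
  by (auto simp: poly_superalg_def Let_def)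

lemma \<iota>_coef [simp]: "x \<in> carrier A \<Longrightarrow> \<iota> (coef x) = x"
  by (auto simp: poly_superalg_def Let_def)

lemma X_upD: "u \<in> X \<Longrightarrow> u \<in> up R" by (simp add: polys_on_def)

lemma X_closed: "u \<in> X \<Longrightarrow> u n \<in> carrier R" using mem_upD[OF X_upD] .

lemma coef_closed [simp]: "x \<in> carrier A \<Longrightarrow> coef x n \<in> carrier R"
  using X_closed[OF coef_X] .

lemma coef_outside: "\<lbrakk>x \<in> carrier A; n \<notin> S\<rbrakk> \<Longrightarrow> coef x n = \<zero>"
  using coef_X[of x] by (simp add: polys_on_def)

lemma poly_eqI:
  assumes "x \<in> carrier A" "y \<in> carrier A" "\<And>n. coef x n = coef y n"
  shows "x = y"
proof -
  have "coef x = coef y" using assms(3) by (rule ext)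
  then show ?thesis using \<iota>_coef[OF assms(1)] \<iota>_coef[OF assms(2)] by metis
qed

lemma XI:
  assumes "\<And>n. u n \<in> carrier R" "\<And>n. n > N \<Longrightarrow> u n = \<zero>" "\<And>n. n \<notin> S \<Longrightarrow> u n = \<zero>"
  shows "u \<in> X"
  unfolding polys_on_def using assms by (auto intro!: mem_upI exI[of _ N])

lemma X_bound:
  assumes "u \<in> X"
  obtains N where "\<And>n. n > N \<Longrightarrow> u n = \<zero>"
  using R.bound_upD[OF X_upD[OF assms]] by (auto dest: bound.bound)

lemma X_map:
  assumes "u \<in> X" "\<And>x. x \<in> carrier R \<Longrightarrow> f x \<in> carrier R" "f \<zero> = \<zero>"
  shows "(\<lambda>n. f (u n)) \<in> X"
proof -
  obtain N where "\<And>n. n > N \<Longrightarrow> u n = \<zero>" using X_bound[OF assms(1)] by blast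
  then show ?thesis using assms X_closed[OF assms(1)] by (intro XI[of _ N]) (auto simp: polys_on_def)
qed

lemma X_zero: "\<zero>\<^bsub>UP R\<^esub> \<in> X"
  by (rule XI[of _ 0]) (auto simp: UP_def)

lemma X_one: "\<one>\<^bsub>UP R\<^esub> \<in> X"
  by (rule XI[of _ 0]) (use zero_S in \<open>auto simp: UP_def\<close>)

lemma UP_add: "\<lbrakk>u \<in> X; v \<in> X\<rbrakk> \<Longrightarrow> u \<oplus>\<^bsub>UP R\<^esub> v = (\<lambda>n. u n \<oplus> v n)"
  by (simp add: UP_def X_upD)

lemma UP_mult: "\<lbrakk>u \<in> X; v \<in> X\<rbrakk> \<Longrightarrow> u \<otimes>\<^bsub>UP R\<^esub> v = (\<lambda>n. \<Oplus>i\<in>{..n}. u i \<otimes> v (n - i))"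
  by (simp add: UP_def X_upD)

lemma X_add: "\<lbrakk>u \<in> X; v \<in> X\<rbrakk> \<Longrightarrow> u \<oplus>\<^bsub>UP R\<^esub> v \<in> X"
  using R.up_add_closed[of u v] by (simp add: UP_add) (simp add: polys_on_def)

lemma X_mult:
  assumes u: "u \<in> X" and v: "v \<in> X"
  shows "u \<otimes>\<^bsub>UP R\<^esub> v \<in> X"
proof -
  have "(\<Oplus>i\<in>{..n}. u i \<otimes> v (n - i)) = \<zero>" if n: "n \<notin> S" for n
  proof (rule R.add.finprod_one_eqI)
    fix i assume "i \<in> {..n}"
    then have "i \<notin> S \<or> n - i \<notin> S" using add_S[of i "n - i"] n by auto
    then have "u i = \<zero> \<or> v (n - i) = \<zero>" using u v by (auto simp: polys_on_def)
    then show "u i \<otimes> v (n - i) = \<zero>" using X_closed[OF u] X_closed[OF v] by auto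
  qed
  then show ?thesis
    using R.up_mult_closed[OF X_upD[OF u] X_upD[OF v]] by (simp add: UP_mult[OF u v] polys_on_def)
qed

lemma
  assumes "x \<in> carrier A" "y \<in> carrier A"
  shows coef_add [simp]: "coef (x \<oplus>\<^bsub>A\<^esub> y) n = coef x n \<oplus> coef y n"
    and A_add_closed [simp]: "x \<oplus>\<^bsub>A\<^esub> y \<in> carrier A"
    and coef_mult: "coef (x \<otimes>\<^bsub>A\<^esub> y) n = (\<Oplus>i\<in>{..n}. coef x i \<otimes> coef y (n - i))"
    and coef_mult_UP: "coef (x \<otimes>\<^bsub>A\<^esub> y) = coef x \<otimes>\<^bsub>UP R\<^esub> coef y"
    and A_mult_closed [simp]: "x \<otimes>\<^bsub>A\<^esub> y \<in> carrier A"
proof -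
  note c = coef_X[OF assms(1)] coef_X[OF assms(2)]
  have a: "x \<oplus>\<^bsub>A\<^esub> y = \<iota> (coef x \<oplus>\<^bsub>UP R\<^esub> coef y)" "x \<otimes>\<^bsub>A\<^esub> y = \<iota> (coef x \<otimes>\<^bsub>UP R\<^esub> coef y)"
    by (simp_all add: poly_superalg_def Let_def coef_def)
  show "x \<oplus>\<^bsub>A\<^esub> y \<in> carrier A" "x \<otimes>\<^bsub>A\<^esub> y \<in> carrier A"
    unfolding a using X_add[OF c] X_mult[OF c] by auto
  show "coef (x \<oplus>\<^bsub>A\<^esub> y) n = coef x n \<oplus> coef y n"
    unfolding a using X_add[OF c] UP_add[OF c] by simp
  show "coef (x \<otimes>\<^bsub>A\<^esub> y) = coef x \<otimes>\<^bsub>UP R\<^esub> coef y"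
    unfolding a using X_mult[OF c] by simp
  then show "coef (x \<otimes>\<^bsub>A\<^esub> y) n = (\<Oplus>i\<in>{..n}. coef x i \<otimes> coef y (n - i))"
    using UP_mult[OF c] by simp
qed

lemma
  shows coef_zero [simp]: "coef \<zero>\<^bsub>A\<^esub> n = \<zero>" and A_zero_closed [simp]: "\<zero>\<^bsub>A\<^esub> \<in> carrier A"
    and coef_one: "coef \<one>\<^bsub>A\<^esub> n = (if n = 0 then \<one> else \<zero>)" and coef_one_UP: "coef \<one>\<^bsub>A\<^esub> = \<one>\<^bsub>UP R\<^esub>"
    and A_one_closed [simp]: "\<one>\<^bsub>A\<^esub> \<in> carrier A"
proof -
  have a: "\<zero>\<^bsub>A\<^esub> = \<iota> \<zero>\<^bsub>UP R\<^esub>" "\<one>\<^bsub>A\<^esub> = \<iota> \<one>\<^bsub>UP R\<^esub>" by (simp_all add: poly_superalg_def Let_def)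
  show "\<zero>\<^bsub>A\<^esub> \<in> carrier A" "\<one>\<^bsub>A\<^esub> \<in> carrier A" unfolding a using X_zero X_one by auto
  show "coef \<zero>\<^bsub>A\<^esub> n = \<zero>" unfolding a using X_zero by (simp add: UP_def)
  show "coef \<one>\<^bsub>A\<^esub> = \<one>\<^bsub>UP R\<^esub>" unfolding a using X_one by simp
  then show "coef \<one>\<^bsub>A\<^esub> n = (if n = 0 then \<one> else \<zero>)" by (simp add: UP_def)
qed

lemma
  assumes "c \<in> carrier K" "x \<in> carrier A"
  shows coef_smult [simp]: "coef (c \<odot>\<^bsub>A\<^esub> x) n = c \<odot> coef x n"
    and A_smult_closed [simp]: "c \<odot>\<^bsub>A\<^esub> x \<in> carrier A"
proof -
  have a: "c \<odot>\<^bsub>A\<^esub> x = \<iota> (\<lambda>n. c \<odot> coef x n)" by (simp add: poly_superalg_def Let_def coef_def)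
  have X: "(\<lambda>n. c \<odot> coef x n) \<in> X"
    using assms X_map[OF coef_X[OF assms(2)], of "\<lambda>y. c \<odot> y"] by simp
  show "coef (c \<odot>\<^bsub>A\<^esub> x) n = c \<odot> coef x n" "c \<odot>\<^bsub>A\<^esub> x \<in> carrier A"
    unfolding a using X by simp_all
qed

lemma A_evens_iff: "x \<in> evens A \<longleftrightarrow> x \<in> carrier A \<and> (\<forall>n. coef x n \<in> evens R)"
proof
  assume "x \<in> evens A"
  then obtain u where "u \<in> X" "\<forall>n. u n \<in> evens R" "x = \<iota> u" by (auto simp: poly_superalg_def Let_def)
  then show "x \<in> carrier A \<and> (\<forall>n. coef x n \<in> evens R)" by simp
next
  assume x: "x \<in> carrier A \<and> (\<forall>n. coef x n \<in> evens R)"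
  then have "\<iota> (coef x) \<in> \<iota> ` {u \<in> X. \<forall>n. u n \<in> evens R}" using coef_X by blast
  then have "x \<in> \<iota> ` {u \<in> X. \<forall>n. u n \<in> evens R}" using x by (simp only: \<iota>_coef)
  then show "x \<in> evens A" by (simp add: poly_superalg_def Let_def)
qed

lemma A_odds_iff: "x \<in> odds A \<longleftrightarrow> x \<in> carrier A \<and> (\<forall>n. coef x n \<in> odds R)"
proof
  assume "x \<in> odds A"
  then obtain u where "u \<in> X" "\<forall>n. u n \<in> odds R" "x = \<iota> u" by (auto simp: poly_superalg_def Let_def)
  then show "x \<in> carrier A \<and> (\<forall>n. coef x n \<in> odds R)" by simp
next
  assume x: "x \<in> carrier A \<and> (\<forall>n. coef x n \<in> odds R)"
  then have "\<iota> (coef x) \<in> \<iota> ` {u \<in> X. \<forall>n. u n \<in> odds R}" using coef_X by blast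
  then have "x \<in> \<iota> ` {u \<in> X. \<forall>n. u n \<in> odds R}" using x by (simp only: \<iota>_coef)
  then show "x \<in> odds A" by (simp add: poly_superalg_def Let_def)
qed

lemma ring_A: "ring A"
proof -
  interpret U: UP_ring R "UP R" by unfold_locales simp
  interpret U: ring "UP R" by (rule U.UP_ring)
  have cX: "coef x \<in> carrier (UP R)" if "x \<in> carrier A" for x
    using X_upD[OF coef_X[OF that]] by (simp add: UP_def)
  have coef_inj: "x = y" if "x \<in> carrier A" "y \<in> carrier A" "coef x = coef y" for x y
    using poly_eqI[OF that(1,2)] that(3) by simp
  have coef_add_UP: "coef (x \<oplus>\<^bsub>A\<^esub> y) = coef x \<oplus>\<^bsub>UP R\<^esub> coef y" if "x \<in> carrier A" "y \<in> carrier A" for x y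
    using that by (simp add: fun_eq_iff UP_add coef_X)
  show ?thesis
  proof (rule ringI)
    show "abelian_group A"
    proof (rule abelian_groupI)
      fix x assume x: "x \<in> carrier A"
      have "(\<lambda>n. \<ominus> coef x n) \<in> X" using X_map[OF coef_X[OF x], of "\<lambda>y. \<ominus> y"] by simp
      note y = \<iota>_closed[OF this] coef_\<iota>[OF this]
      have "\<iota> (\<lambda>n. \<ominus> coef x n) \<oplus>\<^bsub>A\<^esub> x = \<zero>\<^bsub>A\<^esub>"
        by (rule poly_eqI) (use x y in \<open>simp_all add: R.l_neg\<close>)
      then show "\<exists>y\<in>carrier A. y \<oplus>\<^bsub>A\<^esub> x = \<zero>\<^bsub>A\<^esub>" using y(1) by blast
    next
      fix x y z assume "x \<in> carrier A" "y \<in> carrier A" "z \<in> carrier A"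
      then show "x \<oplus>\<^bsub>A\<^esub> y \<oplus>\<^bsub>A\<^esub> z = x \<oplus>\<^bsub>A\<^esub> (y \<oplus>\<^bsub>A\<^esub> z)"
        by - (rule poly_eqI; simp add: R.a_assoc)
    next
      fix x y assume "x \<in> carrier A" "y \<in> carrier A"
      then show "x \<oplus>\<^bsub>A\<^esub> y = y \<oplus>\<^bsub>A\<^esub> x"
        by - (rule poly_eqI; simp add: R.a_comm)
    next
      fix x assume "x \<in> carrier A"
      then show "\<zero>\<^bsub>A\<^esub> \<oplus>\<^bsub>A\<^esub> x = x" by - (rule poly_eqI; simp)
    qed simp_all
    show "monoid A"
      by (rule monoidI; (rule coef_inj)?; simp add: coef_mult_UP coef_one_UP cX U.m_assoc)
    show "(x \<oplus>\<^bsub>A\<^esub> y) \<otimes>\<^bsub>A\<^esub> z = x \<otimes>\<^bsub>A\<^esub> z \<oplus>\<^bsub>A\<^esub> y \<otimes>\<^bsub>A\<^esub> z"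
      if "x \<in> carrier A" "y \<in> carrier A" "z \<in> carrier A" for x y z
      using that by (intro coef_inj) (auto simp: coef_mult_UP coef_add_UP cX U.l_distr)
    show "z \<otimes>\<^bsub>A\<^esub> (x \<oplus>\<^bsub>A\<^esub> y) = z \<otimes>\<^bsub>A\<^esub> x \<oplus>\<^bsub>A\<^esub> z \<otimes>\<^bsub>A\<^esub> y"
      if "x \<in> carrier A" "y \<in> carrier A" "z \<in> carrier A" for x y z
      using that by (intro coef_inj) (auto simp: coef_mult_UP coef_add_UP cX U.r_distr)
  qed
qed

lemma module_A: "module K A"
proof -
  interpret ring A by (rule ring_A)
  show ?thesis
  proof (rule moduleI)
    show "cring K" by (rule R.R.is_cring)
    show "abelian_group A" by (rule is_abelian_group)
    show "a \<odot>\<^bsub>A\<^esub> x \<in> carrier A" if "a \<in> carrier K" "x \<in> carrier A" for a x using that by simp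
    show "(a \<oplus>\<^bsub>K\<^esub> b) \<odot>\<^bsub>A\<^esub> x = a \<odot>\<^bsub>A\<^esub> x \<oplus>\<^bsub>A\<^esub> b \<odot>\<^bsub>A\<^esub> x"
      if "a \<in> carrier K" "b \<in> carrier K" "x \<in> carrier A" for a b x
      by (rule poly_eqI) (use that in \<open>simp_all add: R.smult_l_distr\<close>)
    show "a \<odot>\<^bsub>A\<^esub> (x \<oplus>\<^bsub>A\<^esub> y) = a \<odot>\<^bsub>A\<^esub> x \<oplus>\<^bsub>A\<^esub> a \<odot>\<^bsub>A\<^esub> y"
      if "a \<in> carrier K" "x \<in> carrier A" "y \<in> carrier A" for a x y
      by (rule poly_eqI) (use that in \<open>simp_all add: R.smult_r_distr\<close>)
    show "(a \<otimes>\<^bsub>K\<^esub> b) \<odot>\<^bsub>A\<^esub> x = a \<odot>\<^bsub>A\<^esub> (b \<odot>\<^bsub>A\<^esub> x)"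
      if "a \<in> carrier K" "b \<in> carrier K" "x \<in> carrier A" for a b x
      by (rule poly_eqI) (use that in \<open>simp_all add: R.smult_assoc1\<close>)
    show "\<one>\<^bsub>K\<^esub> \<odot>\<^bsub>A\<^esub> x = x" if "x \<in> carrier A" for x
      by (rule poly_eqI) (use that in simp_all)
  qed
qed

lemma coef_neg:
  assumes "x \<in> carrier A"
  shows "coef (\<ominus>\<^bsub>A\<^esub> x) n = \<ominus> coef x n"
proof -
  interpret ring A by (rule ring_A)
  have "coef (\<ominus>\<^bsub>A\<^esub> x) n \<oplus> coef x n = \<zero>"
    using assms coef_add[of "\<ominus>\<^bsub>A\<^esub> x" x n] by (simp add: l_neg)
  then show ?thesis using assms by (intro R.minus_equality[symmetric]) auto
qed

lemma coef_mult_swap: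
  assumes "x \<in> carrier A" "y \<in> carrier A"
  shows "coef (y \<otimes>\<^bsub>A\<^esub> x) n = (\<Oplus>i\<in>{..n}. coef y (n - i) \<otimes> coef x i)"
proof -
  have "(\<Oplus>i\<in>(\<lambda>i. n - i) ` {..n}. coef y i \<otimes> coef x (n - i)) =
      (\<Oplus>i\<in>{..n}. coef y (n - i) \<otimes> coef x (n - (n - i)))"
    using assms by (intro R.finsum_reindex) (auto simp: inj_on_def)
  moreover have "(\<lambda>i. n - i) ` {..n} = {..n}"
    by (auto simp: image_iff intro: bexI[where x = "n - _"]) (metis atMost_iff diff_diff_cancel diff_le_self)
  moreover have "(\<Oplus>i\<in>{..n}. coef y (n - i) \<otimes> coef x (n - (n - i))) =
    (\<Oplus>i\<in>{..n}. coef y (n - i) \<otimes> coef x i)"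
    using assms by (intro R.finsum_cong') auto
  ultimately show ?thesis using assms by (simp add: coef_mult)
qed

lemma comm_superalgebra_A: "comm_superalgebra K A"
proof -
  interpret ring A by (rule ring_A)
  interpret module K A by (rule module_A)
  have neg_even: "\<ominus> x \<in> evens R" if "x \<in> evens R" for x
    using R.submoduleE(3)[OF R.evens_submodule that] .
  have neg_odd: "\<ominus> x \<in> odds R" if "x \<in> odds R" for x
    using R.submoduleE(3)[OF R.odds_submodule that] .
  have smult_even: "c \<odot> x \<in> evens R" if "c \<in> carrier K" "x \<in> evens R" for c x
    using R.submoduleE(4)[OF R.evens_submodule that] .
  have smult_odd: "c \<odot> x \<in> odds R" if "c \<in> carrier K" "x \<in> odds R" for c x
    using R.submoduleE(4)[OF R.odds_submodule that] .
  have parity: "\<exists>!w. fst w \<in> evens A \<and> snd w \<in> odds A \<and> x = fst w \<oplus>\<^bsub>A\<^esub> snd w" if x: "x \<in> carrier A" for x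
  proof -
    \<comment> \<open>The even part of a coefficient; applying it to all coefficients needs it as a function.\<close>
    define e where "e y = (THE z. z \<in> evens R \<and> (\<exists>w\<in>odds R. y = z \<oplus> w))" for y
    have e: "e y \<in> evens R \<and> (\<exists>w\<in>odds R. y = e y \<oplus> w)" if y: "y \<in> carrier R" for y
      unfolding e_def
    proof (rule theI')
      obtain z w where "z \<in> evens R" "w \<in> odds R" "y = z \<oplus> w" using R.parity_obtain[OF y] .
      then show "\<exists>!z. z \<in> evens R \<and> (\<exists>w\<in>odds R. y = z \<oplus> w)"
        by (intro ex1I[of _ z]) (auto dest: R.parity_unique)
    qed
    have e0: "e \<zero> = \<zero>"
    proof -
      obtain w where "w \<in> odds R" "\<zero> = e \<zero> \<oplus> w" using e[of "\<zero>"] by auto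
      then show ?thesis using e[of "\<zero>"] R.parity_unique(1)[of "e \<zero>" "\<zero>" w "\<zero>"] by simp
    qed
    let ?o = "\<lambda>y. y \<ominus> e y"
    have o: "?o y \<in> odds R" "y = e y \<oplus> ?o y" if y: "y \<in> carrier R" for y
    proof -
      obtain w where w: "w \<in> odds R" "y = e y \<oplus> w" using e[OF y] by auto
      have "(e y \<oplus> w) \<ominus> e y = w"
        using w(1) e[OF y] by (simp add: R.minus_eq R.a_comm[of "e y" w] R.a_assoc R.r_neg)
      then have "?o y = w" using w(2) by simp
      then show "?o y \<in> odds R" "y = e y \<oplus> ?o y" using w by auto
    qed
    have ec: "e y \<in> carrier R" if "y \<in> carrier R" for y using e[OF that] by auto
    have X: "(\<lambda>n. e (coef x n)) \<in> X" "(\<lambda>n. ?o (coef x n)) \<in> X"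
      using X_map[OF coef_X[OF x], of e] X_map[OF coef_X[OF x], of ?o] ec e0 by (auto simp: R.minus_eq)
    let ?w = "(\<iota> (\<lambda>n. e (coef x n)), \<iota> (\<lambda>n. ?o (coef x n)))"
    have cx: "coef x n \<in> carrier R" for n using x by simp
    have E: "fst ?w \<in> evens A" and O: "snd ?w \<in> odds A"
      using X e[OF cx] o(1)[OF cx] by (simp_all add: A_evens_iff A_odds_iff)
    have E': "fst ?w \<in> carrier A" and O': "snd ?w \<in> carrier A"
      using E O by (simp_all add: A_evens_iff A_odds_iff)
    have sum: "x = fst ?w \<oplus>\<^bsub>A\<^esub> snd ?w"
    proof (rule poly_eqI)
      fix n
      show "coef x n = coef (fst ?w \<oplus>\<^bsub>A\<^esub> snd ?w) n"
        unfolding coef_add[OF E' O'] using X by (simp add: o(2)[OF cx, symmetric])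
    qed (use x E' O' in simp_all)
    show ?thesis
    proof (rule ex1I[of _ ?w])
      show "fst ?w \<in> evens A \<and> snd ?w \<in> odds A \<and> x = fst ?w \<oplus>\<^bsub>A\<^esub> snd ?w"
        using E O sum by blast
    next
      fix w assume w: "fst w \<in> evens A \<and> snd w \<in> odds A \<and> x = fst w \<oplus>\<^bsub>A\<^esub> snd w"
      then have w': "fst w \<in> carrier A" "snd w \<in> carrier A" by (auto simp: A_evens_iff A_odds_iff)
      have *: "coef (fst w) n = coef (fst ?w) n \<and> coef (snd w) n = coef (snd ?w) n" for n
      proof -
        have "coef (fst w) n \<oplus> coef (snd w) n = coef (fst ?w) n \<oplus> coef (snd ?w) n"
          unfolding coef_add[OF w', symmetric] coef_add[OF E' O', symmetric] using w sum by metis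
        moreover have "coef (fst w) n \<in> evens R" "coef (snd w) n \<in> odds R"
          "coef (fst ?w) n \<in> evens R" "coef (snd ?w) n \<in> odds R"
          using w E O by (simp_all only: A_evens_iff A_odds_iff)
        ultimately show ?thesis using R.parity_unique by blast
      qed
      show "w = ?w"
        by (rule prod_eqI; rule poly_eqI) (use w' E' O' * in blast)+
    qed
  qed
  show ?thesis
  proof (intro comm_superalgebra.intro superalgebra.intro superalgebra_axioms.intro comm_superalgebra_axioms.intro)
    show "module K A" "ring A" by (rule module_A, rule ring_A)
    show "submodule (evens A) K A" "submodule (odds A) K A"
      by (rule submoduleI; auto simp: A_evens_iff A_odds_iff coef_neg neg_even neg_odd smult_even smult_odd)+
    show "\<one>\<^bsub>A\<^esub> \<in> evens A" by (simp add: A_evens_iff coef_one R.one_even)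
  next
    fix c x y assume c: "c \<in> carrier K" "x \<in> carrier A" "y \<in> carrier A"
    show "c \<odot>\<^bsub>A\<^esub> x \<otimes>\<^bsub>A\<^esub> y = c \<odot>\<^bsub>A\<^esub> (x \<otimes>\<^bsub>A\<^esub> y)" "x \<otimes>\<^bsub>A\<^esub> (c \<odot>\<^bsub>A\<^esub> y) = c \<odot>\<^bsub>A\<^esub> (x \<otimes>\<^bsub>A\<^esub> y)"
      using c
      by - (rule poly_eqI; auto intro!: R.finsum_cong'
          simp: coef_mult R.finsum_smult_ldistr R.smult_mult_left R.smult_mult_right)+
  next
    fix x y
    show "x \<in> evens A \<Longrightarrow> y \<in> evens A \<Longrightarrow> x \<otimes>\<^bsub>A\<^esub> y \<in> evens A"
      by (auto simp: A_evens_iff coef_mult intro!: R.evens_finsum R.even_even)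
    show "x \<in> evens A \<Longrightarrow> y \<in> odds A \<Longrightarrow> x \<otimes>\<^bsub>A\<^esub> y \<in> odds A"
      by (auto simp: A_evens_iff A_odds_iff coef_mult intro!: R.odds_finsum R.even_odd)
    show "x \<in> odds A \<Longrightarrow> y \<in> evens A \<Longrightarrow> x \<otimes>\<^bsub>A\<^esub> y \<in> odds A"
      by (auto simp: A_evens_iff A_odds_iff coef_mult intro!: R.odds_finsum R.odd_even)
    show "x \<in> odds A \<Longrightarrow> y \<in> odds A \<Longrightarrow> x \<otimes>\<^bsub>A\<^esub> y \<in> evens A"
      by (auto simp: A_evens_iff A_odds_iff coef_mult intro!: R.evens_finsum R.odd_odd)
  next
    fix x y assume x: "x \<in> evens A" and "y \<in> evens A \<union> odds A"
    then have y: "y \<in> carrier A" by (auto simp: A_evens_iff A_odds_iff)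
    then show "y \<otimes>\<^bsub>A\<^esub> x = x \<otimes>\<^bsub>A\<^esub> y"
      using x
      by - (rule poly_eqI;
        auto simp: A_evens_iff coef_mult_swap[of x y] coef_mult[of x y] intro!: R.finsum_cong' R.even_central)
  next
    fix x y assume x: "x \<in> odds A" and y: "y \<in> odds A"
    then have c: "x \<in> carrier A" "y \<in> carrier A" by (auto simp: A_odds_iff)
    have "coef (y \<otimes>\<^bsub>A\<^esub> x) n = coef (\<ominus>\<^bsub>A\<^esub> (x \<otimes>\<^bsub>A\<^esub> y)) n" for n
    proof -
      have "coef (y \<otimes>\<^bsub>A\<^esub> x) n = (\<Oplus>i\<in>{..n}. \<ominus> (coef x i \<otimes> coef y (n - i)))"
        unfolding coef_mult_swap[OF c] using x y
        by (intro R.finsum_cong' R.odd_anticomm) (auto simp: A_odds_iff)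
      also have "\<dots> = \<ominus> (\<Oplus>i\<in>{..n}. coef x i \<otimes> coef y (n - i))"
        by (rule finsum_additive[symmetric, OF R.abelian_monoid_axioms R.abelian_monoid_axioms])
          (use c in \<open>auto simp: R.minus_add\<close>)
      finally show ?thesis using c by (simp add: coef_neg coef_mult)
    qed
    then show "y \<otimes>\<^bsub>A\<^esub> x = \<ominus>\<^bsub>A\<^esub> (x \<otimes>\<^bsub>A\<^esub> y)" by - (rule poly_eqI, use c in auto)
  qed (rule parity)
qed

end

section \<open>Monomials and powers of a point of Spec(B)\<close>

context poly_superalgebra
begin

sublocale A: comm_superalgebra K A by (rule comm_superalgebra_A)

definition const :: "'u \<Rightarrow> 'u" where
  "const = (\<lambda>x\<in>carrier R. \<iota> (\<lambda>n. if n = 0 then x else \<zero>))"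

definition tpow :: "nat \<Rightarrow> 'u" where
  "tpow k = \<iota> (\<lambda>n. if n = k then \<one> else \<zero>)"

lemma
  assumes "x \<in> carrier R"
  shows coef_const: "coef (const x) n = (if n = 0 then x else \<zero>)"
    and const_closed [simp]: "const x \<in> carrier A"
proof -
  have "(\<lambda>n. if n = 0 then x else \<zero>) \<in> X"
    by (rule XI[of _ 0]) (use assms zero_S in auto)
  then show "coef (const x) n = (if n = 0 then x else \<zero>)" "const x \<in> carrier A"
    using assms by (simp_all add: const_def)
qed

lemma
  assumes "k \<in> S"
  shows coef_tpow: "coef (tpow k) n = (if n = k then \<one> else \<zero>)"
    and tpow_closed [simp]: "tpow k \<in> carrier A"
    and tpow_even: "tpow k \<in> evens A"
proof -
  have X: "(\<lambda>n. if n = k then \<one> else \<zero>) \<in> X"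
    by (rule XI[of _ k]) (use assms in auto)
  then have c: "coef (tpow k) n = (if n = k then \<one> else \<zero>)" "tpow k \<in> carrier A" for n
    by (simp_all add: tpow_def)
  show "coef (tpow k) n = (if n = k then \<one> else \<zero>)" "tpow k \<in> carrier A" by (rule c)+
  show "tpow k \<in> evens A" unfolding A_evens_iff using c by (simp add: R.one_even)
qed

lemma coef_const_mult:
  assumes "x \<in> carrier R" "y \<in> carrier A"
  shows "coef (const x \<otimes>\<^bsub>A\<^esub> y) n = x \<otimes> coef y n"
proof -
  have "coef (const x \<otimes>\<^bsub>A\<^esub> y) n = (\<Oplus>i\<in>{..n}. if 0 = i then x \<otimes> coef y (n - i) else \<zero>)"
    unfolding coef_mult[OF const_closed[OF assms(1)] assms(2)]
    by (intro R.finsum_cong') (use assms in \<open>auto simp: coef_const\<close>)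
  also have "\<dots> = x \<otimes> coef y (n - 0)"
    by (rule R.finsum_singleton) (use assms in auto)
  finally show ?thesis by simp
qed

lemma const_superhom: "const \<in> superhom K R A"
proof (rule superhomI)
  fix x y assume xy: "x \<in> carrier R" "y \<in> carrier R"
  show "const (x \<oplus> y) = const x \<oplus>\<^bsub>A\<^esub> const y"
    by (rule poly_eqI) (use xy in \<open>auto simp: coef_const\<close>)
  show "const (x \<otimes> y) = const x \<otimes>\<^bsub>A\<^esub> const y"
    by (rule poly_eqI) (use xy in \<open>auto simp: coef_const coef_const_mult\<close>)
next
  show "const \<one> = \<one>\<^bsub>A\<^esub>" by (rule poly_eqI) (auto simp: coef_const coef_one)
next
  fix c x assume c: "c \<in> carrier K" "x \<in> carrier R"
  show "const (c \<odot> x) = c \<odot>\<^bsub>A\<^esub> const x"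
    by (rule poly_eqI) (use c in \<open>auto simp: coef_const\<close>)
next
  show "const \<in> extensional (carrier R)" by (simp add: const_def)
qed (auto simp: A_evens_iff A_odds_iff coef_const simp del: A.evens_closed A.odds_closed)

lemma coef_tpow_mult:
  assumes "j \<in> S" "y \<in> carrier A"
  shows "coef (tpow j \<otimes>\<^bsub>A\<^esub> y) n = (if j \<le> n then coef y (n - j) else \<zero>)"
proof -
  have "coef (tpow j \<otimes>\<^bsub>A\<^esub> y) n = (\<Oplus>i\<in>{..n}. if j = i then coef y (n - i) else \<zero>)"
    unfolding coef_mult[OF tpow_closed[OF assms(1)] assms(2)]
    by (intro R.finsum_cong') (use assms in \<open>auto simp: coef_tpow\<close>)
  also have "\<dots> = (if j \<le> n then coef y (n - j) else \<zero>)"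
  proof (cases "j \<le> n")
    case True
    then show ?thesis
      using R.finsum_singleton[of j "{..n}" "\<lambda>i. coef y (n - i)"] assms by auto
  next
    case False
    then have "(\<Oplus>i\<in>{..n}. if j = i then coef y (n - i) else \<zero>) = \<zero>"
      by (intro R.add.finprod_one_eqI) auto
    then show ?thesis using False by simp
  qed
  finally show ?thesis .
qed

lemma tpow_mult:
  assumes "j \<in> S" "k \<in> S"
  shows "tpow j \<otimes>\<^bsub>A\<^esub> tpow k = tpow (j + k)"
proof (rule poly_eqI)
  show "coef (tpow j \<otimes>\<^bsub>A\<^esub> tpow k) n = coef (tpow (j + k)) n" for n
    using assms add_S[OF assms] by (auto simp: coef_tpow_mult coef_tpow)
qed (use assms add_S[OF assms] in auto)

lemma mult_S: "k \<in> S \<Longrightarrow> n * k \<in> S"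
  by (induction n) (auto simp: zero_S add_S)

lemma tpow_zero: "tpow 0 = \<one>\<^bsub>A\<^esub>"
  by (rule poly_eqI) (auto simp: zero_S coef_tpow coef_one)

lemma tpow_pow:
  assumes "k \<in> S"
  shows "tpow k [^]\<^bsub>A\<^esub> (n :: nat) = tpow (n * k)"
proof (induction n)
  case (Suc n)
  then show ?case using tpow_mult[OF mult_S[OF assms, of n] assms] by (simp add: add.commute)
qed (simp add: tpow_zero)

lemma coef_finsum:
  assumes "f \<in> I \<rightarrow> carrier A"
  shows "coef (\<Oplus>\<^bsub>A\<^esub>i\<in>I. f i) n = (\<Oplus>i\<in>I. coef (f i) n)"
  by (rule finsum_additive[OF A.abelian_monoid_axioms R.abelian_monoid_axioms]) (use assms in auto)

end

text \<open>
  For odd \<open>q\<close> this is the submonoid generated by \<open>2\<close> and \<open>q\<close>. With \<open>q = p ^ r\<close> its monoid algebra is \<open>B\<close>, where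
  \<open>x\<close> and \<open>y\<close> correspond to the exponents \<open>2\<close> and \<open>q\<close>.
\<close>

definition weight_set :: "nat \<Rightarrow> nat set" where
  "weight_set q = {n. even n \<or> q \<le> n}"

text \<open>
  The value of the basis element of \<open>B\<close> with exponent \<open>n\<close> at the point \<open>(\<mu>, a)\<close>.
\<close>

definition weight_power :: "('u, 'u) superalg \<Rightarrow> nat \<Rightarrow> 'u \<times> 'u \<Rightarrow> nat \<Rightarrow> 'u" where
  "weight_power A q = (\<lambda>(\<mu>, a) n. if even n then a [^]\<^bsub>A\<^esub> (n div 2)
     else a [^]\<^bsub>A\<^esub> ((n - q) div 2) \<otimes>\<^bsub>A\<^esub> \<mu>)"

context odd_char_superalgebra
begin

abbreviation "q \<equiv> p ^ r"

lemma odd_q: "odd q" using odd_p by simp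

lemma weight_set_cases:
  assumes "n \<in> weight_set q"
  obtains i where "n = 2 * i" | i where "n = 2 * i + q"
proof (cases "even n")
  case True
  then show ?thesis using that(1) by (elim evenE)
next
  case False
  then have "q \<le> n" "even (n - q)" using assms odd_q by (auto simp: weight_set_def)
  then show ?thesis using that(2)[of "(n - q) div 2"] by simp
qed

lemma weight_power_even [simp]: "weight_power A q (\<mu>, a) (2 * i) = a [^] i"
  by (simp add: weight_power_def)

lemma weight_power_odd [simp]: "weight_power A q (\<mu>, a) (2 * i + q) = a [^] i \<otimes> \<mu>"
  using odd_p by (simp add: weight_power_def)

lemma weight_power_evens:
  assumes "b \<in> Spec_B p r A"
  shows "weight_power A q b n \<in> evens A"
  using assms by (cases b) (auto simp: weight_power_def Spec_B_def even_even)

text \<open>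
  For two odd exponents this is the relation \<open>\<mu>\<^sup>2 = a ^ q\<close>.
\<close>

lemma weight_power_add:
  assumes b: "b \<in> Spec_B p r A" and n: "m \<in> weight_set q" "n \<in> weight_set q"
  shows "weight_power A q b (m + n) = weight_power A q b m \<otimes> weight_power A q b n"
proof -
  obtain \<mu> a where eq: "b = (\<mu>, a)" by (cases b)
  note B = Spec_BD[OF b[unfolded eq]]
  have [simp]: "\<mu> \<in> carrier A" "a \<in> carrier A" using B by auto
  have even: "weight_power A q b (2 * i + 2 * j) = a [^] (i + j)" for i j
    unfolding eq distrib_left[symmetric] by (rule weight_power_even)
  have odd1: "weight_power A q b (2 * i + 2 * j + q) = a [^] (i + j) \<otimes> \<mu>" for i j
    unfolding eq distrib_left[symmetric] by (rule weight_power_odd)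
  have odd2: "weight_power A q b (2 * i + q + (2 * j + q)) = a [^] (i + j + q)" for i j
  proof -
    have "2 * i + q + (2 * j + q) = 2 * (i + j + q)" by simp
    then show ?thesis unfolding eq by (simp only: weight_power_even)
  qed
  show ?thesis
  proof (rule weight_set_cases[OF n(1)]; rule weight_set_cases[OF n(2)])
    fix i j assume "m = 2 * i" "n = 2 * j"
    then show ?thesis using even[of i j] by (simp add: eq nat_pow_mult)
  next
    fix i j assume mn: "m = 2 * i" "n = 2 * j + q"
    then have "m + n = 2 * i + 2 * j + q" by simp
    then show ?thesis using odd1[of i j] by (simp only:) (simp add: mn eq nat_pow_mult[symmetric] m_assoc)
  next
    fix i j assume mn: "m = 2 * i + q" "n = 2 * j"
    then have "m + n = 2 * i + 2 * j + q" by simp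
    then show ?thesis using odd1[of i j] even_central[of "a [^] j" \<mu>] B
      by (simp only:) (simp add: mn eq nat_pow_mult[symmetric] m_assoc)
  next
    fix i j assume mn: "m = 2 * i + q" "n = 2 * j + q"
    have "(a [^] i \<otimes> \<mu>) \<otimes> (a [^] j \<otimes> \<mu>) = (a [^] i \<otimes> a [^] j) \<otimes> (\<mu> \<otimes> \<mu>)"
      using B by (intro even_mult_mult) auto
    then have "(a [^] i \<otimes> \<mu>) \<otimes> (a [^] j \<otimes> \<mu>) = a [^] (i + j + q)" by (simp add: B nat_pow_mult)
    then show ?thesis using odd2[of i j] by (simp only: mn eq weight_power_odd)
  qed
qed

lemma weight_power_zero [simp]: "weight_power A q (\<mu>, a) 0 = \<one>"
  by (simp add: weight_power_def)

lemma weight_power_one: "weight_power A q (\<one>, \<one>) n = \<one>"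
  by (simp add: weight_power_def)

lemma weight_power_at_zero:
  assumes "n \<in> weight_set q"
  shows "weight_power A q (\<zero>, \<zero>) n = (if n = 0 then \<one> else \<zero>)"
proof (rule weight_set_cases[OF assms])
  fix i assume "n = 2 * i"
  then show ?thesis by (cases "i = 0") (simp_all only: weight_power_even, simp_all add: nat_pow_zero)
next
  fix i assume "n = 2 * i + q"
  then show ?thesis using p_gt_1 by (simp only: weight_power_odd) simp
qed

end

section \<open>Evaluation of weighted polynomials\<close>

text \<open>
  The map from \<open>R[S]\<close>, the tensor product of \<open>R\<close> with the coordinate algebra of \<open>Spec(B)\<close>, to a test
  superalgebra that is induced by a homomorphism \<open>h\<close> out of \<open>R\<close> and a point \<open>b\<close> of \<open>Spec(B)\<close>.
\<close>

definition evaluate ::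
  "('u, 'u) superalg \<Rightarrow> ('u, 'u) superalg \<Rightarrow> nat \<Rightarrow> ('u \<Rightarrow> 'u) \<Rightarrow> 'u \<times> 'u \<Rightarrow> (nat \<Rightarrow> 'u) \<Rightarrow> 'u" where
  "evaluate R B q h b u = (\<Oplus>\<^bsub>B\<^esub>n\<in>{n. u n \<noteq> \<zero>\<^bsub>R\<^esub>}. h (u n) \<otimes>\<^bsub>B\<^esub> weight_power B q b n)"

text \<open>
  Passes from the basis \<open>x ^ i\<close>, \<open>x ^ i * y\<close> of the coordinate algebra of \<open>Spec(B)\<close> to the basis \<open>t ^ n\<close>.
\<close>

definition encode :: "('u, 'u) superalg \<Rightarrow> nat \<Rightarrow> (nat \<Rightarrow> 'u) \<times> (nat \<Rightarrow> 'u) \<Rightarrow> nat \<Rightarrow> 'u" where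
  "encode R q = (\<lambda>(u, v) n. if even n then u (n div 2) else if q \<le> n then v ((n - q) div 2) else \<zero>\<^bsub>R\<^esub>)"

locale weighted_poly = M_setting K p r s + poly_superalgebra K R "weight_set (p ^ r)" \<iota>
  for K :: "'u ring" and p r s :: nat and R :: "('u, 'u) superalg" (structure) and \<iota>
begin

abbreviation "q \<equiv> p ^ r"
abbreviation "S \<equiv> weight_set q"

lemma odd_q: "odd q" using odd_p by simp

sublocale poly: odd_char_superalgebra K A p r s
  by (rule odd_char_superalgebra[OF comm_superalgebra_A])

context
  fixes B h b
  assumes B: "comm_superalgebra K B" and h: "h \<in> superhom K R B" and b: "b \<in> Spec_B p r B"
begin

abbreviation "ev \<equiv> evaluate R B q h b"
abbreviation "wp \<equiv> weight_power B q b"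

interpretation B: odd_char_superalgebra K B p r s by (rule odd_char_superalgebra[OF B])

lemma evaluate_term_closed [simp]: "x \<in> carrier R \<Longrightarrow> h x \<otimes>\<^bsub>B\<^esub> wp n \<in> carrier B"
  using superhomD(3)[OF h] B.weight_power_evens[OF b] by simp

lemma evaluate_eq:
  assumes "finite I" "{n. u n \<noteq> \<zero>} \<subseteq> I" "\<And>n. u n \<in> carrier R"
  shows "ev u = (\<Oplus>\<^bsub>B\<^esub>n\<in>I. h (u n) \<otimes>\<^bsub>B\<^esub> wp n)"
  unfolding evaluate_def
  using superhom_zero[OF R.superalgebra_axioms B.superalgebra_axioms h] B.weight_power_evens[OF b] assms
  by (intro B.add.finprod_mono_neutral_cong_left) auto

lemma evaluate_bound:
  assumes "u \<in> X" "\<And>n. n > N \<Longrightarrow> u n = \<zero>"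
  shows "ev u = (\<Oplus>\<^bsub>B\<^esub>n\<in>{..N}. h (u n) \<otimes>\<^bsub>B\<^esub> wp n)"
  using assms X_closed[OF assms(1)] by (intro evaluate_eq) (auto simp: not_less[symmetric])

lemma evaluate_closed:
  assumes "u \<in> X" shows "ev u \<in> carrier B"
proof -
  obtain N where "\<And>n. n > N \<Longrightarrow> u n = \<zero>" using X_bound[OF assms] by blast
  from evaluate_bound[OF assms this] show ?thesis using X_closed[OF assms] by simp
qed

lemma evaluate_tpow:
  assumes "k \<in> S" shows "ev (coef (tpow k)) = wp k"
proof -
  have "ev (coef (tpow k)) = (\<Oplus>\<^bsub>B\<^esub>n\<in>{k}. h (coef (tpow k) n) \<otimes>\<^bsub>B\<^esub> wp n)"
    by (rule evaluate_eq) (use assms in \<open>auto simp: coef_tpow split: if_splits\<close>)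
  then show ?thesis
    using assms superhomD(6)[OF h] B.weight_power_evens[OF b] by (simp add: coef_tpow)
qed

lemma evaluate_const:
  assumes "x \<in> carrier R" shows "ev (coef (const x)) = h x"
proof -
  have "ev (coef (const x)) = (\<Oplus>\<^bsub>B\<^esub>n\<in>{0}. h (coef (const x) n) \<otimes>\<^bsub>B\<^esub> wp n)"
    by (rule evaluate_eq) (use assms in \<open>auto simp: coef_const split: if_splits\<close>)
  then show ?thesis
    using assms superhomD(3)[OF h] by (cases b) (simp add: coef_const)
qed

text \<open>
  The product rule reduces to the Cauchy product, because powers of a point are central and add up on the
  weight set; coefficients outside of it are zero.
\<close>

lemma evaluate_superhom: "(\<lambda>x\<in>carrier A. ev (coef x)) \<in> superhom K A B"
proof (rule superhomI)
  note hD = superhomD[OF h] and w = B.weight_power_evens[OF b]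
  fix x y assume x: "x \<in> carrier A" and y: "y \<in> carrier A"
  obtain N where N: "\<And>n. n > N \<Longrightarrow> coef x n = \<zero>" using X_bound[OF coef_X[OF x]] by blast
  obtain M where M: "\<And>n. n > M \<Longrightarrow> coef y n = \<zero>" using X_bound[OF coef_X[OF y]] by blast
  have "ev (coef (x \<oplus>\<^bsub>A\<^esub> y)) =
      (\<Oplus>\<^bsub>B\<^esub>n\<in>{..max N M}. h (coef (x \<oplus>\<^bsub>A\<^esub> y) n) \<otimes>\<^bsub>B\<^esub> wp n)"
    by (rule evaluate_bound) (use x y N M in \<open>auto simp: coef_X\<close>)
  also have "\<dots> = (\<Oplus>\<^bsub>B\<^esub>n\<in>{..max N M}. h (coef x n) \<otimes>\<^bsub>B\<^esub> wp n \<oplus>\<^bsub>B\<^esub>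
      h (coef y n) \<otimes>\<^bsub>B\<^esub> wp n)"
    using x y hD(3,4) w by (intro B.finsum_cong') (auto simp: B.l_distr)
  also have "\<dots> = (\<Oplus>\<^bsub>B\<^esub>n\<in>{..max N M}. h (coef x n) \<otimes>\<^bsub>B\<^esub> wp n) \<oplus>\<^bsub>B\<^esub>
      (\<Oplus>\<^bsub>B\<^esub>n\<in>{..max N M}. h (coef y n) \<otimes>\<^bsub>B\<^esub> wp n)"
    using x y by (intro B.finsum_addf) auto
  also have "(\<Oplus>\<^bsub>B\<^esub>n\<in>{..max N M}. h (coef x n) \<otimes>\<^bsub>B\<^esub> wp n) = ev (coef x)"
    by (rule evaluate_bound[symmetric]) (use x N in \<open>auto simp: coef_X\<close>)
  also have "(\<Oplus>\<^bsub>B\<^esub>n\<in>{..max N M}. h (coef y n) \<otimes>\<^bsub>B\<^esub> wp n) = ev (coef y)"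
    by (rule evaluate_bound[symmetric]) (use y M in \<open>auto simp: coef_X\<close>)
  finally show "(\<lambda>x\<in>carrier A. ev (coef x)) (x \<oplus>\<^bsub>A\<^esub> y) =
    (\<lambda>x\<in>carrier A. ev (coef x)) x \<oplus>\<^bsub>B\<^esub> (\<lambda>x\<in>carrier A. ev (coef x)) y"
    using x y by (simp del: coef_add)
  define f where "f n = h (coef x n) \<otimes>\<^bsub>B\<^esub> wp n" for n
  define g where "g n = h (coef y n) \<otimes>\<^bsub>B\<^esub> wp n" for n
  have fg [simp]: "f n \<in> carrier B" "g n \<in> carrier B" for n using x y by (simp_all add: f_def g_def)
  have h0: "h \<zero> = \<zero>\<^bsub>B\<^esub>" by (rule superhom_zero[OF R.superalgebra_axioms B.superalgebra_axioms h])
  have w' [simp]: "wp n \<in> carrier B" for n using w by simp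
  have prod_term: "f i \<otimes>\<^bsub>B\<^esub> g (n - i) = h (coef x i \<otimes> coef y (n - i)) \<otimes>\<^bsub>B\<^esub> wp n"
    if i: "i \<le> n" for i n
  proof (cases "i \<in> S \<and> n - i \<in> S")
    case True
    then have "wp n = wp i \<otimes>\<^bsub>B\<^esub> wp (n - i)"
      using B.weight_power_add[OF b, of i "n - i"] i by simp
    moreover have "f i \<otimes>\<^bsub>B\<^esub> g (n - i) = (h (coef x i) \<otimes>\<^bsub>B\<^esub> h (coef y (n - i))) \<otimes>\<^bsub>B\<^esub>
        (wp i \<otimes>\<^bsub>B\<^esub> wp (n - i))"
      unfolding f_def g_def using x y by (intro B.even_mult_mult w hD(3) w' coef_closed)
    ultimately show ?thesis using x y hD(5) by simp
  next
    case False
    then have "coef x i = \<zero> \<or> coef y (n - i) = \<zero>" using x y coef_outside by blast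
    then show ?thesis
    proof
      assume "coef x i = \<zero>" then show ?thesis using y hD(3) w by (simp add: f_def g_def h0)
    next
      assume "coef y (n - i) = \<zero>" then show ?thesis using x hD(3) w by (simp add: f_def g_def h0)
    qed
  qed
  have bound_f: "bound \<zero>\<^bsub>B\<^esub> N f" and bound_g: "bound \<zero>\<^bsub>B\<^esub> M g"
    using N M w by (auto simp: f_def g_def h0)
  have xy0: "coef (x \<otimes>\<^bsub>A\<^esub> y) n = \<zero>" if n: "n > N + M" for n
    unfolding coef_mult[OF x y]
  proof (rule R.add.finprod_one_eqI)
    fix i assume "i \<in> {..n}"
    have "i > N \<or> n - i > M" using n by linarith
    then show "coef x i \<otimes> coef y (n - i) = \<zero>" using N M x y by auto
  qed
  have "ev (coef (x \<otimes>\<^bsub>A\<^esub> y)) =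
      (\<Oplus>\<^bsub>B\<^esub>n\<in>{..N + M}. h (coef (x \<otimes>\<^bsub>A\<^esub> y) n) \<otimes>\<^bsub>B\<^esub> wp n)"
    by (rule evaluate_bound) (use x y xy0 in \<open>auto simp: coef_X\<close>)
  also have "\<dots> = (\<Oplus>\<^bsub>B\<^esub>n\<in>{..N + M}. \<Oplus>\<^bsub>B\<^esub>i\<in>{..n}. f i \<otimes>\<^bsub>B\<^esub> g (n - i))"
  proof (intro B.finsum_cong' refl)
    fix n
    have cl: "(\<lambda>i. coef x i \<otimes> coef y (n - i)) \<in> {..n} \<rightarrow> carrier R" using x y by auto
    have "h (coef (x \<otimes>\<^bsub>A\<^esub> y) n) \<otimes>\<^bsub>B\<^esub> wp n =
      (\<Oplus>\<^bsub>B\<^esub>i\<in>{..n}. h (coef x i \<otimes> coef y (n - i))) \<otimes>\<^bsub>B\<^esub> wp n"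
      unfolding coef_mult[OF x y] superhom_finsum[OF R.superalgebra_axioms B.superalgebra_axioms h cl] ..
    also have "\<dots> = (\<Oplus>\<^bsub>B\<^esub>i\<in>{..n}. h (coef x i \<otimes> coef y (n - i)) \<otimes>\<^bsub>B\<^esub> wp n)"
      by (rule B.finsum_ldistr) (use x y hD(3) in auto)
    also have "\<dots> = (\<Oplus>\<^bsub>B\<^esub>i\<in>{..n}. f i \<otimes>\<^bsub>B\<^esub> g (n - i))"
      by (intro B.finsum_cong') (auto simp: prod_term)
    finally show "h (coef (x \<otimes>\<^bsub>A\<^esub> y) n) \<otimes>\<^bsub>B\<^esub> wp n = (\<Oplus>\<^bsub>B\<^esub>i\<in>{..n}. f i \<otimes>\<^bsub>B\<^esub> g (n - i))" .
  qed auto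
  also have "\<dots> = (\<Oplus>\<^bsub>B\<^esub>i\<in>{..N}. f i) \<otimes>\<^bsub>B\<^esub> (\<Oplus>\<^bsub>B\<^esub>i\<in>{..M}. g i)"
    by (rule B.cauchy_product[OF bound_f bound_g]) auto
  also have "(\<Oplus>\<^bsub>B\<^esub>i\<in>{..N}. f i) = ev (coef x)"
    unfolding f_def by (rule evaluate_bound[symmetric]) (use x N in \<open>auto simp: coef_X\<close>)
  also have "(\<Oplus>\<^bsub>B\<^esub>i\<in>{..M}. g i) = ev (coef y)"
    unfolding g_def by (rule evaluate_bound[symmetric]) (use y M in \<open>auto simp: coef_X\<close>)
  finally show "(\<lambda>x\<in>carrier A. ev (coef x)) (x \<otimes>\<^bsub>A\<^esub> y) =
    (\<lambda>x\<in>carrier A. ev (coef x)) x \<otimes>\<^bsub>B\<^esub> (\<lambda>x\<in>carrier A. ev (coef x)) y"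
    using x y by simp
next
  fix c x assume c: "c \<in> carrier K" and x: "x \<in> carrier A"
  note hD = superhomD[OF h] and w = B.weight_power_evens[OF b]
  obtain N where N: "\<And>n. n > N \<Longrightarrow> coef x n = \<zero>" using X_bound[OF coef_X[OF x]] by blast
  have "ev (coef (c \<odot>\<^bsub>A\<^esub> x)) =
    (\<Oplus>\<^bsub>B\<^esub>n\<in>{..N}. h (coef (c \<odot>\<^bsub>A\<^esub> x) n) \<otimes>\<^bsub>B\<^esub> wp n)"
    by (rule evaluate_bound) (use c x N in \<open>auto simp: coef_X\<close>)
  also have "\<dots> = (\<Oplus>\<^bsub>B\<^esub>n\<in>{..N}. c \<odot>\<^bsub>B\<^esub> (h (coef x n) \<otimes>\<^bsub>B\<^esub> wp n))"
    using c x hD(3,7) w by (intro B.finsum_cong') (auto simp: B.smult_mult_left)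
  also have "\<dots> = c \<odot>\<^bsub>B\<^esub> (\<Oplus>\<^bsub>B\<^esub>n\<in>{..N}. h (coef x n) \<otimes>\<^bsub>B\<^esub> wp n)"
    using c x by (intro B.finsum_smult_ldistr[symmetric]) auto
  also have "(\<Oplus>\<^bsub>B\<^esub>n\<in>{..N}. h (coef x n) \<otimes>\<^bsub>B\<^esub> wp n) = ev (coef x)"
    by (rule evaluate_bound[symmetric]) (use x N in \<open>auto simp: coef_X\<close>)
  finally show "(\<lambda>x\<in>carrier A. ev (coef x)) (c \<odot>\<^bsub>A\<^esub> x) =
    c \<odot>\<^bsub>B\<^esub> (\<lambda>x\<in>carrier A. ev (coef x)) x"
    using c x by (simp del: coef_smult)
next
  have "ev (coef (tpow 0)) = wp 0"
    by (rule evaluate_tpow) (simp add: zero_S)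
  then show "(\<lambda>x\<in>carrier A. ev (coef x)) \<one>\<^bsub>A\<^esub> = \<one>\<^bsub>B\<^esub>"
    by (cases b) (simp add: tpow_zero)
next
  note hD = superhomD[OF h] and w = B.weight_power_evens[OF b]
  fix x assume x: "x \<in> evens A"
  have "(\<Oplus>\<^bsub>B\<^esub>n\<in>{n. coef x n \<noteq> \<zero>}. h (coef x n) \<otimes>\<^bsub>B\<^esub> wp n) \<in> evens B"
    using iffD1[OF A_evens_iff x] hD(8) w by (intro B.evens_finsum) (auto intro!: B.even_even)
  then show "(\<lambda>x\<in>carrier A. ev (coef x)) x \<in> evens B"
    using x by (simp add: evaluate_def)
next
  note hD = superhomD[OF h] and w = B.weight_power_evens[OF b]
  fix x assume x: "x \<in> odds A"
  have "(\<Oplus>\<^bsub>B\<^esub>n\<in>{n. coef x n \<noteq> \<zero>}. h (coef x n) \<otimes>\<^bsub>B\<^esub> wp n) \<in> odds B"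
    using iffD1[OF A_odds_iff x] hD(9) w by (intro B.odds_finsum) (auto intro!: B.odd_even)
  then show "(\<lambda>x\<in>carrier A. ev (coef x)) x \<in> odds B"
    using x by (simp add: evaluate_def)
qed (auto simp: evaluate_closed coef_X)

lemma pair_points_evaluate:
  assumes "u \<in> finite_seqs R" "v \<in> finite_seqs R"
  shows "pair_points R B h b (u, v) = ev (encode R q (u, v))"
proof -
  obtain \<mu> a where eq: "b = (\<mu>, a)" by (cases b)
  note bD = B.Spec_BD[OF b[unfolded eq]]
  let ?U = "{i. u i \<noteq> \<zero>}" and ?V = "{i. v i \<noteq> \<zero>}"
  let ?w = "encode R q (u, v)" and ?I = "(\<lambda>i. 2 * i) ` ?U" and ?J = "(\<lambda>i. 2 * i + q) ` ?V"
  have fin: "finite ?U" "finite ?V" and uv [simp]: "u i \<in> carrier R" "v i \<in> carrier R" for i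
    using assms by (auto simp: finite_seqs_def)
  have wc [simp]: "?w n \<in> carrier R" for n by (simp add: encode_def)
  have w: "?w (2 * i) = u i" "?w (2 * i + q) = v i" for i
    using odd_p by (simp_all add: encode_def)
  have sup: "{n. ?w n \<noteq> \<zero>} \<subseteq> ?I \<union> ?J"
  proof
    fix n assume n: "n \<in> {n. ?w n \<noteq> \<zero>}"
    then have "n \<in> S" by (auto simp: encode_def weight_set_def split: if_splits)
    then show "n \<in> ?I \<union> ?J"
      by (rule poly.weight_set_cases) (use n w in auto)
  qed
  have disj: "?I \<inter> ?J = {}"
  proof -
    have "2 * i \<noteq> 2 * j + q" for i j using odd_q by (metis even_mult_iff even_add even_numeral)
    then show ?thesis by auto
  qed
  have "ev ?w = (\<Oplus>\<^bsub>B\<^esub>n\<in>?I \<union> ?J. h (?w n) \<otimes>\<^bsub>B\<^esub> wp n)"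
    by (rule evaluate_eq[OF _ sup]) (use fin in auto)
  also have "\<dots> = (\<Oplus>\<^bsub>B\<^esub>n\<in>?I. h (?w n) \<otimes>\<^bsub>B\<^esub> wp n) \<oplus>\<^bsub>B\<^esub>
      (\<Oplus>\<^bsub>B\<^esub>n\<in>?J. h (?w n) \<otimes>\<^bsub>B\<^esub> wp n)"
    by (rule B.finsum_Un_disjoint) (use fin disj in auto)
  also have "(\<Oplus>\<^bsub>B\<^esub>n\<in>?I. h (?w n) \<otimes>\<^bsub>B\<^esub> wp n) =
      (\<Oplus>\<^bsub>B\<^esub>i\<in>?U. h (?w (2 * i)) \<otimes>\<^bsub>B\<^esub> wp (2 * i))"
    by (rule B.finsum_reindex) (auto simp: inj_on_def)
  also have "\<dots> = (\<Oplus>\<^bsub>B\<^esub>i\<in>?U. h (u i) \<otimes>\<^bsub>B\<^esub> a [^]\<^bsub>B\<^esub> i)"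
    unfolding w eq B.weight_power_even ..
  also have "(\<Oplus>\<^bsub>B\<^esub>n\<in>?J. h (?w n) \<otimes>\<^bsub>B\<^esub> wp n) =
      (\<Oplus>\<^bsub>B\<^esub>i\<in>?V. h (?w (2 * i + q)) \<otimes>\<^bsub>B\<^esub> wp (2 * i + q))"
    by (rule B.finsum_reindex) (auto simp: inj_on_def)
  also have "\<dots> = (\<Oplus>\<^bsub>B\<^esub>i\<in>?V. h (v i) \<otimes>\<^bsub>B\<^esub> (a [^]\<^bsub>B\<^esub> i \<otimes>\<^bsub>B\<^esub> \<mu>))"
    unfolding w eq B.weight_power_odd ..
  finally show ?thesis by (simp add: pair_points_def eq)
qed

end

lemma encode_X:
  assumes "u \<in> finite_seqs R" "v \<in> finite_seqs R"
  shows "encode R q (u, v) \<in> X"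
proof -
  have "finite {i. u i \<noteq> \<zero>}" "finite {i. v i \<noteq> \<zero>}" and uv: "u i \<in> carrier R" "v i \<in> carrier R" for i
    using assms by (auto simp: finite_seqs_def)
  then obtain M N where M: "\<And>i. u i \<noteq> \<zero> \<Longrightarrow> i \<le> M" and N: "\<And>i. v i \<noteq> \<zero> \<Longrightarrow> i \<le> N"
    by (auto simp: finite_nat_set_iff_bounded_le)
  have M': "u i = \<zero>" if "i > M" for i using M[of i] that by force
  have N': "v i = \<zero>" if "i > N" for i using N[of i] that by force
  show ?thesis
    by (rule XI[of _ "2 * M + 2 * N + q + 1"]) (auto simp: uv encode_def weight_set_def intro!: M' N')
qed

lemma scaled_S: "k * q \<in> S" "2 * k \<in> S" "k * 2 \<in> S"
  using mult_S[of q k] by (auto simp: weight_set_def)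

text \<open>
  The image of the universal point under \<open>t \<mapsto> t ^ k\<close>. The case \<open>k = 1\<close> is the universal point itself; large \<open>k\<close>
  separate the exponents of two successive actions.
\<close>

lemma scaled_point: "(tpow (k * q), tpow (2 * k)) \<in> Spec_B p r A"
proof -
  have "tpow (k * q) \<otimes>\<^bsub>A\<^esub> tpow (k * q) = tpow (q * (2 * k))"
  proof -
    have "k * q + k * q = q * (2 * k)" by (metis mult.commute mult.left_commute mult_2)
    then show ?thesis by (simp only: tpow_mult[OF scaled_S(1)[of k] scaled_S(1)[of k]])
  qed
  then show ?thesis
    using tpow_even[OF scaled_S(1)] tpow_even[OF scaled_S(2)] tpow_pow[OF scaled_S(2)]
    by (simp add: Spec_B_def)
qed

lemma scaled_weight_power:
  assumes "n \<in> S"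
  shows "weight_power A q (tpow (k * q), tpow (2 * k)) n = tpow (k * n)"
proof (rule poly.weight_set_cases[OF assms])
  fix i assume n: "n = 2 * i"
  have "i * (2 * k) = k * n" using n by simp
  then show ?thesis by (simp only: n poly.weight_power_even tpow_pow[OF scaled_S(2)])
next
  fix i assume n: "n = 2 * i + q"
  have "i * (2 * k) + k * q = k * n" using n by (simp add: algebra_simps)
  then show ?thesis
    by (simp only: n poly.weight_power_odd tpow_pow[OF scaled_S(2)] tpow_mult[OF mult_S[OF scaled_S(2)] scaled_S(1)])
qed

lemma coef_evaluate_scaled:
  assumes u: "u \<in> X" and N: "\<And>n. n > N \<Longrightarrow> u n = \<zero>"
  shows "coef (evaluate R A q const (tpow (k * q), tpow (2 * k)) u) m =
    (\<Oplus>n\<in>{..N}. if m = k * n then u n else \<zero>)"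
proof -
  note b = scaled_point[of k]
  have ev: "evaluate R A q const (tpow (k * q), tpow (2 * k)) u =
    (\<Oplus>\<^bsub>A\<^esub>n\<in>{..N}. const (u n) \<otimes>\<^bsub>A\<^esub> weight_power A q (tpow (k * q), tpow (2 * k)) n)"
    by (rule evaluate_bound[OF comm_superalgebra_A const_superhom b u]) (rule N)
  have cl: "const (u n) \<otimes>\<^bsub>A\<^esub> weight_power A q (tpow (k * q), tpow (2 * k)) n \<in> carrier A" for n
    using evaluate_term_closed[OF comm_superalgebra_A const_superhom b X_closed[OF u]] .
  have "coef (evaluate R A q const (tpow (k * q), tpow (2 * k)) u) m =
    (\<Oplus>n\<in>{..N}. coef (const (u n) \<otimes>\<^bsub>A\<^esub> weight_power A q (tpow (k * q), tpow (2 * k)) n) m)"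
    unfolding ev by (rule coef_finsum) (use cl in auto)
  also have "\<dots> = (\<Oplus>n\<in>{..N}. if m = k * n then u n else \<zero>)"
  proof (intro R.finsum_cong' refl)
    fix n
    show "coef (const (u n) \<otimes>\<^bsub>A\<^esub> weight_power A q (tpow (k * q), tpow (2 * k)) n) m =
      (if m = k * n then u n else \<zero>)"
    proof (cases "n \<in> S")
      case True
      then show ?thesis
        using X_closed[OF u, of n] mult_S[OF True, of k]
        by (simp add: scaled_weight_power coef_const_mult coef_tpow)
    next
      case False
      then have "u n = \<zero>" using u by (simp add: polys_on_def)
      moreover have "weight_power A q (tpow (k * q), tpow (2 * k)) n \<in> carrier A"
        using poly.weight_power_evens[OF b] by simp
      ultimately show ?thesis by (simp add: coef_const_mult)
    qed
  qed (use X_closed[OF u] in auto)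
  finally show ?thesis .
qed

text \<open>
  Coefficients can be recovered from the value at the universal point. All properties of the coaction are
  derived from this.
\<close>

lemma evaluate_universal:
  assumes u: "u \<in> X"
  shows "evaluate R A q const (tpow q, tpow 2) u = \<iota> u"
proof (rule poly_eqI)
  have b: "(tpow q, tpow 2) \<in> Spec_B p r A" using scaled_point[of 1] by simp
  show "evaluate R A q const (tpow q, tpow 2) u \<in> carrier A"
    by (rule evaluate_closed[OF comm_superalgebra_A const_superhom b u])
  show "\<iota> u \<in> carrier A" using u by simp
  fix m
  obtain N where N: "\<And>n. n > N \<Longrightarrow> u n = \<zero>" using X_bound[OF u] by blast
  have N': "n > max N m \<Longrightarrow> u n = \<zero>" for n using N by simp
  have "coef (evaluate R A q const (tpow q, tpow 2) u) m =
    (\<Oplus>n\<in>{..max N m}. if m = n then u n else \<zero>)"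
    using coef_evaluate_scaled[OF u, where N = "max N m" and k = 1 and m = m] N' by simp
  also have "\<dots> = u m" by (rule R.finsum_singleton) (use X_closed[OF u] in auto)
  finally show "coef (evaluate R A q const (tpow q, tpow 2) u) m = coef (\<iota> u) m" using u by simp
qed

end

section \<open>Existence and uniqueness of the coaction\<close>

lemma weight_set_zero: "0 \<in> weight_set q" by (simp add: weight_set_def)

lemma weight_set_add:
  assumes "odd q" "m \<in> weight_set q" "n \<in> weight_set q"
  shows "m + n \<in> weight_set q"
  using assms by (auto simp: weight_set_def)

locale Hom_representation = M_setting K p r s
  for K :: "'u ring" and p r s :: nat +
  fixes G :: "('u, 'g) group_functor" and R :: "('u, 'u) superalg" (structure) and rep :: "('u, 'g) Hom_rep"
  assumes group_functor: "is_group_functor K G"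
    and coordinate: "is_coordinate_superalgebra_of_Hom K p r s G R rep"
begin

abbreviation "q \<equiv> p ^ r"
abbreviation "S \<equiv> weight_set q"

lemma odd_q: "odd q" using odd_p by simp

lemma represents: "represents K R (base_changed_homs K M G) (base_change K) rep"
  using coordinate by (simp add: is_coordinate_superalgebra_of_Hom_def)

sublocale R: comm_superalgebra K R
  using represents by (simp add: represents_def)

lemma R_comm: "comm_superalgebra K R" by (rule R.comm_superalgebra_axioms)

lemma rep_bij: "comm_superalgebra K A \<Longrightarrow>
    bij_betw (rep A) (superhom K R A) (base_changed_homs K M G A)"
  using represents by (simp add: represents_def)

lemma rep_natural: "\<lbrakk>comm_superalgebra K A; comm_superalgebra K A'; f \<in> superhom K A A'; h \<in> superhom K R A\<rbrakk> \<Longrightarrow>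
    rep A' (compose (carrier R) f h) = base_change K A A' f (rep A h)"
  using represents by (simp add: represents_def)

lemma rep_closed: "\<lbrakk>comm_superalgebra K A; h \<in> superhom K R A\<rbrakk> \<Longrightarrow>
    rep A h \<in> base_changed_homs K M G A"
  using rep_bij bij_betwE by blast

lemma rep_inj: "\<lbrakk>comm_superalgebra K A; h \<in> superhom K R A; h' \<in> superhom K R A; rep A h = rep A h'\<rbrakk> \<Longrightarrow> h = h'"
  using rep_bij[of A] by (auto simp: bij_betw_def inj_on_def)

lemma R_id: "(\<lambda>x\<in>carrier R. x) \<in> superhom K R R"
  by (rule superhom_id[OF R.superalgebra_axioms])

text \<open>
  The action of \<open>Spec(B)\<close> on \<open>Hom(M, G)\<close>, transported to homomorphisms out of the coordinate superalgebra.
\<close>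

definition act :: "('u, 'u) superalg \<Rightarrow> ('u \<Rightarrow> 'u) \<Rightarrow> 'u \<times> 'u \<Rightarrow> 'u \<Rightarrow> 'u" where
  "act A h b = inv_into (superhom K R A) (rep A) (right_action K p r s A b (rep A h))"

lemma
  assumes "comm_superalgebra K A" "h \<in> superhom K R A" "b \<in> Spec_B p r A"
  shows act_superhom: "act A h b \<in> superhom K R A"
    and rep_act: "rep A (act A h b) = right_action K p r s A b (rep A h)"
proof -
  have "right_action K p r s A b (rep A h) \<in> rep A ` superhom K R A"
    using right_action_closed[OF assms(1,3) rep_closed[OF assms(1,2)]] rep_bij[OF assms(1)]
    by (simp add: bij_betw_def)
  then show "act A h b \<in> superhom K R A" "rep A (act A h b) = right_action K p r s A b (rep A h)"
    unfolding act_def by (rule inv_into_into, rule f_inv_into_f)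
qed

lemma act_natural:
  assumes A: "comm_superalgebra K A" and A': "comm_superalgebra K A'" and f: "f \<in> superhom K A A'"
    and h: "h \<in> superhom K R A" and b: "(\<mu>, a) \<in> Spec_B p r A"
  shows "compose (carrier R) f (act A h (\<mu>, a)) = act A' (compose (carrier R) f h) (f \<mu>, f a)"
proof (rule rep_inj[OF A'])
  note fh = superhom_compose[OF R.superalgebra_axioms h f] and fb = Spec_B_map[OF A A' f b]
  show "compose (carrier R) f (act A h (\<mu>, a)) \<in> superhom K R A'"
    by (rule superhom_compose[OF R.superalgebra_axioms act_superhom[OF A h b] f])
  show "act A' (compose (carrier R) f h) (f \<mu>, f a) \<in> superhom K R A'"
    by (rule act_superhom[OF A' fh fb])
  show "rep A' (compose (carrier R) f (act A h (\<mu>, a))) = rep A' (act A' (compose (carrier R) f h) (f \<mu>, f a))"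
    using rep_natural[OF A A' f act_superhom[OF A h b]] rep_natural[OF A A' f h] rep_act[OF A h b]
      rep_act[OF A' fh fb] base_change_right_action[OF A A' f b, of "rep A h"] by simp
qed

lemma act_act:
  assumes A: "comm_superalgebra K A" and h: "h \<in> superhom K R A"
    and b: "(\<mu>, a) \<in> Spec_B p r A" and b': "(\<mu>', a') \<in> Spec_B p r A"
  shows "act A (act A h (\<mu>, a)) (\<mu>', a') = act A h (\<mu> \<otimes>\<^bsub>A\<^esub> \<mu>', a \<otimes>\<^bsub>A\<^esub> a')"
proof (rule rep_inj[OF A])
  interpret A: odd_char_superalgebra K A p r s by (rule odd_char_superalgebra[OF A])
  note bb = A.Spec_B_mult[OF b b'] and hb = act_superhom[OF A h b]
  show "act A (act A h (\<mu>, a)) (\<mu>', a') \<in> superhom K R A" by (rule act_superhom[OF A hb b'])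
  show "act A h (\<mu> \<otimes>\<^bsub>A\<^esub> \<mu>', a \<otimes>\<^bsub>A\<^esub> a') \<in> superhom K R A" by (rule act_superhom[OF A h bb])
  show "rep A (act A (act A h (\<mu>, a)) (\<mu>', a')) = rep A (act A h (\<mu> \<otimes>\<^bsub>A\<^esub> \<mu>', a \<otimes>\<^bsub>A\<^esub> a'))"
    using right_action_comp[OF A b b', of "rep A h"]
    by (simp add: rep_act[OF A hb b'] rep_act[OF A h b] rep_act[OF A h bb])
qed

lemma act_one:
  assumes A: "comm_superalgebra K A" and h: "h \<in> superhom K R A"
  shows "act A h (\<one>\<^bsub>A\<^esub>, \<one>\<^bsub>A\<^esub>) = h"
proof -
  interpret A: odd_char_superalgebra K A p r s by (rule odd_char_superalgebra[OF A])
  show ?thesis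
    using act_superhom[OF A h A.Spec_B_one] h rep_act[OF A h A.Spec_B_one]
      right_action_one[OF A rep_closed[OF A h]] by (intro rep_inj[OF A]) auto
qed

lemma weighted_poly_ex: "\<exists>\<iota>. weighted_poly K p r s R \<iota>"
proof -
  obtain \<iota> :: "(nat \<Rightarrow> 'u) \<Rightarrow> 'u" where \<iota>: "inj_on \<iota> (up R)"
    using R.infinite_inj_up[OF infinite_universe] by blast
  have "weighted_poly K p r s R \<iota>"
    by unfold_locales
      (use inj_on_subset[OF \<iota>] weight_set_zero weight_set_add[OF odd_q] in \<open>auto simp: polys_on_def\<close>)
  then show ?thesis by blast
qed

lemma coaction_is_act:
  assumes "is_coaction K p r s R rep \<delta>" "comm_superalgebra K A" "h \<in> superhom K R A" "b \<in> Spec_B p r A"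
    "z \<in> carrier R"
  shows "pair_points R A h b (\<delta> z) = act A h b z"
proof -
  have "(\<lambda>z\<in>carrier R. pair_points R A h b (\<delta> z)) \<in> superhom K R A \<and>
        rep A (\<lambda>z\<in>carrier R. pair_points R A h b (\<delta> z)) = right_action K p r s A b (rep A h)"
    using assms unfolding is_coaction_def by blast
  then have "(\<lambda>z\<in>carrier R. pair_points R A h b (\<delta> z)) = act A h b"
    using act_superhom[OF assms(2-4)] rep_act[OF assms(2-4)] by (intro rep_inj[OF assms(2)]) auto
  then show ?thesis using assms(5) by (metis restrict_apply')
qed

text \<open>
  The coaction is the product \<open>\<theta>\<close> of the inclusion of \<open>R\<close> into \<open>R[S]\<close> and the universal point. Any pair of points
  is the image of this pair under evaluation, so naturality of the action gives the defining property. Conversely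
  a coaction is determined by its value at this pair.
\<close>

lemma coaction_ex1: "\<exists>!\<delta>. is_coaction K p r s R rep \<delta>"
proof -
  obtain \<iota> where "weighted_poly K p r s R \<iota>" using weighted_poly_ex by blast
  then interpret W: weighted_poly K p r s R \<iota> .
  note A = W.comm_superalgebra_A and c = W.const_superhom
  have b: "(W.tpow q, W.tpow 2) \<in> Spec_B p r W.A" using W.scaled_point[of 1] by simp
  define \<theta> where "\<theta> = act W.A W.const (W.tpow q, W.tpow 2)"
  have \<theta>: "\<theta> \<in> superhom K R W.A" unfolding \<theta>_def by (rule act_superhom[OF A c b])
  define \<delta> where "\<delta> = (\<lambda>z\<in>carrier R. ((\<lambda>i. W.coef (\<theta> z) (2 * i)), (\<lambda>i. W.coef (\<theta> z) (2 * i + q))))"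
  have fs: "(\<lambda>i. W.coef (\<theta> z) (2 * i)) \<in> finite_seqs R" "(\<lambda>i. W.coef (\<theta> z) (2 * i + q)) \<in> finite_seqs R"
    if z: "z \<in> carrier R" for z
  proof -
    have tz: "\<theta> z \<in> carrier W.A" using superhomD(3)[OF \<theta> z] .
    obtain N where N: "\<And>n. n > N \<Longrightarrow> W.coef (\<theta> z) n = \<zero>" using W.X_bound[OF W.coef_X[OF tz]] by blast
    have "{i. W.coef (\<theta> z) (2 * i) \<noteq> \<zero>} \<subseteq> {..N}" "{i. W.coef (\<theta> z) (2 * i + q) \<noteq> \<zero>} \<subseteq> {..N}"
      using N by (auto intro!: leI dest: N)
    then show "(\<lambda>i. W.coef (\<theta> z) (2 * i)) \<in> finite_seqs R" "(\<lambda>i. W.coef (\<theta> z) (2 * i + q)) \<in> finite_seqs R"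
      using tz by (auto simp: finite_seqs_def intro: finite_subset)
  qed
  have enc: "encode R q (\<delta> z) = W.coef (\<theta> z)" if z: "z \<in> carrier R" for z
  proof
    fix n
    have tz: "\<theta> z \<in> carrier W.A" using superhomD(3)[OF \<theta> z] .
    show "encode R q (\<delta> z) n = W.coef (\<theta> z) n"
    proof (cases "n \<in> S")
      case True
      then show ?thesis
        by (rule W.poly.weight_set_cases) (use z odd_p in \<open>auto simp: encode_def \<delta>_def\<close>)
    next
      case False
      then show ?thesis using W.coef_outside[OF tz] by (auto simp: encode_def weight_set_def split: prod.splits)
    qed
  qed
  show ?thesis
  proof (rule ex1I[of _ \<delta>])
    show "is_coaction K p r s R rep \<delta>"
      unfolding is_coaction_def
    proof (intro conjI allI impI ballI)
      show "\<delta> \<in> carrier R \<rightarrow>\<^sub>E finite_seqs R \<times> finite_seqs R"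
        using fs by (auto simp: \<delta>_def)
      fix A' h b' assume A': "comm_superalgebra K A'" and h: "h \<in> superhom K R A'" and b': "b' \<in> Spec_B p r A'"
      let ?e = "\<lambda>x\<in>carrier W.A. evaluate R A' q h b' (W.coef x)"
      note e = W.evaluate_superhom[OF A' h b']
      have "compose (carrier R) ?e \<theta> = act A' (compose (carrier R) ?e W.const) (?e (W.tpow q), ?e (W.tpow 2))"
        unfolding \<theta>_def by (rule act_natural[OF A A' e c b])
      also have "compose (carrier R) ?e W.const = h"
        by (rule superhom_eqI[OF superhom_compose[OF R.superalgebra_axioms c e] h])
          (simp add: compose_def W.evaluate_const[OF A' h b'])
      also have "(?e (W.tpow q), ?e (W.tpow 2)) = b'"
      proof -
        obtain \<mu> a where eq: "b' = (\<mu>, a)" by (cases b')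
        interpret A': odd_char_superalgebra K A' p r s by (rule odd_char_superalgebra[OF A'])
        have S: "q \<in> S" "2 \<in> S" by (simp_all add: weight_set_def)
        have "weight_power A' q b' (2 * 0 + q) = \<mu>" "weight_power A' q b' (2 * 1) = a"
          unfolding eq A'.weight_power_odd A'.weight_power_even using A'.Spec_BD b' eq by auto
        then show ?thesis using S W.evaluate_tpow[OF A' h b'] by (simp add: eq)
      qed
      finally have *: "compose (carrier R) ?e \<theta> = act A' h b'" .
      have "(\<lambda>z\<in>carrier R. pair_points R A' h b' (\<delta> z)) = act A' h b'"
      proof -
        have "pair_points R A' h b' (\<delta> z) = compose (carrier R) ?e \<theta> z" if z: "z \<in> carrier R" for z
          using W.pair_points_evaluate[OF A' h b' fs[OF z]] enc[OF z] superhomD(3)[OF \<theta> z] z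
          by (simp add: \<delta>_def compose_def)
        then show ?thesis unfolding * using superhomD(2)[OF act_superhom[OF A' h b']]
          by (auto simp: fun_eq_iff extensional_def restrict_def)
      qed
      then show "(\<lambda>z\<in>carrier R. pair_points R A' h b' (\<delta> z)) \<in> superhom K R A'"
        "rep A' (\<lambda>z\<in>carrier R. pair_points R A' h b' (\<delta> z)) = right_action K p r s A' b' (rep A' h)"
        using act_superhom[OF A' h b'] rep_act[OF A' h b'] by simp_all
    qed
  next
    fix \<delta>' assume \<delta>': "is_coaction K p r s R rep \<delta>'"
    have funs: "\<delta>' \<in> carrier R \<rightarrow>\<^sub>E finite_seqs R \<times> finite_seqs R" using \<delta>' by (simp add: is_coaction_def)
    have "\<delta>' z = \<delta> z" if z: "z \<in> carrier R" for z
    proof -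
      obtain u v where uv: "\<delta>' z = (u, v)" "u \<in> finite_seqs R" "v \<in> finite_seqs R"
        using PiE_mem[OF funs z] by (cases "\<delta>' z") auto
      have "\<theta> z = \<iota> (encode R q (u, v))"
        using coaction_is_act[OF \<delta>' A c b z] W.pair_points_evaluate[OF A c b uv(2,3)]
          W.evaluate_universal[OF W.encode_X[OF uv(2,3)]] uv(1) by (simp add: \<theta>_def)
      then have *: "W.coef (\<theta> z) = encode R q (u, v)" using W.encode_X[OF uv(2,3)] by simp
      have "u i = W.coef (\<theta> z) (2 * i)" "v i = W.coef (\<theta> z) (2 * i + q)" for i
        unfolding * using odd_p by (simp_all add: encode_def)
      then have "u = (\<lambda>i. W.coef (\<theta> z) (2 * i))" "v = (\<lambda>i. W.coef (\<theta> z) (2 * i + q))" by (auto intro: ext)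
      then show ?thesis using uv(1) z by (simp add: \<delta>_def)
    qed
    then show "\<delta>' = \<delta>"
      using PiE_arb[OF funs] by (auto simp: fun_eq_iff \<delta>_def)
  qed
qed

lemma is_coaction_coaction: "is_coaction K p r s R rep (coaction K p r s R rep)"
  unfolding coaction_def by (rule theI'[OF coaction_ex1])

text \<open>
  Joins the families \<open>phi\<close> and \<open>psi\<close>, so that \<open>n\<close> is twice the degree of the component.
\<close>

definition component :: "nat \<Rightarrow> 'u \<Rightarrow> 'u" where
  "component n z = encode R q (coaction K p r s R rep z) n"

lemma component_even: "component (2 * i) z = phi K p r s R rep i z"
  by (cases "coaction K p r s R rep z") (simp add: component_def encode_def phi_def)

lemma component_odd: "component (2 * i + q) z = psi K p r s R rep i z"
  using odd_p by (cases "coaction K p r s R rep z") (simp add: component_def encode_def psi_def)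

lemma coaction_finite_seqs:
  assumes "z \<in> carrier R"
  obtains u v where "coaction K p r s R rep z = (u, v)" "u \<in> finite_seqs R" "v \<in> finite_seqs R"
proof -
  have "coaction K p r s R rep z \<in> finite_seqs R \<times> finite_seqs R"
    using is_coaction_coaction assms by (auto simp: is_coaction_def)
  then show ?thesis using that by (cases "coaction K p r s R rep z") auto
qed

lemma component_poly:
  assumes "z \<in> carrier R"
  shows "(\<lambda>n. component n z) \<in> polys_on R S"
proof -
  obtain \<iota> where "weighted_poly K p r s R \<iota>" using weighted_poly_ex by blast
  then interpret W: weighted_poly K p r s R \<iota> .
  obtain u v where "coaction K p r s R rep z = (u, v)" "u \<in> finite_seqs R" "v \<in> finite_seqs R"
    using coaction_finite_seqs[OF assms] .
  then show ?thesis using W.encode_X by (simp add: component_def)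
qed

lemma act_eq_evaluate:
  assumes "comm_superalgebra K A" "h \<in> superhom K R A" "b \<in> Spec_B p r A" "z \<in> carrier R"
  shows "act A h b z = evaluate R A q h b (\<lambda>n. component n z)"
proof -
  obtain \<iota> where "weighted_poly K p r s R \<iota>" using weighted_poly_ex by blast
  then interpret W: weighted_poly K p r s R \<iota> .
  obtain u v where uv: "coaction K p r s R rep z = (u, v)" "u \<in> finite_seqs R" "v \<in> finite_seqs R"
    using coaction_finite_seqs[OF assms(4)] .
  show ?thesis
    using coaction_is_act[OF is_coaction_coaction assms] W.pair_points_evaluate[OF assms(1-3) uv(2,3)]
    by (simp add: uv(1) component_def)
qed

end

section \<open>The homogeneous projections\<close>

text \<open>
  The ground field as a purely even superalgebra, over which the trivial homomorphism is defined.
\<close>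

definition scalars :: "'u ring \<Rightarrow> ('u, 'u) superalg" where
  "scalars K = \<lparr>carrier = carrier K, monoid.mult = monoid.mult K, one = one K, zero = zero K, add = add K,
     smult = monoid.mult K, evens = carrier K, odds = {zero K}\<rparr>"

lemma scalars_simps [simp]:
  "carrier (scalars K) = carrier K" "monoid.mult (scalars K) = monoid.mult K" "one (scalars K) = one K"
  "zero (scalars K) = zero K" "add (scalars K) = add K" "smult (scalars K) = monoid.mult K"
  "evens (scalars K) = carrier K" "odds (scalars K) = {zero K}"
  by (simp_all add: scalars_def)

lemma comm_superalgebra_scalars:
  assumes "cring K"
  shows "comm_superalgebra K (scalars K)"
proof -
  interpret K: cring K by fact
  have ab: "abelian_group (scalars K)"
    by (rule abelian_groupI) (auto simp: K.a_ac intro: K.l_neg bexI[of _ "\<ominus>\<^bsub>K\<^esub> _"])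
  have ring: "ring (scalars K)"
    by (rule ringI[OF ab]) (auto intro!: monoidI simp: K.m_assoc K.l_distr K.r_distr)
  interpret S: ring "scalars K" by (rule ring)
  have mod: "module K (scalars K)"
    by (rule moduleI[OF assms ab]) (auto simp: K.l_distr K.r_distr K.m_assoc)
  interpret M: module K "scalars K" by (rule mod)
  have neg0: "\<ominus>\<^bsub>scalars K\<^esub> \<zero>\<^bsub>K\<^esub> = \<zero>\<^bsub>K\<^esub>" using S.minus_zero by simp
  show ?thesis
  proof (intro comm_superalgebra.intro superalgebra.intro superalgebra_axioms.intro comm_superalgebra_axioms.intro mod ring)
    show "submodule (evens (scalars K)) K (scalars K)" using M.carrier_is_submodule by simp
    show "submodule (odds (scalars K)) K (scalars K)"
      by (rule M.submoduleI) (auto simp: neg0)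
    show "\<exists>!w. fst w \<in> evens (scalars K) \<and> snd w \<in> odds (scalars K) \<and> x = fst w \<oplus>\<^bsub>scalars K\<^esub> snd w"
      if "x \<in> carrier (scalars K)" for x
      using that by (intro ex1I[of _ "(x, \<zero>\<^bsub>K\<^esub>)"]) auto
  qed (auto simp: K.m_assoc K.m_lcomm K.m_comm neg0)
qed

context Hom_representation
begin

lemma component_closed [simp]: "z \<in> carrier R \<Longrightarrow> component n z \<in> carrier R"
  using component_poly[of z] by (auto simp: polys_on_def)

lemma component_outside: "\<lbrakk>z \<in> carrier R; n \<notin> S\<rbrakk> \<Longrightarrow> component n z = \<zero>"
  using component_poly[of z] by (auto simp: polys_on_def)

lemma component_bound:
  assumes "z \<in> carrier R"
  obtains N where "\<And>n. n > N \<Longrightarrow> component n z = \<zero>"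
proof -
  have "(\<lambda>n. component n z) \<in> up R" using component_poly[OF assms] by (simp add: polys_on_def)
  from R.bound_upD[OF this] show ?thesis using that by (auto dest: bound.bound)
qed

text \<open>
  All statements are read off from the coefficients of \<open>\<theta> z\<close>, the value of the coaction in \<open>R[S]\<close>. The last one is
  associativity of the action. Acting by \<open>(t ^ q, t\<^sup>2)\<close> and then by \<open>(t ^ (k * q), t ^ (2 * k))\<close> gives
  \<open>\<Sum> component m (component n z) * t ^ (m + k * n)\<close>, acting by the product of the two points gives
  \<open>\<Sum> component n z * t ^ (n + k * n)\<close>, and for large \<open>k\<close> the exponent \<open>m + k * n\<close> determines \<open>m\<close> and \<open>n\<close>.
\<close>

lemma
  shows component_add: "\<lbrakk>x \<in> carrier R; y \<in> carrier R\<rbrakk> \<Longrightarrow> component n (x \<oplus> y) = component n x \<oplus> component n y"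
    and component_mult: "\<lbrakk>x \<in> carrier R; y \<in> carrier R\<rbrakk> \<Longrightarrow>
      component n (x \<otimes> y) = (\<Oplus>i\<in>{..n}. component i x \<otimes> component (n - i) y)"
    and component_one: "component n \<one> = (if n = 0 then \<one> else \<zero>)"
    and component_smult: "\<lbrakk>c \<in> carrier K; x \<in> carrier R\<rbrakk> \<Longrightarrow> component n (c \<odot> x) = c \<odot> component n x"
    and component_odds: "x \<in> odds R \<Longrightarrow> component n x \<in> odds R"
    and component_component: "z \<in> carrier R \<Longrightarrow>
      component m (component n z) = (if m = n then component n z else \<zero>)"
proof -
  obtain \<iota> where "weighted_poly K p r s R \<iota>" using weighted_poly_ex by blast
  then interpret W: weighted_poly K p r s R \<iota> .
  note A = W.comm_superalgebra_A and c = W.const_superhom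
  have b: "(W.tpow q, W.tpow 2) \<in> Spec_B p r W.A" using W.scaled_point[of 1] by simp
  define \<theta> where "\<theta> = act W.A W.const (W.tpow q, W.tpow 2)"
  have \<theta>: "\<theta> \<in> superhom K R W.A" unfolding \<theta>_def by (rule act_superhom[OF A c b])
  note t = superhomD[OF \<theta>]
  have coef: "W.coef (\<theta> z) = (\<lambda>n. component n z)" if "z \<in> carrier R" for z
    using act_eq_evaluate[OF A c b that] W.evaluate_universal[OF component_poly[OF that]] component_poly[OF that]
    by (simp add: \<theta>_def)
  have coef': "component n z = W.coef (\<theta> z) n" if "z \<in> carrier R" for n z using coef[OF that] by simp
  show add: "component n (x \<oplus> y) = component n x \<oplus> component n y"
    if "x \<in> carrier R" "y \<in> carrier R" for n x y
    using that by (simp add: coef' t(3,4))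
  show "component n (x \<otimes> y) = (\<Oplus>i\<in>{..n}. component i x \<otimes> component (n - i) y)"
    if "x \<in> carrier R" "y \<in> carrier R"
    using that by (simp add: coef' t(3,5) W.coef_mult)
  show "component n \<one> = (if n = 0 then \<one> else \<zero>)"
    by (simp add: coef' t(6) W.coef_one)
  show "component n (c \<odot> x) = c \<odot> component n x" if "c \<in> carrier K" "x \<in> carrier R"
    using that by (simp add: coef' t(3,7))
  show "component n x \<in> odds R" if "x \<in> odds R"
    using that iffD1[OF W.A_odds_iff t(9)[OF that]] by (simp add: coef')
  show "component m (component n z) = (if m = n then component n z else \<zero>)" if z: "z \<in> carrier R"
  proof -
    have zero: "component m \<zero> = \<zero>" for m
      using add[of "\<zero>" "\<zero>" m] R.add.r_cancel_one[of "component m \<zero>"] by simp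
    define P where "P n = component n z" for n
    have P [simp]: "P n \<in> carrier R" for n using z by (simp add: P_def)
    have PX: "P \<in> W.X" using component_poly[OF z] by (simp add: P_def[abs_def])
    obtain N0 where N0: "\<And>n. n > N0 \<Longrightarrow> P n = \<zero>" using component_bound[OF z] P_def by auto
    have "\<forall>n. \<exists>M. \<forall>m>M. component m (P n) = \<zero>" using component_bound[OF P] by metis
    then obtain M where M: "\<And>n m. m > M n \<Longrightarrow> component m (P n) = \<zero>" by metis
    \<comment> \<open>A common bound for the components of \<open>z\<close> and for the components of these.\<close>
    define N where "N = N0 + (\<Sum>n\<le>N0. M n)"
    have N: "P n = \<zero>" if "n > N" for n using N0 that by (simp add: N_def)
    have N': "component m (P n) = \<zero>" if m: "m > N" for m n
    proof (cases "n \<le> N0")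
      case True
      then have "M n \<le> (\<Sum>n\<le>N0. M n)" by (intro member_le_sum) auto
      then show ?thesis using M m by (simp add: N_def)
    next
      case False then show ?thesis using N0 zero by simp
    qed
    \<comment> \<open>Exponents up to \<open>N\<close> are then digits in base \<open>k\<close>.\<close>
    define k where "k = N + 1"
    have main: "component m (P n) = (if m = n then P n else \<zero>)" if mn: "m \<le> N" "n \<le> N"
    proof -
      let ?b = "(W.tpow (k * q), W.tpow (2 * k))"
      let ?J = "m + k * n"
      note b' = W.scaled_point[of k]
      have bb: "(W.tpow q \<otimes>\<^bsub>W.A\<^esub> W.tpow (k * q), W.tpow 2 \<otimes>\<^bsub>W.A\<^esub> W.tpow (2 * k)) =
        (W.tpow ((k + 1) * q), W.tpow (2 * (k + 1)))"
      proof -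
        have "q \<in> S" "k * q \<in> S" "2 \<in> S" "2 * k \<in> S" using W.scaled_S[of 1] W.scaled_S[of k] by auto
        moreover have "q + k * q = (k + 1) * q" "2 + 2 * k = 2 * (k + 1)" by simp_all
        ultimately show ?thesis by (metis W.tpow_mult)
      qed
      have e: "act W.A \<theta> ?b z = act W.A W.const (W.tpow ((k + 1) * q), W.tpow (2 * (k + 1))) z"
        unfolding \<theta>_def act_act[OF A c b b'] bb ..
      have "W.coef (act W.A W.const (W.tpow ((k + 1) * q), W.tpow (2 * (k + 1))) z) ?J =
        (\<Oplus>i\<in>{..N}. if ?J = (k + 1) * i then P i else \<zero>)"
        unfolding act_eq_evaluate[OF A c W.scaled_point z] P_def[symmetric]
        by (rule W.coef_evaluate_scaled[OF PX]) (rule N)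
      also have "\<dots> = (\<Oplus>i\<in>{..N}. if n = i then (if m = n then P i else \<zero>) else \<zero>)"
      proof (intro R.finsum_cong' refl)
        fix i assume i: "i \<in> {..N}"
        have "?J = (k + 1) * i \<longleftrightarrow> n = i \<and> m = n"
        proof
          assume J: "?J = (k + 1) * i"
          then have J': "m + k * n = i + k * i" by simp
          have "m < k" "i < k" using mn i by (simp_all add: k_def)
          then have "(m + k * n) div k = n" "(i + k * i) div k = i" by simp_all
          then have "n = i" using J' by simp
          then show "n = i \<and> m = n" using J' by simp
        qed auto
        then show "(if ?J = (k + 1) * i then P i else \<zero>) =
          (if n = i then (if m = n then P i else \<zero>) else \<zero>)" by auto
      qed auto
      also have "\<dots> = (if m = n then P n else \<zero>)"
        by (rule R.finsum_singleton) (use mn in auto)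
      finally have rhs: "W.coef (act W.A W.const (W.tpow ((k + 1) * q), W.tpow (2 * (k + 1))) z) ?J =
        (if m = n then P n else \<zero>)" .
      have tc: "\<theta> (P i) \<in> carrier W.A" for i using t(3) by simp
      have "act W.A \<theta> ?b z = (\<Oplus>\<^bsub>W.A\<^esub>i\<in>{..N}. \<theta> (P i) \<otimes>\<^bsub>W.A\<^esub> weight_power W.A q ?b i)"
        unfolding act_eq_evaluate[OF A \<theta> b' z] P_def[symmetric]
        by (rule W.evaluate_bound[OF A \<theta> b' PX]) (rule N)
      then have "W.coef (act W.A \<theta> ?b z) ?J =
        (\<Oplus>i\<in>{..N}. W.coef (\<theta> (P i) \<otimes>\<^bsub>W.A\<^esub> weight_power W.A q ?b i) ?J)"
        using W.coef_finsum[of "\<lambda>i. \<theta> (P i) \<otimes>\<^bsub>W.A\<^esub> weight_power W.A q ?b i" "{..N}" ?J]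
          W.evaluate_term_closed[OF A \<theta> b' P] by simp
      also have "\<dots> = (\<Oplus>i\<in>{..N}. if n = i then component m (P i) else \<zero>)"
      proof (intro R.finsum_cong' refl)
        fix i
        show "W.coef (\<theta> (P i) \<otimes>\<^bsub>W.A\<^esub> weight_power W.A q ?b i) ?J = (if n = i then component m (P i) else \<zero>)"
        proof (cases "i \<in> S")
          case True
          note kS = W.mult_S[OF True, of k]
          have "W.coef (\<theta> (P i) \<otimes>\<^bsub>W.A\<^esub> weight_power W.A q ?b i) ?J =
              W.coef (W.tpow (k * i) \<otimes>\<^bsub>W.A\<^esub> \<theta> (P i)) ?J"
            using W.A.even_central[OF W.tpow_even[OF kS] tc] W.scaled_weight_power[OF True] by simp
          also have "\<dots> = (if k * i \<le> ?J then component (?J - k * i) (P i) else \<zero>)"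
            using W.coef_tpow_mult[OF kS tc] by (simp add: coef')
          also have "\<dots> = (if n = i then component m (P i) else \<zero>)"
          proof (rule linorder_cases[of i n])
            assume "i < n"
            then have "k * i + k \<le> k * n" by (metis Suc_leI add.commute mult_Suc_right mult_le_mono2)
            then have "?J - k * i > N" by (simp add: k_def)
            then show ?thesis using \<open>i < n\<close> N' by simp
          next
            assume "n < i"
            then have "k * n + k \<le> k * i" by (metis Suc_leI add.commute mult_Suc_right mult_le_mono2)
            then have "\<not> k * i \<le> ?J" using mn by (simp add: k_def)
            then show ?thesis using \<open>n < i\<close> by simp
          qed simp
          finally show ?thesis .
        next
          case False
          then have "P i = \<zero>" using component_outside[OF z] by (simp add: P_def)
          then show ?thesis
            using W.poly.weight_power_evens[OF b', of i] zero
              superhom_zero[OF R.superalgebra_axioms W.A.superalgebra_axioms \<theta>] by simp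
        qed
      qed simp
      also have "\<dots> = component m (P n)"
        by (rule R.finsum_singleton) (use mn in auto)
      finally show ?thesis using rhs e by simp
    qed
    show ?thesis
      unfolding P_def[symmetric] using main N N' zero by (cases "m \<le> N"; cases "n \<le> N") auto
  qed
qed

lemma component_zero: "component n \<zero> = \<zero>"
  using component_add[of "\<zero>" "\<zero>" n] R.add.r_cancel_one[of "component n \<zero>"] by simp

text \<open>
  The neutral point \<open>(1, 1)\<close> acts trivially, and all its powers are \<open>1\<close>.
\<close>

lemma component_sum:
  assumes z: "z \<in> carrier R" and N: "\<And>n. n > N \<Longrightarrow> component n z = \<zero>"
  shows "(\<Oplus>n\<in>{..N}. component n z) = z"
proof -
  obtain \<iota> where "weighted_poly K p r s R \<iota>" using weighted_poly_ex by blast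
  then interpret W: weighted_poly K p r s R \<iota> .
  interpret RR: odd_char_superalgebra K R p r s by (rule odd_char_superalgebra[OF R_comm])
  have "z = evaluate R R q (\<lambda>x\<in>carrier R. x) (\<one>, \<one>) (\<lambda>n. component n z)"
    using act_eq_evaluate[OF R_comm R_id RR.Spec_B_one z] act_one[OF R_comm R_id] z by simp
  also have "\<dots> = (\<Oplus>n\<in>{..N}. (\<lambda>x\<in>carrier R. x) (component n z) \<otimes> weight_power R q (\<one>, \<one>) n)"
    by (rule W.evaluate_bound[OF R_comm R_id RR.Spec_B_one component_poly[OF z]]) (rule N)
  also have "\<dots> = (\<Oplus>n\<in>{..N}. component n z)"
    using z by (simp add: RR.weight_power_one)
  finally show ?thesis ..
qed

text \<open>
  The point \<open>(0, 0)\<close> acts by projection to the component of degree zero, because all its powers with positive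
  exponent in the weight set vanish. On the other hand it moves every point to the trivial homomorphism, and the homomorphism
  from \<open>R\<close> that represents the trivial one factors through \<open>k\<close>.
\<close>

lemma augmentation:
  "\<exists>\<epsilon>\<in>superhom K R (scalars K). \<forall>z\<in>carrier R. component 0 z = \<epsilon> z \<odot> \<one>"
proof -
  have sc: "comm_superalgebra K (scalars K)" by (rule comm_superalgebra_scalars) (rule R.R.is_cring)
  obtain \<epsilon> where \<epsilon>: "\<epsilon> \<in> superhom K R (scalars K)" "rep (scalars K) \<epsilon> = trivial_hom G (scalars K)"
    using trivial_hom_closed[OF group_functor, of "scalars K"] rep_bij[OF sc] unfolding bij_betw_def by (metis imageE)
  let ?u = "\<lambda>c\<in>carrier K. c \<odot> \<one>"
  have u: "?u \<in> superhom K (scalars K) R"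
    by (rule superhomI)
      (use R.submoduleE(4)[OF R.evens_submodule] R.one_even in
        \<open>auto simp: R.smult_l_distr R.smult_mult_left R.smult_assoc1 [symmetric]\<close>)
  interpret RR: odd_char_superalgebra K R p r s by (rule odd_char_superalgebra[OF R_comm])
  obtain \<iota> where "weighted_poly K p r s R \<iota>" using weighted_poly_ex by blast
  then interpret W: weighted_poly K p r s R \<iota> .
  have "act R (\<lambda>x\<in>carrier R. x) (\<zero>, \<zero>) = compose (carrier R) ?u \<epsilon>"
  proof (rule rep_inj[OF R_comm act_superhom[OF R_comm R_id RR.Spec_B_zero]])
    show "compose (carrier R) ?u \<epsilon> \<in> superhom K R R"
      by (rule superhom_compose[OF R.superalgebra_axioms \<epsilon>(1) u])
    show "rep R (act R (\<lambda>x\<in>carrier R. x) (\<zero>, \<zero>)) = rep R (compose (carrier R) ?u \<epsilon>)"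
      using rep_act[OF R_comm R_id RR.Spec_B_zero] right_action_zero[OF group_functor R_comm rep_closed[OF R_comm R_id]]
        rep_natural[OF sc R_comm u \<epsilon>(1)] base_change_trivial_hom[OF sc u, of G] by (simp add: \<epsilon>(2))
  qed
  then have 0: "act R (\<lambda>x\<in>carrier R. x) (\<zero>, \<zero>) z = \<epsilon> z \<odot> \<one>" if "z \<in> carrier R" for z
    using that superhomD(3)[OF \<epsilon>(1) that] by (simp add: compose_def)
  have "component 0 z = \<epsilon> z \<odot> \<one>" if z: "z \<in> carrier R" for z
  proof -
    obtain N where N: "\<And>n. n > N \<Longrightarrow> component n z = \<zero>" using component_bound[OF z] by blast
    have "\<epsilon> z \<odot> \<one> =
      (\<Oplus>n\<in>{..N}. (\<lambda>x\<in>carrier R. x) (component n z) \<otimes> weight_power R q (\<zero>, \<zero>) n)"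
      unfolding 0[OF z, symmetric] act_eq_evaluate[OF R_comm R_id RR.Spec_B_zero z]
      by (rule W.evaluate_bound[OF R_comm R_id RR.Spec_B_zero component_poly[OF z]]) (rule N)
    also have "\<dots> = (\<Oplus>n\<in>{..N}. if 0 = n then component n z else \<zero>)"
    proof (intro R.finsum_cong' refl)
      fix n
      show "(\<lambda>x\<in>carrier R. x) (component n z) \<otimes> weight_power R q (\<zero>, \<zero>) n =
        (if 0 = n then component n z else \<zero>)"
        using z RR.weight_power_at_zero[of n] component_outside[OF z, of n]
          RR.weight_power_evens[OF RR.Spec_B_zero, of n] by (cases "n \<in> S") auto
    qed (use z in auto)
    also have "\<dots> = component 0 z" by (rule R.finsum_singleton) (use z in auto)
    finally show ?thesis ..
  qed
  then show ?thesis using \<epsilon>(1) by blast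
qed

end

section \<open>The quotient by the odd ideal\<close>

locale odd_quotient = comm_superalgebra K R
  for K :: "'u ring" and R :: "('u, 'u) superalg" (structure)
begin

abbreviation "I \<equiv> odd_ideal R"
abbreviation "V \<equiv> V_algebra R"

definition cls :: "'u \<Rightarrow> 'u set" where "cls z = I +> z"

lemma odds_subset: "odds R \<subseteq> carrier R" by auto

lemma ideal_odd_ideal: "ideal I R"
  unfolding odd_ideal_def by (rule genideal_ideal[OF odds_subset])

sublocale I: ideal I R by (rule ideal_odd_ideal)

lemma I_closed [simp]: "x \<in> I \<Longrightarrow> x \<in> carrier R"
  using I.a_subset by auto

lemma odds_I: "odds R \<subseteq> I"
  unfolding odd_ideal_def by (rule genideal_self[OF odds_subset])

lemma I_minimal: "\<lbrakk>ideal J R; odds R \<subseteq> J\<rbrakk> \<Longrightarrow> I \<subseteq> J"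
  unfolding odd_ideal_def by (rule genideal_minimal)

lemma I_smult:
  assumes "c \<in> carrier K" "x \<in> I"
  shows "c \<odot> x \<in> I"
proof -
  have "(c \<odot> \<one>) \<otimes> x \<in> I" using assms by (intro I.I_l_closed) auto
  then show ?thesis using assms by (simp add: smult_mult_left)
qed

lemma V_simps:
  "carrier V = a_rcosets I" "monoid.mult V = rcoset_mult R I" "one V = cls \<one>" "zero V = I"
  "add V = set_add R" "smult V = (\<lambda>c X. \<Union>z\<in>X. cls (c \<odot> z))"
  by (simp_all add: V_algebra_def ring.extend_def module.fields_def FactRing_def cls_def)

lemma V_carrier: "carrier V = cls ` carrier R"
  by (auto simp: V_simps cls_def A_RCOSETS_def' )

lemma cls_closed [simp]: "x \<in> carrier R \<Longrightarrow> cls x \<in> carrier V"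
  by (simp add: V_carrier)

lemma V_obtain:
  assumes "X \<in> carrier V" obtains x where "x \<in> carrier R" "X = cls x"
  using assms by (auto simp: V_carrier)

lemma cls_add [simp]: "\<lbrakk>x \<in> carrier R; y \<in> carrier R\<rbrakk> \<Longrightarrow> cls x \<oplus>\<^bsub>V\<^esub> cls y = cls (x \<oplus> y)"
  by (simp add: V_simps cls_def I.a_rcos_sum)

lemma cls_mult [simp]: "\<lbrakk>x \<in> carrier R; y \<in> carrier R\<rbrakk> \<Longrightarrow> cls x \<otimes>\<^bsub>V\<^esub> cls y = cls (x \<otimes> y)"
  by (simp add: V_simps cls_def I.rcoset_mult_add)

lemma cls_one: "\<one>\<^bsub>V\<^esub> = cls \<one>" by (simp add: V_simps)

lemma cls_eq_iff: "\<lbrakk>x \<in> carrier R; y \<in> carrier R\<rbrakk> \<Longrightarrow> cls x = cls y \<longleftrightarrow> x \<ominus> y \<in> I"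
  using I.a_rcos_module_minus[OF ring_axioms, of y x] a_repr_independence[OF _ _ I.a_subgroup, of x y]
    I.a_rcos_self[of x] unfolding cls_def by metis

lemma cls_zero: "\<zero>\<^bsub>V\<^esub> = cls \<zero>"
  using a_coset_add_zero[OF I.a_subset] by (simp add: V_simps cls_def)

lemma cls_eq_zero_iff: "x \<in> carrier R \<Longrightarrow> cls x = \<zero>\<^bsub>V\<^esub> \<longleftrightarrow> x \<in> I"
  by (simp add: cls_zero cls_eq_iff minus_eq)

lemma cls_self: "x \<in> carrier R \<Longrightarrow> x \<in> cls x"
  unfolding cls_def by (rule I.a_rcos_self)

lemma mem_cls: "\<lbrakk>x \<in> carrier R; z \<in> cls x\<rbrakk> \<Longrightarrow> z \<in> carrier R \<and> cls z = cls x"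
  using I.a_elemrcos_carrier[of x z] a_repr_independence[OF _ _ I.a_subgroup, of z x]
  unfolding cls_def by simp

lemma cls_smult [simp]:
  assumes c: "c \<in> carrier K" and x: "x \<in> carrier R"
  shows "c \<odot>\<^bsub>V\<^esub> cls x = cls (c \<odot> x)"
proof -
  have "cls (c \<odot> z) = cls (c \<odot> x)" if "z \<in> cls x" for z
  proof -
    have z: "z \<in> carrier R" "z \<ominus> x \<in> I" using mem_cls[OF x that] x cls_eq_iff by auto
    have "c \<odot> z \<ominus> c \<odot> x = c \<odot> (z \<ominus> x)" using c x z by (simp add: minus_eq smult_r_distr smult_r_minus)
    then show ?thesis using c x z I_smult[OF c z(2)] by (simp add: cls_eq_iff)
  qed
  then have "(\<Union>z\<in>cls x. cls (c \<odot> z)) = (\<Union>z\<in>cls x. cls (c \<odot> x))" by (intro SUP_cong refl)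
  also have "\<dots> = cls (c \<odot> x)" using cls_self[OF x] by blast
  finally show ?thesis by (simp only: V_simps)
qed

lemma cls_odd: "x \<in> odds R \<Longrightarrow> cls x = \<zero>\<^bsub>V\<^esub>"
  using odds_I by (auto simp: cls_eq_zero_iff)

text \<open>
  The quotient is commutative because every class contains an even element, and even elements are central.
\<close>

lemma V_algebra: "algebra K V"
proof (rule algebraI)
  have V_cases: "\<exists>x\<in>carrier R. X = cls x" if "X \<in> carrier V" for X using that by (auto simp: V_carrier)
  show "cring K" by (rule R.is_cring)
  show "cring V"
  proof (rule cringI)
    show "abelian_group V"
    proof (rule abelian_groupI)
      fix X assume "X \<in> carrier V"
      then obtain x where x: "x \<in> carrier R" "X = cls x" by (rule V_obtain)
      then show "\<zero>\<^bsub>V\<^esub> \<oplus>\<^bsub>V\<^esub> X = X" by (simp add: cls_zero)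
      have "cls (\<ominus> x) \<in> carrier V" "cls (\<ominus> x) \<oplus>\<^bsub>V\<^esub> X = \<zero>\<^bsub>V\<^esub>"
        using x by (simp_all add: cls_zero l_neg)
      then show "\<exists>Y\<in>carrier V. Y \<oplus>\<^bsub>V\<^esub> X = \<zero>\<^bsub>V\<^esub>" by blast
    next
      fix X Y assume "X \<in> carrier V" "Y \<in> carrier V"
      then obtain x y where x: "x \<in> carrier R" "X = cls x" and y: "y \<in> carrier R" "Y = cls y"
        using V_cases by metis
      show "X \<oplus>\<^bsub>V\<^esub> Y \<in> carrier V" using x y by simp
      show "X \<oplus>\<^bsub>V\<^esub> Y = Y \<oplus>\<^bsub>V\<^esub> X" using x y a_comm[OF x(1) y(1)] by simp
    next
      fix X Y Z assume "X \<in> carrier V" "Y \<in> carrier V" "Z \<in> carrier V"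
      then obtain x y z where xyz: "x \<in> carrier R" "y \<in> carrier R" "z \<in> carrier R"
        and e: "X = cls x" "Y = cls y" "Z = cls z"
        using V_cases by metis
      show "X \<oplus>\<^bsub>V\<^esub> Y \<oplus>\<^bsub>V\<^esub> Z = X \<oplus>\<^bsub>V\<^esub> (Y \<oplus>\<^bsub>V\<^esub> Z)"
        unfolding e using xyz a_assoc[OF xyz] by simp
    qed (simp add: cls_zero)
    show "comm_monoid V"
    proof (rule comm_monoidI)
      fix X Y assume "X \<in> carrier V" "Y \<in> carrier V"
      then obtain x y where x: "x \<in> carrier R" "X = cls x" and y: "y \<in> carrier R" "Y = cls y"
        using V_cases by metis
      show "X \<otimes>\<^bsub>V\<^esub> Y \<in> carrier V" using x y by simp
      obtain e w where w: "e \<in> evens R" "w \<in> odds R" "x = e \<oplus> w" using parity_obtain[OF x(1)] .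
      have "cls e \<oplus>\<^bsub>V\<^esub> cls w = cls e \<oplus>\<^bsub>V\<^esub> cls \<zero>" using cls_odd[OF w(2)] cls_zero by simp
      then have "X = cls e" using w x by simp
      then show "X \<otimes>\<^bsub>V\<^esub> Y = Y \<otimes>\<^bsub>V\<^esub> X" using y w even_central[OF w(1) y(1)] by simp
    next
      fix X Y Z assume "X \<in> carrier V" "Y \<in> carrier V" "Z \<in> carrier V"
      then obtain x y z where xyz: "x \<in> carrier R" "y \<in> carrier R" "z \<in> carrier R"
        and e: "X = cls x" "Y = cls y" "Z = cls z"
        using V_cases by metis
      show "X \<otimes>\<^bsub>V\<^esub> Y \<otimes>\<^bsub>V\<^esub> Z = X \<otimes>\<^bsub>V\<^esub> (Y \<otimes>\<^bsub>V\<^esub> Z)"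
        unfolding e using xyz m_assoc[OF xyz] by simp
    next
      fix X assume "X \<in> carrier V"
      then show "\<one>\<^bsub>V\<^esub> \<otimes>\<^bsub>V\<^esub> X = X" by (rule V_obtain) (simp add: cls_one)
    qed (simp add: cls_one)
    fix X Y Z assume "X \<in> carrier V" "Y \<in> carrier V" "Z \<in> carrier V"
    then obtain x y z where xyz: "x \<in> carrier R" "y \<in> carrier R" "z \<in> carrier R"
      and e: "X = cls x" "Y = cls y" "Z = cls z"
      using V_cases by metis
    show "(X \<oplus>\<^bsub>V\<^esub> Y) \<otimes>\<^bsub>V\<^esub> Z = X \<otimes>\<^bsub>V\<^esub> Z \<oplus>\<^bsub>V\<^esub> Y \<otimes>\<^bsub>V\<^esub> Z"
      unfolding e using xyz l_distr[OF xyz] by simp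
  qed
  show "\<one>\<^bsub>K\<^esub> \<odot>\<^bsub>V\<^esub> X = X" if "X \<in> carrier V" for X
    using V_cases[OF that] by auto
  fix c X assume c: "c \<in> carrier K" and "X \<in> carrier V"
  then obtain x where x: "x \<in> carrier R" "X = cls x" using V_cases by metis
  show "c \<odot>\<^bsub>V\<^esub> X \<in> carrier V" using c x by simp
  show "(c \<oplus>\<^bsub>K\<^esub> d) \<odot>\<^bsub>V\<^esub> X = c \<odot>\<^bsub>V\<^esub> X \<oplus>\<^bsub>V\<^esub> d \<odot>\<^bsub>V\<^esub> X" if "d \<in> carrier K" for d
    using c x that by (simp add: smult_l_distr)
  show "(c \<otimes>\<^bsub>K\<^esub> d) \<odot>\<^bsub>V\<^esub> X = c \<odot>\<^bsub>V\<^esub> (d \<odot>\<^bsub>V\<^esub> X)" if "d \<in> carrier K" for d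
    using c x that by (simp add: smult_assoc1)
  fix Y assume "Y \<in> carrier V"
  then obtain y where y: "y \<in> carrier R" "Y = cls y" using V_cases by metis
  show "c \<odot>\<^bsub>V\<^esub> (X \<oplus>\<^bsub>V\<^esub> Y) = c \<odot>\<^bsub>V\<^esub> X \<oplus>\<^bsub>V\<^esub> c \<odot>\<^bsub>V\<^esub> Y"
    using c x y by (simp add: smult_r_distr)
  show "(c \<odot>\<^bsub>V\<^esub> X) \<otimes>\<^bsub>V\<^esub> Y = c \<odot>\<^bsub>V\<^esub> (X \<otimes>\<^bsub>V\<^esub> Y)"
    using c x y by (simp add: smult_mult_left)
qed

sublocale V: algebra K V by (rule V_algebra)

lemma cls_finsum:
  assumes "f \<in> J \<rightarrow> carrier R"
  shows "cls (\<Oplus>i\<in>J. f i) = (\<Oplus>\<^bsub>V\<^esub>i\<in>J. cls (f i))"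
  by (rule finsum_additive[OF abelian_monoid_axioms V.M.abelian_monoid_axioms]) (use assms in \<open>auto simp: cls_zero\<close>)

end

section \<open>The grading of k[V] and its degree zero part\<close>

context Hom_representation
begin

sublocale Q: odd_quotient K R by unfold_locales

lemma component_neg:
  assumes "x \<in> carrier R"
  shows "component n (\<ominus> x) = \<ominus> component n x"
proof -
  have "component n (\<ominus> x) \<oplus> component n x = \<zero>"
    using component_add[of "\<ominus> x" x n] assms by (simp add: R.l_neg component_zero)
  then show ?thesis using assms by (intro R.minus_equality[symmetric]) auto
qed

lemma I_finsum: "f \<in> J \<rightarrow> Q.I \<Longrightarrow> (\<Oplus>i\<in>J. f i) \<in> Q.I"
  by (rule R.finsum_closed_under_add) (auto simp: Q.I.a_closed)

text \<open>
  The elements whose components all lie in the odd ideal form an ideal that contains the odd elements.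
\<close>

lemma component_I:
  assumes "z \<in> Q.I"
  shows "component n z \<in> Q.I"
proof -
  let ?J = "{z \<in> carrier R. \<forall>n. component n z \<in> Q.I}"
  have "ideal ?J R"
  proof (rule idealI[OF R.ring_axioms])
    show "subgroup ?J (add_monoid R)"
    proof (rule subgroup.intro)
      fix x assume "x \<in> ?J"
      then have x: "x \<in> carrier R" "\<And>n. component n x \<in> Q.I" by auto
      have "inv\<^bsub>add_monoid R\<^esub> x = \<ominus> x" by (simp add: a_inv_def)
      moreover have "\<ominus> x \<in> ?J" using x by (simp add: component_neg Q.I.a_inv_closed)
      ultimately show "inv\<^bsub>add_monoid R\<^esub> x \<in> ?J" by simp
    qed (auto simp: component_zero component_add Q.I.a_closed)
    fix a x assume "a \<in> ?J" and x: "x \<in> carrier R"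
    then have a: "a \<in> carrier R" "\<And>n. component n a \<in> Q.I" by auto
    show "x \<otimes> a \<in> ?J"
      using a x by (auto simp: component_mult intro!: I_finsum Q.I.I_l_closed)
    show "a \<otimes> x \<in> ?J"
      using a x by (auto simp: component_mult intro!: I_finsum Q.I.I_r_closed)
  qed
  moreover have "odds R \<subseteq> ?J" using component_odds Q.odds_I by auto
  ultimately show ?thesis using Q.I_minimal[of ?J] assms by blast
qed

definition degree_of :: "nat \<Rightarrow> rat" where
  "degree_of n = of_nat n / 2"

lemma degree_of_eq_iff [simp]: "degree_of m = degree_of n \<longleftrightarrow> m = n"
  by (simp add: degree_of_def)

definition index_of :: "rat \<Rightarrow> nat" where
  "index_of d = nat \<lfloor>2 * d\<rfloor>"

lemma index_of_degree_of [simp]: "index_of (degree_of n) = n"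
  by (simp add: index_of_def degree_of_def)

lemma degree_of_add: "degree_of (m + n) = degree_of m + degree_of n"
  by (simp add: degree_of_def add_divide_distrib)

lemma degree_of_S:
  assumes "n \<in> S" shows "degree_of n \<in> degree_group p r"
proof (cases "even n")
  case True
  then obtain i where "n = 2 * i" by (rule evenE)
  then have "degree_of n = of_int (int i) + of_int 0 * (of_nat (p ^ r) / 2)" by (simp add: degree_of_def)
  then show ?thesis unfolding degree_group_def by blast
next
  case False
  then have "even (n - q)" "q \<le> n" using assms odd_q by (auto simp: weight_set_def)
  then obtain i where "n - q = 2 * i" by (elim evenE)
  then have "n = 2 * i + q" using \<open>q \<le> n\<close> by simp
  then have "degree_of n = of_int (int i) + of_int 1 * (of_nat (p ^ r) / 2)"
    by (simp add: degree_of_def add_divide_distrib)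
  then show ?thesis unfolding degree_group_def by blast
qed

abbreviation "C \<equiv> V_component K p r s R rep"

lemma Hom_component_eq:
  "Hom_component K p r s R rep d = {component n z | n z. z \<in> carrier R \<and> d = degree_of n} \<union> {\<zero>}"
proof -
  have "x \<in> Hom_component K p r s R rep d"
    if "x = component n z" "z \<in> carrier R" "d = degree_of n" for n z x
  proof (cases "n \<in> S")
    case True
    interpret RR: odd_char_superalgebra K R p r s by (rule odd_char_superalgebra[OF R_comm])
    show ?thesis
    proof (rule RR.weight_set_cases[OF True])
      fix i assume "n = 2 * i"
      then have "x = phi K p r s R rep i z" "d = of_nat i"
        using that by (simp_all only: component_even) (simp add: degree_of_def)
      then show ?thesis using that(2) unfolding Hom_component_def by blast
    next
      fix i assume "n = 2 * i + q"
      then have "x = psi K p r s R rep i z" "d = of_nat i + of_nat (p ^ r) / 2"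
        using that by (simp_all only: component_odd) (simp add: degree_of_def add_divide_distrib)
      then show ?thesis using that(2) unfolding Hom_component_def by blast
    qed
  next
    case False
    then show ?thesis using that component_outside by (simp add: Hom_component_def)
  qed
  moreover have "(\<exists>n. phi K p r s R rep i z = component n z \<and> of_nat i = degree_of n)" for i z
    by (rule exI[of _ "2 * i"]) (simp add: component_even degree_of_def)
  moreover have "(\<exists>n. psi K p r s R rep i z = component n z \<and> of_nat i + of_nat (p ^ r) / 2 = degree_of n)" for i z
    by (rule exI[of _ "2 * i + q"]) (simp only: component_odd, simp add: degree_of_def add_divide_distrib)
  ultimately show ?thesis
    by (auto simp: Hom_component_def) blast+
qed

lemma C_eq: "C d = {Q.cls (component n z) | n z. z \<in> carrier R \<and> d = degree_of n} \<union> {\<zero>\<^bsub>Q.V\<^esub>}"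
  unfolding V_component_def Hom_component_eq Q.cls_zero Q.cls_def[symmetric] by (auto simp: image_Un)

lemma C_degree_of: "C (degree_of n) = (\<lambda>z. Q.cls (component n z)) ` carrier R"
proof -
  have "\<zero>\<^bsub>Q.V\<^esub> = Q.cls (component n \<zero>)" by (simp add: component_zero Q.cls_zero)
  then show ?thesis unfolding C_eq by auto
qed

lemma C_other: "(\<And>n. d \<noteq> degree_of n) \<Longrightarrow> C d = {\<zero>\<^bsub>Q.V\<^esub>}"
  unfolding C_eq by auto

lemma C_cases:
  obtains n where "d = degree_of n" "C d = (\<lambda>z. Q.cls (component n z)) ` carrier R"
  | "\<And>n. d \<noteq> degree_of n" "C d = {\<zero>\<^bsub>Q.V\<^esub>}"
  using C_degree_of C_other by metis

lemma C_subset: "C d \<subseteq> carrier Q.V"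
  by (rule C_cases[of d]) auto

lemma C_submodule: "submodule (C d) K Q.V"
proof (rule C_cases[of d])
  fix n assume C: "C d = (\<lambda>z. Q.cls (component n z)) ` carrier R"
  show ?thesis unfolding C
  proof (rule Q.V.submoduleI)
    show "(\<lambda>z. Q.cls (component n z)) ` carrier R \<subseteq> carrier Q.V" by auto
    show "\<zero>\<^bsub>Q.V\<^esub> \<in> (\<lambda>z. Q.cls (component n z)) ` carrier R"
      by (rule image_eqI[of _ _ "\<zero>"]) (simp_all add: component_zero Q.cls_zero)
  next
    fix X assume "X \<in> (\<lambda>z. Q.cls (component n z)) ` carrier R"
    then obtain z where z: "z \<in> carrier R" "X = Q.cls (component n z)" by auto
    have "Q.cls (component n (\<ominus> z)) \<oplus>\<^bsub>Q.V\<^esub> X = \<zero>\<^bsub>Q.V\<^esub>"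
      using z by (simp add: component_neg R.l_neg Q.cls_zero)
    then have "\<ominus>\<^bsub>Q.V\<^esub> X = Q.cls (component n (\<ominus> z))"
      using z by (intro Q.V.minus_equality) auto
    then show "\<ominus>\<^bsub>Q.V\<^esub> X \<in> (\<lambda>z. Q.cls (component n z)) ` carrier R" using z(1) by auto
  next
    fix X Y assume "X \<in> (\<lambda>z. Q.cls (component n z)) ` carrier R" "Y \<in> (\<lambda>z. Q.cls (component n z)) ` carrier R"
    then obtain x y where "x \<in> carrier R" "y \<in> carrier R" "X = Q.cls (component n x)" "Y = Q.cls (component n y)" by auto
    then have "X \<oplus>\<^bsub>Q.V\<^esub> Y = Q.cls (component n (x \<oplus> y))" "x \<oplus> y \<in> carrier R"
      by (simp_all add: component_add)
    then show "X \<oplus>\<^bsub>Q.V\<^esub> Y \<in> (\<lambda>z. Q.cls (component n z)) ` carrier R" by blast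
  next
    fix c X assume c: "c \<in> carrier K" and "X \<in> (\<lambda>z. Q.cls (component n z)) ` carrier R"
    then obtain z where z: "z \<in> carrier R" "X = Q.cls (component n z)" by auto
    then have "c \<odot>\<^bsub>Q.V\<^esub> X = Q.cls (component n (c \<odot> z))" "c \<odot> z \<in> carrier R"
      using c by (simp_all add: component_smult)
    then show "c \<odot>\<^bsub>Q.V\<^esub> X \<in> (\<lambda>z. Q.cls (component n z)) ` carrier R" by blast
  qed
next
  assume C: "C d = {\<zero>\<^bsub>Q.V\<^esub>}"
  show ?thesis unfolding C by (rule Q.V.submoduleI) auto
qed

text \<open>
  The choice of a representative does not matter, because the odd ideal is homogeneous.
\<close>

definition projection :: "nat \<Rightarrow> 'u set \<Rightarrow> 'u set" where
  "projection n X = Q.cls (component n (SOME z. z \<in> carrier R \<and> X = Q.cls z))"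

lemma projection_cls:
  assumes z: "z \<in> carrier R"
  shows "projection n (Q.cls z) = Q.cls (component n z)"
proof -
  let ?w = "SOME w. w \<in> carrier R \<and> Q.cls z = Q.cls w"
  have w: "?w \<in> carrier R \<and> Q.cls z = Q.cls ?w" by (rule someI[of _ z]) (use z in simp)
  then have "?w \<ominus> z \<in> Q.I" using z Q.cls_eq_iff[of ?w z] by simp
  from component_I[OF this, of n] have "component n ?w \<ominus> component n z \<in> Q.I"
    using z w by (simp add: R.minus_eq component_add component_neg)
  then show ?thesis unfolding projection_def using z w by (simp add: Q.cls_eq_iff)
qed

lemma projection_closed: "X \<in> carrier Q.V \<Longrightarrow> projection n X \<in> carrier Q.V"
  by (rule Q.V_obtain) (auto simp: projection_cls)

lemma projection_finsum:
  assumes "f \<in> J \<rightarrow> carrier Q.V"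
  shows "projection n (\<Oplus>\<^bsub>Q.V\<^esub>i\<in>J. f i) = (\<Oplus>\<^bsub>Q.V\<^esub>i\<in>J. projection n (f i))"
proof (rule finsum_additive[OF Q.V.M.abelian_monoid_axioms Q.V.M.abelian_monoid_axioms])
  fix X Y assume "X \<in> carrier Q.V" "Y \<in> carrier Q.V"
  then obtain x y where "x \<in> carrier R" "X = Q.cls x" "y \<in> carrier R" "Y = Q.cls y"
    by (metis Q.V_obtain)
  then show "projection n (X \<oplus>\<^bsub>Q.V\<^esub> Y) = projection n X \<oplus>\<^bsub>Q.V\<^esub> projection n Y"
    by (simp add: projection_cls component_add)
next
  show "projection n \<zero>\<^bsub>Q.V\<^esub> = \<zero>\<^bsub>Q.V\<^esub>" by (simp add: Q.cls_zero projection_cls component_zero)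
qed (use assms projection_closed in auto)

lemma projection_C:
  assumes "X \<in> C d"
  shows "projection n X = (if d = degree_of n then X else \<zero>\<^bsub>Q.V\<^esub>)"
proof (rule C_cases[of d])
  fix m assume "d = degree_of m" "C d = (\<lambda>z. Q.cls (component m z)) ` carrier R"
  moreover then obtain z where "z \<in> carrier R" "X = Q.cls (component m z)" using assms by auto
  ultimately show ?thesis by (auto simp: projection_cls component_component Q.cls_zero)
next
  assume "\<And>m. d \<noteq> degree_of m" "C d = {\<zero>\<^bsub>Q.V\<^esub>}"
  then show ?thesis using assms by (simp add: Q.cls_zero projection_cls component_zero)
qed

abbreviation "D \<equiv> degree_group p r"

text \<open>
  Applying the projections to a decomposition recovers its summands.
\<close>

lemma decomposition_unique:
  assumes w: "w \<in> (\<Pi>\<^sub>E d\<in>D. C d)" and fin: "finite {d \<in> D. w d \<noteq> \<zero>\<^bsub>Q.V\<^esub>}"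
    and X: "X = (\<Oplus>\<^bsub>Q.V\<^esub>d\<in>{d \<in> D. w d \<noteq> \<zero>\<^bsub>Q.V\<^esub>}. w d)"
  shows "w = (\<lambda>d\<in>D. if \<exists>n. d = degree_of n then projection (index_of d) X else \<zero>\<^bsub>Q.V\<^esub>)"
proof
  fix d
  let ?T = "{d \<in> D. w d \<noteq> \<zero>\<^bsub>Q.V\<^esub>}"
  have wC: "w d \<in> C d" if "d \<in> D" for d using w that by auto
  show "w d = (\<lambda>d\<in>D. if \<exists>n. d = degree_of n then projection (index_of d) X else \<zero>\<^bsub>Q.V\<^esub>) d"
  proof (cases "d \<in> D")
    case d: True
    show ?thesis
    proof (cases "\<exists>n. d = degree_of n")
      case True
      then obtain n where n: "d = degree_of n" by blast
      have "projection n X = (\<Oplus>\<^bsub>Q.V\<^esub>e\<in>?T. projection n (w e))"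
        unfolding X using wC C_subset by (intro projection_finsum) auto
      also have "\<dots> = (\<Oplus>\<^bsub>Q.V\<^esub>e\<in>?T. if d = e then w e else \<zero>\<^bsub>Q.V\<^esub>)"
      proof (intro Q.V.finsum_cong' refl funcsetI)
        fix e assume e: "e \<in> ?T"
        then have "w e \<in> C e" using wC by simp
        then show "(if d = e then w e else \<zero>\<^bsub>Q.V\<^esub>) \<in> carrier Q.V"
          "projection n (w e) = (if d = e then w e else \<zero>\<^bsub>Q.V\<^esub>)"
          using C_subset projection_C[of "w e" e n] n by auto
      qed
      also have "\<dots> = w d"
      proof (cases "d \<in> ?T")
        case True
        then show ?thesis
          using wC C_subset fin by (intro Q.V.finsum_singleton) auto
      next
        case False
        then have "(\<Oplus>\<^bsub>Q.V\<^esub>e\<in>?T. if d = e then w e else \<zero>\<^bsub>Q.V\<^esub>) = \<zero>\<^bsub>Q.V\<^esub>"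
          by (intro Q.V.add.finprod_one_eqI) auto
        then show ?thesis using False d by simp
      qed
      finally show ?thesis using d n by simp
    next
      case False
      then have "C d = {\<zero>\<^bsub>Q.V\<^esub>}" by (intro C_other) auto
      then show ?thesis using wC[OF d] d False by auto
    qed
  next
    case False
    then show ?thesis using PiE_arb[OF w] by simp
  qed
qed

lemma decomposition_exists:
  assumes "X \<in> carrier Q.V"
  shows "\<exists>w. w \<in> (\<Pi>\<^sub>E d\<in>D. C d) \<and> finite {d \<in> D. w d \<noteq> \<zero>\<^bsub>Q.V\<^esub>} \<and>
    X = (\<Oplus>\<^bsub>Q.V\<^esub>d\<in>{d \<in> D. w d \<noteq> \<zero>\<^bsub>Q.V\<^esub>}. w d)"
proof -
  obtain z where z: "z \<in> carrier R" "X = Q.cls z" using assms by (rule Q.V_obtain)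
  obtain N where N: "\<And>n. n > N \<Longrightarrow> component n z = \<zero>" using component_bound[OF z(1)] by blast
  define w where "w = (\<lambda>d\<in>D. if \<exists>n. d = degree_of n then Q.cls (component (index_of d) z) else \<zero>\<^bsub>Q.V\<^esub>)"
  have wd: "w (degree_of n) = Q.cls (component n z)" if "degree_of n \<in> D" for n
    using that by (auto simp: w_def)
  have wdeg: "w (degree_of n) = Q.cls (component n z)" if "n \<in> S" for n
    by (rule wd[OF degree_of_S[OF that]])
  let ?T = "{d \<in> D. w d \<noteq> \<zero>\<^bsub>Q.V\<^esub>}" and ?N = "{n. n \<le> N \<and> n \<in> S}"
  have wC: "w \<in> (\<Pi>\<^sub>E d\<in>D. C d)"
  proof (rule PiE_I)
    fix d assume d: "d \<in> D"
    show "w d \<in> C d"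
      by (rule C_cases[of d]) (use d z in \<open>auto simp: w_def\<close>)
  qed (simp add: w_def)
  have T: "?T \<subseteq> degree_of ` ?N"
  proof
    fix d assume d: "d \<in> ?T"
    then obtain n where n: "d = degree_of n" by (auto simp: w_def split: if_splits)
    then have "degree_of n \<in> D" "w (degree_of n) \<noteq> \<zero>\<^bsub>Q.V\<^esub>" using d by auto
    then have "Q.cls (component n z) \<noteq> \<zero>\<^bsub>Q.V\<^esub>" using wd by metis
    then have "component n z \<noteq> \<zero>" by (auto simp: Q.cls_zero)
    then have "n \<le> N" "n \<in> S" using N component_outside[OF z(1)] by (auto intro: leI)
    then show "d \<in> degree_of ` ?N" using n by simp
  qed
  have fN: "finite ?N" by simp
  have NS: "degree_of ` ?N \<subseteq> D" using degree_of_S by auto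
  have wV: "w d \<in> carrier Q.V" if "d \<in> D" for d using wC C_subset that by auto
  have "X = Q.cls (\<Oplus>n\<in>{..N}. component n z)" using component_sum[OF z(1) N] z(2) by simp
  also have "(\<Oplus>n\<in>{..N}. component n z) = (\<Oplus>n\<in>?N. component n z)"
    using z component_outside[OF z(1)] by (intro R.add.finprod_mono_neutral_cong_right) auto
  also have "Q.cls (\<Oplus>n\<in>?N. component n z) = (\<Oplus>\<^bsub>Q.V\<^esub>n\<in>?N. Q.cls (component n z))"
    using z by (intro Q.cls_finsum) auto
  also have "\<dots> = (\<Oplus>\<^bsub>Q.V\<^esub>n\<in>?N. w (degree_of n))"
    using wdeg wV z by (intro Q.V.finsum_cong') auto
  also have "\<dots> = (\<Oplus>\<^bsub>Q.V\<^esub>d\<in>degree_of ` ?N. w d)"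
    using wV NS by (intro Q.V.finsum_reindex[symmetric]) (auto simp: inj_on_def)
  also have "\<dots> = (\<Oplus>\<^bsub>Q.V\<^esub>d\<in>?T. w d)"
    using T NS wV fN by (intro Q.V.add.finprod_mono_neutral_cong_right) auto
  finally have "X = (\<Oplus>\<^bsub>Q.V\<^esub>d\<in>?T. w d)" .
  moreover have "finite ?T" using finite_subset[OF T] fN by blast
  ultimately show ?thesis using wC by blast
qed

lemma component_mult_homogeneous:
  assumes x: "x \<in> carrier R" and y: "y \<in> carrier R"
  shows "component m x \<otimes> component n y = component (m + n) (component m x \<otimes> component n y)"
proof -
  have "component (m + n) (component m x \<otimes> component n y) =
    (\<Oplus>i\<in>{..m + n}. component i (component m x) \<otimes> component (m + n - i) (component n y))"
    using x y by (simp add: component_mult)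
  also have "\<dots> = (\<Oplus>i\<in>{..m + n}. if m = i then component m x \<otimes> component n y else \<zero>)"
    using x y by (intro R.finsum_cong') (auto simp: component_component)
  also have "\<dots> = component m x \<otimes> component n y"
    by (rule R.finsum_singleton) (use x y in auto)
  finally show ?thesis ..
qed

text \<open>
  A product of homogeneous elements equals its component in the sum of the degrees by the product rule for
  components.
\<close>

lemma C_mult:
  assumes "X \<in> C d" "Y \<in> C e"
  shows "X \<otimes>\<^bsub>Q.V\<^esub> Y \<in> C (d + e)"
proof -
  have XY: "X \<in> carrier Q.V" "Y \<in> carrier Q.V" using assms C_subset by auto
  have zero: "\<zero>\<^bsub>Q.V\<^esub> \<in> C (d + e)" by (simp add: C_eq)
  show ?thesis
  proof (cases "X = \<zero>\<^bsub>Q.V\<^esub> \<or> Y = \<zero>\<^bsub>Q.V\<^esub>")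
    case True
    then show ?thesis using zero XY by auto
  next
    case False
    then obtain m x n y where x: "x \<in> carrier R" "X = Q.cls (component m x)" "d = degree_of m"
      and y: "y \<in> carrier R" "Y = Q.cls (component n y)" "e = degree_of n"
      using assms by (auto simp: C_eq)
    have "X \<otimes>\<^bsub>Q.V\<^esub> Y = Q.cls (component (m + n) (component m x \<otimes> component n y))"
      using x y component_mult_homogeneous[OF x(1) y(1), of m n, symmetric] by simp
    moreover have "d + e = degree_of (m + n)" using x y by (simp add: degree_of_add)
    moreover have "component m x \<otimes> component n y \<in> carrier R" using x y by simp
    ultimately show ?thesis using C_degree_of by auto
  qed
qed

lemma graded: "graded_algebra K Q.V D C"
  unfolding graded_algebra_def
proof (intro conjI ballI)
  show "algebra K Q.V" by (rule Q.V_algebra)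
  show "submodule (C d) K Q.V" for d by (rule C_submodule)
  show "\<one>\<^bsub>Q.V\<^esub> \<in> C 0"
  proof -
    have "\<one>\<^bsub>Q.V\<^esub> = Q.cls (component 0 \<one>)" by (simp add: Q.cls_one component_one)
    moreover have "(0 :: rat) = degree_of 0" by (simp add: degree_of_def)
    ultimately show ?thesis using C_degree_of[of 0] by auto
  qed
  show "X \<otimes>\<^bsub>Q.V\<^esub> Y \<in> C (d + e)" if "X \<in> C d" "Y \<in> C e" for d e X Y by (rule C_mult[OF that])
  fix X assume X: "X \<in> carrier Q.V"
  obtain w where w: "w \<in> (\<Pi>\<^sub>E d\<in>D. C d)" "finite {d \<in> D. w d \<noteq> \<zero>\<^bsub>Q.V\<^esub>}"
    "X = (\<Oplus>\<^bsub>Q.V\<^esub>d\<in>{d \<in> D. w d \<noteq> \<zero>\<^bsub>Q.V\<^esub>}. w d)"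
    using decomposition_exists[OF X] by (elim exE conjE)
  show "\<exists>!w. w \<in> (\<Pi>\<^sub>E d\<in>D. C d) \<and> finite {d \<in> D. w d \<noteq> \<zero>\<^bsub>Q.V\<^esub>} \<and>
    X = (\<Oplus>\<^bsub>Q.V\<^esub>d\<in>{d \<in> D. w d \<noteq> \<zero>\<^bsub>Q.V\<^esub>}. w d)"
  proof (rule ex1I[of _ w])
    show "w \<in> (\<Pi>\<^sub>E d\<in>D. C d) \<and> finite {d \<in> D. w d \<noteq> \<zero>\<^bsub>Q.V\<^esub>} \<and>
      X = (\<Oplus>\<^bsub>Q.V\<^esub>d\<in>{d \<in> D. w d \<noteq> \<zero>\<^bsub>Q.V\<^esub>}. w d)"
      by (intro conjI w)
    show "v = w" if "v \<in> (\<Pi>\<^sub>E d\<in>D. C d) \<and> finite {d \<in> D. v d \<noteq> \<zero>\<^bsub>Q.V\<^esub>} \<and>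
      X = (\<Oplus>\<^bsub>Q.V\<^esub>d\<in>{d \<in> D. v d \<noteq> \<zero>\<^bsub>Q.V\<^esub>}. v d)" for v
      using that by (elim conjE) (rule trans[OF decomposition_unique decomposition_unique[OF w, symmetric]])
  qed
qed

text \<open>
  The augmentation vanishes on the odd ideal and is the identity on scalars, so scalars are determined by their
  classes; and it factors the component of degree zero through the scalars.
\<close>

lemma connected: "connected_grading K Q.V C"
proof -
  obtain \<epsilon> where \<epsilon>: "\<epsilon> \<in> superhom K R (scalars K)"
    and comp: "\<And>z. z \<in> carrier R \<Longrightarrow> component 0 z = \<epsilon> z \<odot> \<one>"
    using augmentation by blast
  have e: "\<epsilon> \<in> ring_hom R (scalars K)" "\<And>x. x \<in> carrier R \<Longrightarrow> \<epsilon> x \<in> carrier K"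
    "\<epsilon> \<one> = \<one>\<^bsub>K\<^esub>" "\<And>c x. \<lbrakk>c \<in> carrier K; x \<in> carrier R\<rbrakk> \<Longrightarrow> \<epsilon> (c \<odot> x) = c \<otimes>\<^bsub>K\<^esub> \<epsilon> x"
    "\<And>x. x \<in> odds R \<Longrightarrow> \<epsilon> x = \<zero>\<^bsub>K\<^esub>"
    using superhomD(1)[OF \<epsilon>] superhomD(3)[OF \<epsilon>] superhomD(6)[OF \<epsilon>] superhomD(7)[OF \<epsilon>] superhomD(9)[OF \<epsilon>]
    by simp_all
  have sc: "superalgebra K (scalars K)"
    by (rule comm_superalgebra_superalgebra[OF comm_superalgebra_scalars[OF R.R.is_cring]])
  note h = ring_hom_ringI2[OF R.ring_axioms superalgebra.axioms(2)[OF sc] e(1)]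
  have "\<epsilon> x = \<zero>\<^bsub>K\<^esub>" if "x \<in> Q.I" for x
  proof -
    have "odds R \<subseteq> a_kernel R (scalars K) \<epsilon>" using e(5) by (auto simp: a_kernel_def')
    then show ?thesis using Q.I_minimal[OF ring_hom_ring.kernel_is_ideal[OF h]] that by (auto simp: a_kernel_def')
  qed
  note eI = this
  have deg0: "C 0 = (\<lambda>z. Q.cls (component 0 z)) ` carrier R"
    using C_degree_of[of 0] by (simp add: degree_of_def)
  have one: "c \<odot>\<^bsub>Q.V\<^esub> \<one>\<^bsub>Q.V\<^esub> = Q.cls (c \<odot> \<one>)" if "c \<in> carrier K" for c
    using that by (simp add: Q.cls_one)
  have ec: "\<epsilon> (c \<odot> \<one>) = c" if "c \<in> carrier K" for c
    using that e(3,4) by simp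
  show ?thesis
    unfolding connected_grading_def bij_betw_def
  proof
    show "inj_on (\<lambda>c. c \<odot>\<^bsub>Q.V\<^esub> \<one>\<^bsub>Q.V\<^esub>) (carrier K)"
    proof (rule inj_onI)
      fix c c' assume c: "c \<in> carrier K" "c' \<in> carrier K" and "c \<odot>\<^bsub>Q.V\<^esub> \<one>\<^bsub>Q.V\<^esub> = c' \<odot>\<^bsub>Q.V\<^esub> \<one>\<^bsub>Q.V\<^esub>"
      then have "c \<odot> \<one> \<ominus> c' \<odot> \<one> \<in> Q.I" by (simp add: one Q.cls_eq_iff)
      moreover have "c \<odot> \<one> \<ominus> c' \<odot> \<one> = (c \<ominus>\<^bsub>K\<^esub> c') \<odot> \<one>"
        using c by (simp add: R.minus_eq R.R.minus_eq R.smult_l_distr R.smult_l_minus)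
      ultimately have "c \<ominus>\<^bsub>K\<^esub> c' = \<zero>\<^bsub>K\<^esub>" using eI ec[of "c \<ominus>\<^bsub>K\<^esub> c'"] c by simp
      then show "c = c'" using c R.R.r_right_minus_eq by blast
    qed
    show "(\<lambda>c. c \<odot>\<^bsub>Q.V\<^esub> \<one>\<^bsub>Q.V\<^esub>) ` carrier K = C 0"
    proof
      show "(\<lambda>c. c \<odot>\<^bsub>Q.V\<^esub> \<one>\<^bsub>Q.V\<^esub>) ` carrier K \<subseteq> C 0"
      proof
        fix X assume "X \<in> (\<lambda>c. c \<odot>\<^bsub>Q.V\<^esub> \<one>\<^bsub>Q.V\<^esub>) ` carrier K"
        then obtain c where c: "c \<in> carrier K" "X = Q.cls (c \<odot> \<one>)" using one by auto
        then have "X = Q.cls (component 0 (c \<odot> \<one>))" by (simp add: component_smult component_one)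
        then show "X \<in> C 0" unfolding deg0 using c by auto
      qed
      show "C 0 \<subseteq> (\<lambda>c. c \<odot>\<^bsub>Q.V\<^esub> \<one>\<^bsub>Q.V\<^esub>) ` carrier K"
        unfolding deg0 using comp e(2) one by (auto intro!: image_eqI)
    qed
  qed
qed

end

section \<open>Functoriality in G\<close>

context Hom_representation
begin

text \<open>
  Yoneda's lemma: the comorphism is the homomorphism that represents the image of the universal point.
\<close>

lemma Hom_comorphism_spec:
  assumes H': "Hom_representation K p r s G' R' rep'" and f: "supergroup_scheme_hom K G G' f"
  defines "F \<equiv> Hom_comorphism K p r s R rep R' rep' f"
  shows "F \<in> superhom K R' R"
    and "\<And>A h. \<lbrakk>comm_superalgebra K A; h \<in> superhom K R A\<rbrakk> \<Longrightarrow>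
      rep' A (compose (carrier R') h F) = pushforward K M f A (rep A h)"
proof -
  interpret H': Hom_representation K p r s G' R' rep' by fact
  let ?id = "\<lambda>x\<in>carrier R. x"
  let ?P = "\<lambda>F. F \<in> superhom K R' R \<and> (\<forall>A. comm_superalgebra K A \<longrightarrow> (\<forall>h \<in> superhom K R A.
        rep' A (compose (carrier R') h F) = pushforward K M f A (rep A h)))"
  have "pushforward K M f R (rep R ?id) \<in> rep' R ` superhom K R' R"
    using pushforward_closed[OF f rep_closed[OF R_comm R_id]] H'.rep_bij[OF R_comm] by (simp add: bij_betw_def)
  then obtain F0 where F0: "F0 \<in> superhom K R' R" "rep' R F0 = pushforward K M f R (rep R ?id)"
    by (metis imageE)
  have "?P F0"
  proof (intro conjI allI impI ballI F0(1))
    fix A :: "('u, 'u) superalg" and h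
    assume A: "comm_superalgebra K A" and h: "h \<in> superhom K R A"
    have "compose (carrier R) h ?id = h"
      using superhomD(2)[OF h] by (auto simp: compose_def fun_eq_iff extensional_def)
    then have "rep A h = base_change K R A h (rep R ?id)" using rep_natural[OF R_comm A h R_id] by simp
    then show "rep' A (compose (carrier R') h F0) = pushforward K M f A (rep A h)"
      using H'.rep_natural[OF R_comm A h F0(1)] base_change_pushforward[OF R_comm h, of f "rep R ?id"]
      by (simp add: F0(2))
  qed
  moreover have "F1 = F0" if F1: "?P F1" for F1
  proof -
    have c: "compose (carrier R') ?id F' = F'" if "F' \<in> superhom K R' R" for F'
      using superhomD(2,3)[OF that] by (auto simp: compose_def fun_eq_iff extensional_def)
    have "rep' R F1 = pushforward K M f R (rep R ?id)"
      using F1 R_comm R_id c[of F1] by metis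
    then show ?thesis using F1 F0 by (intro H'.rep_inj[OF R_comm]) auto
  qed
  ultimately have "?P F" unfolding F_def Hom_comorphism_def by (rule theI)
  then show "F \<in> superhom K R' R" "\<And>A h. \<lbrakk>comm_superalgebra K A; h \<in> superhom K R A\<rbrakk> \<Longrightarrow>
      rep' A (compose (carrier R') h F) = pushforward K M f A (rep A h)"
    by blast+
qed

text \<open>
  Composition with the homomorphism from \<open>G\<close> to \<open>G'\<close> commutes with the action, so following the comorphism by the
  coaction of \<open>R\<close> gives the same as applying the comorphism to the coefficients of the coaction of \<open>R'\<close>. Coefficients
  are compared in \<open>R[S]\<close>.
\<close>

lemma Hom_comorphism_component:
  assumes H': "Hom_representation K p r s G' R' rep'" and f: "supergroup_scheme_hom K G G' f"
    and z: "z \<in> carrier R'"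
  defines "F \<equiv> Hom_comorphism K p r s R rep R' rep' f"
  shows "F (Hom_representation.component K p r s R' rep' n z) = component n (F z)"
proof -
  interpret H': Hom_representation K p r s G' R' rep' by fact
  note F = Hom_comorphism_spec[OF H' f, folded F_def]
  obtain \<iota> where "weighted_poly K p r s R \<iota>" using weighted_poly_ex by blast
  then interpret W: weighted_poly K p r s R \<iota> .
  obtain \<iota>' where "weighted_poly K p r s R' \<iota>'" using H'.weighted_poly_ex by blast
  then interpret W': weighted_poly K p r s R' \<iota>' .
  note A = W.comm_superalgebra_A and c = W.const_superhom
  let ?b = "(W.tpow q, W.tpow 2)"
  have b: "?b \<in> Spec_B p r W.A" using W.scaled_point[of 1] by simp
  note cF = superhom_compose[OF H'.R.superalgebra_axioms F(1) c]
  have "compose (carrier R') (act W.A W.const ?b) F = H'.act W.A (compose (carrier R') W.const F) ?b"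
  proof (rule H'.rep_inj[OF A])
    show "compose (carrier R') (act W.A W.const ?b) F \<in> superhom K R' W.A"
      by (rule superhom_compose[OF H'.R.superalgebra_axioms F(1) act_superhom[OF A c b]])
    show "H'.act W.A (compose (carrier R') W.const F) ?b \<in> superhom K R' W.A"
      by (rule H'.act_superhom[OF A cF b])
    show "rep' W.A (compose (carrier R') (act W.A W.const ?b) F) =
      rep' W.A (H'.act W.A (compose (carrier R') W.const F) ?b)"
      unfolding F(2)[OF A act_superhom[OF A c b]] rep_act[OF A c b] H'.rep_act[OF A cF b] F(2)[OF A c]
      by (rule right_action_pushforward[OF A b, symmetric])
  qed
  from fun_cong[OF this, of z]
  have eq: "act W.A W.const ?b (F z) = H'.act W.A (compose (carrier R') W.const F) ?b z"
    unfolding compose_eq[OF z] .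
  have Fz: "F z \<in> carrier R" using superhomD(3)[OF F(1) z] .
  have left: "act W.A W.const ?b (F z) = \<iota> (\<lambda>n. component n (F z))"
    unfolding act_eq_evaluate[OF A c b Fz] by (rule W.evaluate_universal[OF component_poly[OF Fz]])
  obtain N where N: "\<And>n. n > N \<Longrightarrow> H'.component n z = \<zero>\<^bsub>R'\<^esub>" using H'.component_bound[OF z] by blast
  have F0: "F \<zero>\<^bsub>R'\<^esub> = \<zero>"
    by (rule superhom_zero[OF H'.R.superalgebra_axioms R.superalgebra_axioms F(1)])
  let ?u = "\<lambda>n. F (H'.component n z)"
  have u: "?u \<in> W.X"
    by (rule W.XI[of _ N]) (use z superhomD(3)[OF F(1)] N F0 H'.component_outside[OF z] in auto)
  have "H'.act W.A (compose (carrier R') W.const F) ?b z =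
    evaluate R' W.A q (compose (carrier R') W.const F) ?b (\<lambda>n. H'.component n z)"
    by (rule H'.act_eq_evaluate[OF A cF b z])
  also have "\<dots> = (\<Oplus>\<^bsub>W.A\<^esub>n\<in>{..N}. compose (carrier R') W.const F (H'.component n z) \<otimes>\<^bsub>W.A\<^esub> weight_power W.A q ?b n)"
    by (rule W'.evaluate_bound[OF A cF b H'.component_poly[OF z]]) (rule N)
  also have "\<dots> = (\<Oplus>\<^bsub>W.A\<^esub>n\<in>{..N}. W.const (?u n) \<otimes>\<^bsub>W.A\<^esub> weight_power W.A q ?b n)"
    using z by (simp add: compose_eq)
  also have "\<dots> = evaluate R W.A q W.const ?b ?u"
    by (rule W.evaluate_bound[OF A c b u, symmetric]) (simp add: N F0)
  also have "\<dots> = \<iota> ?u" by (rule W.evaluate_universal[OF u])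
  finally have "\<iota> (\<lambda>n. component n (F z)) = \<iota> ?u" using left eq by simp
  then have "W.coef (\<iota> (\<lambda>n. component n (F z))) = W.coef (\<iota> ?u)" by (rule arg_cong)
  then have "(\<lambda>n. component n (F z)) = ?u"
    unfolding W.coef_\<iota>[OF component_poly[OF Fz]] W.coef_\<iota>[OF u] .
  from fun_cong[OF this, of n] show ?thesis by (rule sym)
qed

lemma V_comorphism_cls:
  assumes H': "Hom_representation K p r s G' R' rep'" and f: "supergroup_scheme_hom K G G' f"
    and z: "z \<in> carrier R'"
  defines "F \<equiv> Hom_comorphism K p r s R rep R' rep' f"
  shows "V_comorphism K p r s R rep R' rep' f (odd_quotient.cls R' z) = Q.cls (F z)"
proof -
  interpret H': Hom_representation K p r s G' R' rep' by fact
  note F = Hom_comorphism_spec(1)[OF H' f, folded F_def]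
  note h = ring_hom_ringI2[OF H'.R.ring_axioms R.ring_axioms superhomD(1)[OF F]]
  have "odds R' \<subseteq> {x \<in> carrier R'. F x \<in> Q.I}" using superhomD(9)[OF F] Q.odds_I by auto
  from H'.Q.I_minimal[OF ring_hom_ring.ideal_vimage[OF h Q.ideal_odd_ideal] this]
  have FI: "F x \<in> Q.I" if "x \<in> H'.Q.I" for x using that by auto
  have "Q.cls (F w) = Q.cls (F z)" if "w \<in> H'.Q.cls z" for w
  proof -
    have w: "w \<in> carrier R'" "w \<ominus>\<^bsub>R'\<^esub> z \<in> H'.Q.I"
      using H'.Q.mem_cls[OF z that] H'.Q.cls_eq_iff[OF _ z, of w] by auto
    have "F w = F ((w \<ominus>\<^bsub>R'\<^esub> z) \<oplus>\<^bsub>R'\<^esub> z)"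
      using w z by (simp add: H'.R.minus_eq H'.R.a_assoc H'.R.l_neg)
    also have "\<dots> = F (w \<ominus>\<^bsub>R'\<^esub> z) \<oplus> F z" using w z superhomD(4)[OF F] by simp
    finally have "Q.cls (F w) = Q.cls (F (w \<ominus>\<^bsub>R'\<^esub> z)) \<oplus>\<^bsub>Q.V\<^esub> Q.cls (F z)"
      using w z superhomD(3)[OF F] by simp
    also have "Q.cls (F (w \<ominus>\<^bsub>R'\<^esub> z)) = \<zero>\<^bsub>Q.V\<^esub>"
      using FI[OF w(2)] by (simp add: Q.cls_eq_zero_iff)
    finally show ?thesis using z superhomD(3)[OF F] by simp
  qed
  then have "(\<Union>w\<in>H'.Q.cls z. Q.cls (F w)) = (\<Union>w\<in>H'.Q.cls z. Q.cls (F z))" by (intro SUP_cong refl)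
  also have "\<dots> = Q.cls (F z)" using H'.Q.cls_self[OF z] by blast
  finally show ?thesis unfolding V_comorphism_def F_def[symmetric] Q.cls_def .
qed

lemma V_comorphism_graded:
  assumes H': "Hom_representation K p r s G' R' rep'" and f: "supergroup_scheme_hom K G G' f"
  defines "\<Phi> \<equiv> V_comorphism K p r s R rep R' rep' f"
  shows "\<Phi> \<in> algebra_hom K (V_algebra R') Q.V"
    and "\<Phi> ` V_component K p r s R' rep' d \<subseteq> C d"
proof -
  interpret H': Hom_representation K p r s G' R' rep' by fact
  define F where "F = Hom_comorphism K p r s R rep R' rep' f"
  note F = Hom_comorphism_spec(1)[OF H' f, folded F_def]
  note FD = superhomD[OF F]
  have \<Phi>: "\<Phi> (H'.Q.cls z) = Q.cls (F z)" if "z \<in> carrier R'" for z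
    unfolding \<Phi>_def F_def by (rule V_comorphism_cls[OF H' f that])
  have V': "\<exists>x\<in>carrier R'. X = H'.Q.cls x" if "X \<in> carrier H'.Q.V" for X
    using that by (auto simp: H'.Q.V_carrier)
  have "\<Phi> \<in> ring_hom H'.Q.V Q.V"
  proof (rule ring_hom_memI)
    fix X assume "X \<in> carrier H'.Q.V"
    then obtain x where x: "x \<in> carrier R'" "X = H'.Q.cls x" using V' by blast
    show "\<Phi> X \<in> carrier Q.V" using x FD(3)[OF x(1)] by (simp add: \<Phi>)
    fix Y assume "Y \<in> carrier H'.Q.V"
    then obtain y where y: "y \<in> carrier R'" "Y = H'.Q.cls y" using V' by blast
    show "\<Phi> (X \<otimes>\<^bsub>H'.Q.V\<^esub> Y) = \<Phi> X \<otimes>\<^bsub>Q.V\<^esub> \<Phi> Y" "\<Phi> (X \<oplus>\<^bsub>H'.Q.V\<^esub> Y) = \<Phi> X \<oplus>\<^bsub>Q.V\<^esub> \<Phi> Y"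
      using x y FD(3)[OF x(1)] FD(3)[OF y(1)] FD(4,5)[OF x(1) y(1)] by (simp_all add: \<Phi>)
  next
    show "\<Phi> \<one>\<^bsub>H'.Q.V\<^esub> = \<one>\<^bsub>Q.V\<^esub>"
      using FD(6) \<Phi>[OF H'.R.one_closed] by (simp add: H'.Q.cls_one Q.cls_one)
  qed
  moreover have "\<Phi> (c \<odot>\<^bsub>H'.Q.V\<^esub> X) = c \<odot>\<^bsub>Q.V\<^esub> \<Phi> X" if c: "c \<in> carrier K" and X: "X \<in> carrier H'.Q.V" for c X
  proof -
    obtain x where x: "x \<in> carrier R'" "X = H'.Q.cls x" using V'[OF X] by blast
    show ?thesis using x c FD(3)[OF x(1)] FD(7)[OF c x(1)] by (simp add: \<Phi>)
  qed
  ultimately show "\<Phi> \<in> algebra_hom K (V_algebra R') Q.V" by (simp add: algebra_hom_def)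
  show "\<Phi> ` V_component K p r s R' rep' d \<subseteq> C d"
  proof
    fix Y assume "Y \<in> \<Phi> ` H'.C d"
    then obtain X where X: "X \<in> H'.C d" "Y = \<Phi> X" by blast
    consider n z where "z \<in> carrier R'" "d = degree_of n" "X = H'.Q.cls (H'.component n z)" | "X = \<zero>\<^bsub>H'.Q.V\<^esub>"
      using X(1) unfolding H'.C_eq H'.degree_of_def degree_of_def by blast
    then show "Y \<in> C d"
    proof cases
      case 1
      then have "Y = Q.cls (component n (F z))"
        using Hom_comorphism_component[OF H' f 1(1), folded F_def] X(2) by (simp add: \<Phi>)
      then show ?thesis using 1 FD(3) by (auto simp: C_degree_of)
    next
      case 2
      have "F \<zero>\<^bsub>R'\<^esub> = \<zero>"
        by (rule superhom_zero[OF H'.R.superalgebra_axioms R.superalgebra_axioms F])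
      then have "Y = \<zero>\<^bsub>Q.V\<^esub>"
        using \<Phi>[OF H'.R.zero_closed] X(2) 2 by (simp add: H'.Q.cls_zero Q.cls_zero)
      then show ?thesis by (simp add: C_eq)
    qed
  qed
qed

end

theorem corollary3p4p3:
  fixes K :: "'u ring" and p r s :: nat
    and G :: "('u, 'g) group_functor" and R :: "('u, 'u) superalg" and rep :: "('u, 'g) Hom_rep"
  assumes "infinite (UNIV :: 'u set)"
    and "field K" and "has_characteristic K p" and "p \<ge> 3"
    and "r \<ge> 1" and "s \<ge> 1"
    and "algebraic_supergroup_scheme K G"
    and "is_coordinate_superalgebra_of_Hom K p r s G R rep"
  shows "graded_algebra K (V_algebra R) (degree_group p r) (V_component K p r s R rep) \<and>
    connected_grading K (V_algebra R) (V_component K p r s R rep) \<and>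
    (\<forall>(G' :: ('u, 'h) group_functor) R' rep' f.
       algebraic_supergroup_scheme K G' \<and>
       is_coordinate_superalgebra_of_Hom K p r s G' R' rep' \<and>
       supergroup_scheme_hom K G G' f \<longrightarrow>
       V_comorphism K p r s R rep R' rep' f \<in> algebra_hom K (V_algebra R') (V_algebra R) \<and>
       (\<forall>d \<in> degree_group p r.
          V_comorphism K p r s R rep R' rep' f ` V_component K p r s R' rep' d
            \<subseteq> V_component K p r s R rep d))"
proof -
  have M: "M_setting K p r s" by (intro M_setting.intro assms)
  have rep: "Hom_representation K p r s H Q rep_H"
    if "algebraic_supergroup_scheme K H" "is_coordinate_superalgebra_of_Hom K p r s H Q rep_H"
    for H :: "('u, 'x) group_functor" and Q rep_H
    using M that by (intro Hom_representation.intro Hom_representation_axioms.intro)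
      (auto simp: algebraic_supergroup_scheme_def)
  interpret Hom_representation K p r s G R rep by (rule rep[OF assms(7,8)])
  show ?thesis
    using graded connected V_comorphism_graded[OF rep] by blast
qed

end
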